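(* Let $G$ be a group, $R$ a commutative associative unital ring, and $Q$ an $R$-module. Let $\gamma_1=G$, $\gamma_{i+1}=[G,\gamma_i]$ be the lower central series of $G$ and let $1=\zeta^0\leq\zeta^1\leq\zeta^2\leq\cdots$ be its upper central series. Then $$L^*(\zeta;Q)=\bigoplus_{i>0}\hom_{\mathbb{Z}}(\zeta^i/\zeta^{i-1},Q)$$ is a graded Lie module for the graded Lie ring $L_*(\gamma)\otimes_{\mathbb{Z}}R$, where $L_*(\gamma)=\bigoplus_{i>0}\gamma_i/\gamma_{i+1}$, under the natural action: for $i,j>0$, $x\in\gamma_i$, $r\in R$ and $f\in\hom_{\mathbb{Z}}(\zeta^j/\zeta^{j-1},Q)$, the element $(\bar x\otimes r)\cdot f\in\hom_{\mathbb{Z}}(\zeta^{i+j}/\zeta^{i+j-1},Q)$ is the map $$\bar y\mapsto -r\,f\big(\overline{[x,y]}\big)\qquad (y\in\zeta^{i+j}),$$ where $\overline{[x,y]}$ is the class of $[x,y]$ in $\zeta^j/\zeta^{j-1}$.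
   Context: Commutators in a group are $[g,h]=g^{-1}h^{-1}gh$, and $[X,Y]=\langle [x,y]:x\in X,y\in Y\rangle$. The upper central series is given by $\zeta^0=1$ and $\zeta^{i+1}/\zeta^i$ is the center of $G/\zeta^i$. Bars denote classes in the relevant quotient groups. $L_*(\gamma)$ is the graded Lie ring whose addition on each $\gamma_i/\gamma_{i+1}$ is induced by group multiplication and whose Lie product is the biadditive extension of $\bar x\circ\bar y=\overline{[x,y]}\in\gamma_{i+j}/\gamma_{i+j+1}$ for $x\in\gamma_i$, $y\in\gamma_j$; the product on $L_*(\gamma)\otimes_{\mathbb{Z}} R$ is $(\bar x\otimes r)\circ(\bar y\otimes r')=(\bar x\circ\bar y)\otimes rr'$. A graded Lie module for a graded Lie ring $L=\bigoplus_i L_i$ is a graded abelian group $V=\bigoplus_j V^j$ with a biadditive action satisfying $(a\circ b)\cdot v=a\cdot(b\cdot v)-b\cdot(a\cdot v)$ and $L_i\cdot V^j\subseteq V^{i+j}$; here the action is moreover $R$-bilinear. *)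

theory Defs
  imports "HOL-Algebra.Algebra"
begin

text \<open>
  Additive structures are carried by the \<open>ring\<close> and \<open>module\<close> records. A Lie ring uses \<open>\<otimes>\<close> for its
  Lie product; its field \<open>one\<close> is meaningless, and so are \<open>mult\<close> and \<open>one\<close> of a module.
  Gradings are internal and indexed by the positive integers: the subgroup \<open>H i\<close> is the component
  of degree \<open>i\<close>, and the values of \<open>H\<close> at \<open>0\<close> are ignored.
\<close>

locale graded_abelian_group = abelian_group V for V (structure) +
  fixes H :: "nat \<Rightarrow> 'a set"
  assumes component_subgroup: "0 < i \<Longrightarrow> additive_subgroup (H i) V"
    and direct_sum:
      "(\<lambda>h. gfinprod (add_monoid V) h {0<..})
         \<in> iso (sum_group {0<..} (\<lambda>i. (add_monoid V)\<lparr>carrier := H i\<rparr>)) (add_monoid V)"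

locale lie_ring = abelian_group L for L (structure) +
  assumes lie_closed:
      "\<lbrakk>x \<in> carrier L; y \<in> carrier L\<rbrakk> \<Longrightarrow> x \<otimes> y \<in> carrier L"
    and lie_l_distr:
      "\<lbrakk>x \<in> carrier L; y \<in> carrier L; z \<in> carrier L\<rbrakk> \<Longrightarrow> (x \<oplus> y) \<otimes> z = (x \<otimes> z) \<oplus> (y \<otimes> z)"
    and lie_r_distr:
      "\<lbrakk>x \<in> carrier L; y \<in> carrier L; z \<in> carrier L\<rbrakk> \<Longrightarrow> x \<otimes> (y \<oplus> z) = (x \<otimes> y) \<oplus> (x \<otimes> z)"
    and lie_alternating:
      "x \<in> carrier L \<Longrightarrow> x \<otimes> x = \<zero>"
    and lie_jacobi:
      "\<lbrakk>x \<in> carrier L; y \<in> carrier L; z \<in> carrier L\<rbrakk> \<Longrightarrow>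
         x \<otimes> (y \<otimes> z) \<oplus> y \<otimes> (z \<otimes> x) \<oplus> z \<otimes> (x \<otimes> y) = \<zero>"

locale graded_lie_ring = lie_ring L + graded_abelian_group L H
  for L (structure) and H +
  assumes lie_degree:
    "\<lbrakk>0 < i; 0 < j; x \<in> H i; y \<in> H j\<rbrakk> \<Longrightarrow> x \<otimes> y \<in> H (i + j)"

definition biadditive_action ::
  "('l, 'c) ring_scheme \<Rightarrow> ('v, 'd) ring_scheme \<Rightarrow> ('l \<Rightarrow> 'v \<Rightarrow> 'v) \<Rightarrow> bool"
  where "biadditive_action L V act \<longleftrightarrow>
    (\<forall>a\<in>carrier L. \<forall>v\<in>carrier V. act a v \<in> carrier V) \<and>
    (\<forall>a\<in>carrier L. \<forall>b\<in>carrier L. \<forall>v\<in>carrier V.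
       act (a \<oplus>\<^bsub>L\<^esub> b) v = act a v \<oplus>\<^bsub>V\<^esub> act b v) \<and>
    (\<forall>a\<in>carrier L. \<forall>v\<in>carrier V. \<forall>w\<in>carrier V.
       act a (v \<oplus>\<^bsub>V\<^esub> w) = act a v \<oplus>\<^bsub>V\<^esub> act a w)"

locale graded_lie_module = L: graded_lie_ring L H + V: graded_abelian_group V K
  for L (structure) and H and V (structure) and K +
  fixes act :: "'a \<Rightarrow> 'c \<Rightarrow> 'c"
  assumes biadditive: "biadditive_action L V act"
    and act_lie:
      "\<lbrakk>a \<in> carrier L; b \<in> carrier L; v \<in> carrier V\<rbrakk> \<Longrightarrow>
         act (a \<otimes>\<^bsub>L\<^esub> b) v = act a (act b v) \<ominus>\<^bsub>V\<^esub> act b (act a v)"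
    and act_degree:
      "\<lbrakk>0 < i; 0 < j; a \<in> H i; v \<in> K j\<rbrakk> \<Longrightarrow> act a v \<in> K (i + j)"

definition bilinear_action ::
  "('r, 'b) ring_scheme \<Rightarrow> ('r, 'l, 'c) module_scheme \<Rightarrow> ('r, 'v, 'd) module_scheme
    \<Rightarrow> ('l \<Rightarrow> 'v \<Rightarrow> 'v) \<Rightarrow> bool"
  where "bilinear_action R L V act \<longleftrightarrow>
    module R L \<and> module R V \<and> biadditive_action L V act \<and>
    (\<forall>r\<in>carrier R. \<forall>a\<in>carrier L. \<forall>v\<in>carrier V.
       act (r \<odot>\<^bsub>L\<^esub> a) v = r \<odot>\<^bsub>V\<^esub> act a v \<and> act a (r \<odot>\<^bsub>V\<^esub> v) = r \<odot>\<^bsub>V\<^esub> act a v)"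

definition homogeneous :: "(nat \<Rightarrow> ('a, 'b) monoid_scheme) \<Rightarrow> nat \<Rightarrow> 'a \<Rightarrow> nat \<Rightarrow> 'a"
  where "homogeneous A i a = (\<lambda>k\<in>{0<..}. if k = i then a else \<one>\<^bsub>A k\<^esub>)"

definition commutator :: "('a, 'b) monoid_scheme \<Rightarrow> 'a \<Rightarrow> 'a \<Rightarrow> 'a"
  where "commutator G g h = inv\<^bsub>G\<^esub> g \<otimes>\<^bsub>G\<^esub> inv\<^bsub>G\<^esub> h \<otimes>\<^bsub>G\<^esub> g \<otimes>\<^bsub>G\<^esub> h"

definition commutator_subgroup :: "('a, 'b) monoid_scheme \<Rightarrow> 'a set \<Rightarrow> 'a set \<Rightarrow> 'a set"
  where "commutator_subgroup G A B = generate G {commutator G x y | x y. x \<in> A \<and> y \<in> B}"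

definition group_center :: "('a, 'b) monoid_scheme \<Rightarrow> 'a set"
  where "group_center G = {z \<in> carrier G. \<forall>g\<in>carrier G. z \<otimes>\<^bsub>G\<^esub> g = g \<otimes>\<^bsub>G\<^esub> z}"

text \<open>The series starts in degree \<open>1\<close>; its value at \<open>0\<close> is a dummy.\<close>

fun lower_central :: "('a, 'b) monoid_scheme \<Rightarrow> nat \<Rightarrow> 'a set"
  where
    "lower_central G 0 = carrier G"
  | "lower_central G (Suc 0) = carrier G"
  | "lower_central G (Suc (Suc i)) = commutator_subgroup G (carrier G) (lower_central G (Suc i))"

primrec upper_central :: "('a, 'b) monoid_scheme \<Rightarrow> nat \<Rightarrow> 'a set"
  where
    "upper_central G 0 = {\<one>\<^bsub>G\<^esub>}"
  | "upper_central G (Suc i) =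
       {g \<in> carrier G. upper_central G i #>\<^bsub>G\<^esub> g \<in> group_center (G Mod upper_central G i)}"

definition lower_quotient :: "('a, 'b) monoid_scheme \<Rightarrow> nat \<Rightarrow> 'a set monoid"
  where "lower_quotient G i = (G\<lparr>carrier := lower_central G i\<rparr>) Mod lower_central G (i + 1)"

definition upper_quotient :: "('a, 'b) monoid_scheme \<Rightarrow> nat \<Rightarrow> 'a set monoid"
  where "upper_quotient G i = (G\<lparr>carrier := upper_central G i\<rparr>) Mod upper_central G (i - 1)"

text \<open>The classes of \<open>[x, y]\<close>, for \<open>x\<close> and \<open>y\<close> ranging over the cosets \<open>A\<close> and \<open>B\<close>, all coincide, so
  that the union below is a single coset.\<close>

definition lower_bracket ::
  "('a, 'b) monoid_scheme \<Rightarrow> nat \<Rightarrow> nat \<Rightarrow> 'a set \<Rightarrow> 'a set \<Rightarrow> 'a set"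
  where "lower_bracket G i j A B =
    (\<Union>x\<in>A. \<Union>y\<in>B. lower_central G (i + j + 1) #>\<^bsub>G\<^esub> commutator G x y)"

definition lower_lie_ring :: "('a, 'b) monoid_scheme \<Rightarrow> (nat \<Rightarrow> 'a set) ring"
  where "lower_lie_ring G = (let S = sum_group {0<..} (lower_quotient G) in
    \<lparr>carrier = carrier S,
     monoid.mult = (\<lambda>a b. \<lambda>k\<in>{0<..}.
       finprod (lower_quotient G k) (\<lambda>i. lower_bracket G i (k - i) (a i) (b (k - i))) {0<..<k}),
     monoid.one = undefined,
     ring.zero = \<one>\<^bsub>S\<^esub>,
     ring.add = monoid.mult S\<rparr>)"

definition tensor_relations ::
  "('l, 'c) ring_scheme \<Rightarrow> ('r, 'd) ring_scheme \<Rightarrow> ('l \<times> 'r \<Rightarrow>\<^sub>0 int) set"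
  where "tensor_relations L R = generate (free_Abelian_group (carrier L \<times> carrier R))
    ({frag_of (a \<oplus>\<^bsub>L\<^esub> b, r) - frag_of (a, r) - frag_of (b, r) | a b r.
        a \<in> carrier L \<and> b \<in> carrier L \<and> r \<in> carrier R} \<union>
     {frag_of (a, r \<oplus>\<^bsub>R\<^esub> s) - frag_of (a, r) - frag_of (a, s) | a r s.
        a \<in> carrier L \<and> r \<in> carrier R \<and> s \<in> carrier R})"

definition tensor_class ::
  "('l, 'c) ring_scheme \<Rightarrow> ('r, 'd) ring_scheme \<Rightarrow> ('l \<times> 'r \<Rightarrow>\<^sub>0 int) \<Rightarrow> ('l \<times> 'r \<Rightarrow>\<^sub>0 int) set"
  where "tensor_class L R c =
    tensor_relations L R #>\<^bsub>free_Abelian_group (carrier L \<times> carrier R)\<^esub> c"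

definition tensor_group ::
  "('l, 'c) ring_scheme \<Rightarrow> ('r, 'd) ring_scheme \<Rightarrow> ('l \<times> 'r \<Rightarrow>\<^sub>0 int) set monoid"
  where "tensor_group L R =
    free_Abelian_group (carrier L \<times> carrier R) Mod tensor_relations L R"

definition pure_tensor ::
  "('l, 'c) ring_scheme \<Rightarrow> ('r, 'd) ring_scheme \<Rightarrow> 'l \<Rightarrow> 'r \<Rightarrow> ('l \<times> 'r \<Rightarrow>\<^sub>0 int) set"
  where "pure_tensor L R a r = tensor_class L R (frag_of (a, r))"

text \<open>Extension of scalars of a Lie ring \<open>L\<close> to a commutative ring \<open>R\<close>: the Lie product is induced by
  the biadditive map on formal sums with \<open>(a, r), (b, s) \<mapsto> (a \<otimes> b, r \<otimes> s)\<close>, and the scalar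
  multiplication by the additive one with \<open>(a, s) \<mapsto> (a, r \<otimes> s)\<close>.\<close>

definition tensor_lie_ring ::
  "('l, 'c) ring_scheme \<Rightarrow> ('r, 'd) ring_scheme \<Rightarrow> ('r, ('l \<times> 'r \<Rightarrow>\<^sub>0 int) set) module"
  where "tensor_lie_ring L R =
    \<lparr>carrier = carrier (tensor_group L R),
     monoid.mult = (\<lambda>A B. \<Union>c\<in>A. \<Union>d\<in>B. tensor_class L R
       (frag_extend (\<lambda>(a, r). frag_extend (\<lambda>(b, s). frag_of (a \<otimes>\<^bsub>L\<^esub> b, r \<otimes>\<^bsub>R\<^esub> s)) d) c)),
     monoid.one = undefined,
     ring.zero = \<one>\<^bsub>tensor_group L R\<^esub>,
     ring.add = monoid.mult (tensor_group L R),
     module.smult = (\<lambda>r A. \<Union>c\<in>A. tensor_class L R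
       (frag_extend (\<lambda>(a, s). frag_of (a, r \<otimes>\<^bsub>R\<^esub> s)) c))\<rparr>"

definition lower_lie_tensor ::
  "('a, 'b) monoid_scheme \<Rightarrow> ('r, 'd) ring_scheme
    \<Rightarrow> ('r, ((nat \<Rightarrow> 'a set) \<times> 'r \<Rightarrow>\<^sub>0 int) set) module"
  where "lower_lie_tensor G R = tensor_lie_ring (lower_lie_ring G) R"

text \<open>The image of \<open>L\<^sub>i \<otimes> R\<close> in \<open>L \<otimes> R\<close>.\<close>

definition lower_lie_tensor_component ::
  "('a, 'b) monoid_scheme \<Rightarrow> ('r, 'd) ring_scheme
    \<Rightarrow> nat \<Rightarrow> ((nat \<Rightarrow> 'a set) \<times> 'r \<Rightarrow>\<^sub>0 int) set set"
  where "lower_lie_tensor_component G R i = generate (add_monoid (lower_lie_tensor G R))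
    {pure_tensor (lower_lie_ring G) R (homogeneous (lower_quotient G) i A) r | A r.
       A \<in> carrier (lower_quotient G i) \<and> r \<in> carrier R}"

text \<open>Homomorphisms are taken extensional, so that the elements of \<open>hom_group A Q\<close> are equal as soon as
  they agree on the carrier of \<open>A\<close>.\<close>

definition hom_group :: "('a, 'b) monoid_scheme \<Rightarrow> ('q, 'c) ring_scheme \<Rightarrow> ('a \<Rightarrow> 'q) monoid"
  where "hom_group A Q =
    \<lparr>carrier = hom A (add_monoid Q) \<inter> extensional (carrier A),
     monoid.mult = (\<lambda>f g. \<lambda>x\<in>carrier A. f x \<oplus>\<^bsub>Q\<^esub> g x),
     one = (\<lambda>x\<in>carrier A. \<zero>\<^bsub>Q\<^esub>)\<rparr>"

definition upper_hom ::
  "('a, 'b) monoid_scheme \<Rightarrow> ('r, 'q, 'm) module_scheme \<Rightarrow> nat \<Rightarrow> ('a set \<Rightarrow> 'q) monoid"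
  where "upper_hom G Q i = hom_group (upper_quotient G i) Q"

definition upper_dual ::
  "('a, 'b) monoid_scheme \<Rightarrow> ('r, 'q, 'm) module_scheme \<Rightarrow> ('r, nat \<Rightarrow> 'a set \<Rightarrow> 'q) module"
  where "upper_dual G Q = (let S = sum_group {0<..} (upper_hom G Q) in
    \<lparr>carrier = carrier S,
     monoid.mult = undefined,
     monoid.one = undefined,
     ring.zero = \<one>\<^bsub>S\<^esub>,
     ring.add = monoid.mult S,
     module.smult = (\<lambda>r v. \<lambda>i\<in>{0<..}. \<lambda>B\<in>carrier (upper_quotient G i). r \<odot>\<^bsub>Q\<^esub> v i B)\<rparr>)"

definition upper_dual_component ::
  "('a, 'b) monoid_scheme \<Rightarrow> ('r, 'q, 'm) module_scheme \<Rightarrow> nat \<Rightarrow> (nat \<Rightarrow> 'a set \<Rightarrow> 'q) set"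
  where "upper_dual_component G Q i = homogeneous (upper_hom G Q) i ` carrier (upper_hom G Q i)"

definition natural_on_generators ::
  "('a, 'b) monoid_scheme \<Rightarrow> ('r, 'd) ring_scheme \<Rightarrow> ('r, 'q, 'm) module_scheme
    \<Rightarrow> (((nat \<Rightarrow> 'a set) \<times> 'r \<Rightarrow>\<^sub>0 int) set \<Rightarrow> (nat \<Rightarrow> 'a set \<Rightarrow> 'q) \<Rightarrow> (nat \<Rightarrow> 'a set \<Rightarrow> 'q)) \<Rightarrow> bool"
  where "natural_on_generators G R Q act \<longleftrightarrow>
    (\<forall>i>0. \<forall>j>0. \<forall>x\<in>lower_central G i. \<forall>r\<in>carrier R. \<forall>f\<in>carrier (upper_hom G Q j).
      \<exists>g\<in>carrier (upper_hom G Q (i + j)).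
        act (pure_tensor (lower_lie_ring G) R
               (homogeneous (lower_quotient G) i (lower_central G (i + 1) #>\<^bsub>G\<^esub> x)) r)
            (homogeneous (upper_hom G Q) j f)
          = homogeneous (upper_hom G Q) (i + j) g \<and>
        (\<forall>y\<in>upper_central G (i + j).
           commutator G x y \<in> upper_central G j \<and>
           g (upper_central G (i + j - 1) #>\<^bsub>G\<^esub> y)
             = \<ominus>\<^bsub>Q\<^esub> (r \<odot>\<^bsub>Q\<^esub> f (upper_central G (j - 1) #>\<^bsub>G\<^esub> commutator G x y))))"

end

theory Submission
  imports Defs
begin

text \<open>
  Both central series are filtrations of \<open>G\<close> by normal subgroups \<open>M k\<close> for which \<open>[G, M k]\<close> lies in
  the next smaller term \<open>M (s k)\<close>. For such a filtration the three subgroup lemma gives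
  \<open>[\<gamma>\<^sub>i, M k] \<subseteq> M (s\<^sup>i k)\<close>, whence the commutator induces biadditive maps from
  \<open>\<gamma>\<^sub>i/\<gamma>\<^sub>i\<^sub>+\<^sub>1\<close> and \<open>M k/M (s k)\<close> to \<open>M (s\<^sup>i k)/M (s\<^sup>i\<^sup>+\<^sup>1 k)\<close>: the correction terms in
  \<open>[x x', y] = [x, y]\<^sup>x\<^sup>' [x', y]\<close> disappear because the target is a central section
  (\<open>bracket_biadditive\<close>). The Hall--Witt identity becomes the Jacobi identity
  \<open>[[x, y], z] = [x, [y, z]] - [y, [x, z]]\<close> for \<open>z\<close> in a section of \<open>M\<close> (\<open>bracket_jacobi\<close>).

  For the lower series this says that \<open>L\<^sub>*(\<gamma>)\<close> is a graded Lie ring (\<open>lower_graded_lie_ring\<close>). For the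
  upper series the elements of \<open>\<gamma>\<^sub>i/\<gamma>\<^sub>i\<^sub>+\<^sub>1\<close> lower the degree by \<open>i\<close>, so that composition with the
  bracket raises the degree of homomorphisms to \<open>Q\<close> by \<open>i\<close>. Dualizing reverses the order of
  composition, and the sign in the action restores it, as for any contragredient representation;
  \<open>dual_bracket_jacobi\<close> is the module axiom for homogeneous elements.

  What remains is formal. Extension of scalars preserves graded Lie rings
  (\<open>graded_lie_ring_tensor\<close>). The action exists because the formula is biadditive in \<open>x\<close> and \<open>r\<close>,
  which allows it to pass to the tensor product (\<open>action_exists\<close>). Uniqueness, the module axiom and
  \<open>R\<close>-bilinearity are equalities between multiadditive maps, and these only have to be compared on
  the tensors \<open>x \<otimes> r\<close> with homogeneous \<open>x\<close> and on homogeneous homomorphisms, which generate the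
  two modules (\<open>actions_eq_on_generators\<close>).
\<close>

section \<open>Biadditive maps\<close>

definition biadditive ::
  "('a, 'b) monoid_scheme \<Rightarrow> ('c, 'd) monoid_scheme \<Rightarrow> ('e, 'f) monoid_scheme
    \<Rightarrow> ('a \<Rightarrow> 'c \<Rightarrow> 'e) \<Rightarrow> bool"
  where "biadditive A B C f \<longleftrightarrow>
    (\<forall>a\<in>carrier A. \<forall>b\<in>carrier B. f a b \<in> carrier C) \<and>
    (\<forall>a\<in>carrier A. \<forall>a'\<in>carrier A. \<forall>b\<in>carrier B.
       f (a \<otimes>\<^bsub>A\<^esub> a') b = f a b \<otimes>\<^bsub>C\<^esub> f a' b) \<and>
    (\<forall>a\<in>carrier A. \<forall>b\<in>carrier B. \<forall>b'\<in>carrier B.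
       f a (b \<otimes>\<^bsub>B\<^esub> b') = f a b \<otimes>\<^bsub>C\<^esub> f a b')"

lemma biadditiveI:
  assumes "\<And>a b. \<lbrakk>a \<in> carrier A; b \<in> carrier B\<rbrakk> \<Longrightarrow> f a b \<in> carrier C"
    and "\<And>a a' b. \<lbrakk>a \<in> carrier A; a' \<in> carrier A; b \<in> carrier B\<rbrakk>
      \<Longrightarrow> f (a \<otimes>\<^bsub>A\<^esub> a') b = f a b \<otimes>\<^bsub>C\<^esub> f a' b"
    and "\<And>a b b'. \<lbrakk>a \<in> carrier A; b \<in> carrier B; b' \<in> carrier B\<rbrakk>
      \<Longrightarrow> f a (b \<otimes>\<^bsub>B\<^esub> b') = f a b \<otimes>\<^bsub>C\<^esub> f a b'"
  shows "biadditive A B C f"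
  using assms by (simp add: biadditive_def)

lemma biadditive_closed:
  "\<lbrakk>biadditive A B C f; a \<in> carrier A; b \<in> carrier B\<rbrakk> \<Longrightarrow> f a b \<in> carrier C"
  by (simp add: biadditive_def)

lemma biadditive_mult_left:
  "\<lbrakk>biadditive A B C f; a \<in> carrier A; a' \<in> carrier A; b \<in> carrier B\<rbrakk>
    \<Longrightarrow> f (a \<otimes>\<^bsub>A\<^esub> a') b = f a b \<otimes>\<^bsub>C\<^esub> f a' b"
  by (simp add: biadditive_def)

lemma biadditive_mult_right:
  "\<lbrakk>biadditive A B C f; a \<in> carrier A; b \<in> carrier B; b' \<in> carrier B\<rbrakk>
    \<Longrightarrow> f a (b \<otimes>\<^bsub>B\<^esub> b') = f a b \<otimes>\<^bsub>C\<^esub> f a b'"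
  by (simp add: biadditive_def)

lemma biadditive_hom_left:
  assumes "biadditive A B C f" "b \<in> carrier B"
  shows "(\<lambda>a. f a b) \<in> hom A C"
  using assms by (simp add: biadditive_def hom_def)

lemma biadditive_hom_right:
  assumes "biadditive A B C f" "a \<in> carrier A"
  shows "f a \<in> hom B C"
  using assms by (simp add: biadditive_def hom_def)

lemma biadditive_one_left:
  assumes "biadditive A B C f" "group A" "group C" "b \<in> carrier B"
  shows "f \<one>\<^bsub>A\<^esub> b = \<one>\<^bsub>C\<^esub>"
  using hom_one [OF biadditive_hom_left] assms by metis

lemma biadditive_one_right:
  assumes "biadditive A B C f" "group B" "group C" "a \<in> carrier A"
  shows "f a \<one>\<^bsub>B\<^esub> = \<one>\<^bsub>C\<^esub>"
  using hom_one [OF biadditive_hom_right] assms by metis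

lemma biadditive_inv_right:
  assumes "biadditive A B C f" "group B" "group C" "a \<in> carrier A" "b \<in> carrier B"
  shows "f a (inv\<^bsub>B\<^esub> b) = inv\<^bsub>C\<^esub> f a b"
proof -
  interpret group_hom B C "f a"
    using assms biadditive_hom_right by (simp add: group_hom_def group_hom_axioms_def)
  show ?thesis
    using assms by simp
qed

section \<open>Commutators\<close>

context group
begin

lemma mult_inv_cancel_left:
  assumes "a \<in> carrier G" "b \<in> carrier G"
  shows "a \<otimes> (inv a \<otimes> b) = b" "inv a \<otimes> (a \<otimes> b) = b"
  using assms by (simp_all flip: m_assoc)

text \<open>With these equations the simplifier reduces group words to their normal form in the free group.\<close>

lemmas word_simps = m_assoc inv_mult_group mult_inv_cancel_left

lemma commutator_closed [simp, intro]:
  "\<lbrakk>g \<in> carrier G; h \<in> carrier G\<rbrakk> \<Longrightarrow> commutator G g h \<in> carrier G"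
  by (simp add: commutator_def)

lemma inv_commutator:
  "\<lbrakk>g \<in> carrier G; h \<in> carrier G\<rbrakk> \<Longrightarrow> inv (commutator G g h) = commutator G h g"
  by (simp add: commutator_def word_simps)

lemma commutator_self: "g \<in> carrier G \<Longrightarrow> commutator G g g = \<one>"
  by (simp add: commutator_def word_simps)

lemma commutator_one_left: "g \<in> carrier G \<Longrightarrow> commutator G \<one> g = \<one>"
  by (simp add: commutator_def)

lemma mult_eq_mult_commutator:
  "\<lbrakk>g \<in> carrier G; h \<in> carrier G\<rbrakk> \<Longrightarrow> g \<otimes> h = h \<otimes> (g \<otimes> commutator G g h)"
  by (simp add: commutator_def word_simps)

lemma commutator_mult_left:
  assumes "a \<in> carrier G" "b \<in> carrier G" "y \<in> carrier G"
  shows "commutator G (a \<otimes> b) y = inv b \<otimes> commutator G a y \<otimes> b \<otimes> commutator G b y"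
  using assms by (simp add: commutator_def word_simps)

lemma commutator_mult_right:
  assumes "x \<in> carrier G" "a \<in> carrier G" "b \<in> carrier G"
  shows "commutator G x (a \<otimes> b) = commutator G x b \<otimes> (inv b \<otimes> commutator G x a \<otimes> b)"
  using assms by (simp add: commutator_def word_simps)

lemma commutator_inv_left:
  assumes "x \<in> carrier G" "y \<in> carrier G"
  shows "commutator G (inv x) y = x \<otimes> inv (commutator G x y) \<otimes> inv x"
  using assms by (simp add: commutator_def word_simps)

lemma conjugate_commutator:
  assumes "g \<in> carrier G" "x \<in> carrier G" "y \<in> carrier G"
  shows "g \<otimes> commutator G x y \<otimes> inv g
    = commutator G (g \<otimes> x \<otimes> inv g) (g \<otimes> y \<otimes> inv g)"
  using assms by (simp add: commutator_def word_simps)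

text \<open>This form of the Hall--Witt identity has no inverses inside the commutators: conjugation does
  not change the class of an element in a central section, so that modulo the right term
  it is literally the Jacobi identity.\<close>

lemma Hall_Witt:
  assumes "x \<in> carrier G" "y \<in> carrier G" "z \<in> carrier G"
  shows "commutator G (commutator G x y) (inv x \<otimes> z \<otimes> x)
    \<otimes> commutator G (commutator G z x) (inv z \<otimes> y \<otimes> z)
    \<otimes> commutator G (commutator G y z) (inv y \<otimes> x \<otimes> y) = \<one>"
  using assms by (simp add: commutator_def word_simps)

lemma normal_mem_carrier: "\<lbrakk>N \<lhd> G; n \<in> N\<rbrakk> \<Longrightarrow> n \<in> carrier G"
  by (rule subgroup.mem_carrier [OF normal_imp_subgroup])

lemma coset_absorb_left:
  assumes "subgroup N G" "n \<in> N" "a \<in> carrier G"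
  shows "N #> (n \<otimes> a) = N #> a"
proof -
  have "N #> (n \<otimes> a) = N #> n #> a"
    using assms by (simp add: coset_mult_assoc subgroup.subset subgroup.mem_carrier [OF assms(1)])
  then show ?thesis
    using assms by (simp add: coset_join2 subgroup.mem_carrier [OF assms(1)])
qed

lemma coset_absorb_right:
  assumes "N \<lhd> G" "n \<in> N" "a \<in> carrier G"
  shows "N #> (a \<otimes> n) = N #> a"
proof -
  have n: "n \<in> carrier G"
    using assms by (simp add: normal_mem_carrier)
  have "a \<otimes> n = (a \<otimes> n \<otimes> inv a) \<otimes> a"
    using assms n by (simp add: word_simps)
  then show ?thesis
    using coset_absorb_left [OF normal_imp_subgroup [OF assms(1)]
        normal.inv_op_closed2 [OF assms(1,3,2)] assms(3)] by simp
qed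

lemma coset_eq_subgroup_iff:
  assumes "subgroup N G" "a \<in> carrier G"
  shows "N #> a = N \<longleftrightarrow> a \<in> N"
  using assms by (auto simp: coset_join2 intro: coset_join1)

text \<open>To bound a commutator subgroup it is enough to look at generators.\<close>

lemma centralizer_mod_subgroup:
  assumes N: "N \<lhd> G" and Y: "Y \<subseteq> carrier G"
  shows "subgroup {u \<in> carrier G. \<forall>y\<in>Y. commutator G u y \<in> N} G"
proof -
  interpret N: normal N G by fact
  have conj: "inv b \<otimes> n \<otimes> b \<in> N" if "b \<in> carrier G" "n \<in> N" for b n
    using that by (rule N.inv_op_closed1)
  show ?thesis
  proof (rule subgroup.intro)
    show "inv x \<in> {u \<in> carrier G. \<forall>y\<in>Y. commutator G u y \<in> N}"
      if "x \<in> {u \<in> carrier G. \<forall>y\<in>Y. commutator G u y \<in> N}" for x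
      using that Y by (auto simp: commutator_inv_left subset_iff intro!: N.inv_op_closed2)
    show "x \<otimes> y \<in> {u \<in> carrier G. \<forall>y\<in>Y. commutator G u y \<in> N}"
      if "x \<in> {u \<in> carrier G. \<forall>y\<in>Y. commutator G u y \<in> N}"
        "y \<in> {u \<in> carrier G. \<forall>y\<in>Y. commutator G u y \<in> N}" for x y
      using that Y by (auto simp: commutator_mult_left subset_iff intro!: N.m_closed conj)
  qed (use Y in \<open>auto simp: commutator_one_left subset_iff\<close>)
qed

end

section \<open>Lower and upper central series\<close>

context group
begin

lemma lower_central_Suc:
  "0 < i \<Longrightarrow> lower_central G (Suc i) = commutator_subgroup G (carrier G) (lower_central G i)"
  by (cases i) auto

lemma commutator_subgroup_normal:
  assumes "A \<lhd> G" "B \<lhd> G"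
  shows "commutator_subgroup G A B \<lhd> G"
  unfolding commutator_subgroup_def
proof (rule normal_generateI)
  have sub: "A \<subseteq> carrier G" "B \<subseteq> carrier G"
    using assms normal_mem_carrier by auto
  then show "{commutator G x y |x y. x \<in> A \<and> y \<in> B} \<subseteq> carrier G"
    by auto
  show "g \<otimes> h \<otimes> inv g \<in> {commutator G x y |x y. x \<in> A \<and> y \<in> B}"
    if h: "h \<in> {commutator G x y |x y. x \<in> A \<and> y \<in> B}" and g: "g \<in> carrier G" for h g
  proof -
    obtain x y where xy: "h = commutator G x y" "x \<in> A" "y \<in> B"
      using h by blast
    have "g \<otimes> h \<otimes> inv g = commutator G (g \<otimes> x \<otimes> inv g) (g \<otimes> y \<otimes> inv g)"
      using xy g sub conjugate_commutator [OF g, of x y] by auto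
    moreover have "g \<otimes> x \<otimes> inv g \<in> A" "g \<otimes> y \<otimes> inv g \<in> B"
      using xy g assms by (auto intro: normal.inv_op_closed2)
    ultimately show ?thesis
      by blast
  qed
qed

lemma lower_central_normal: "lower_central G i \<lhd> G"
proof (induction i)
  case (Suc i)
  then show ?case
    by (cases "i = 0") (simp_all add: normal_self lower_central_Suc commutator_subgroup_normal)
qed (simp add: normal_self)

lemma lower_central_carrier: "x \<in> lower_central G i \<Longrightarrow> x \<in> carrier G"
  by (rule normal_mem_carrier [OF lower_central_normal])

lemma lower_central_commutator:
  assumes "g \<in> carrier G" "x \<in> lower_central G i"
  shows "commutator G g x \<in> lower_central G (Suc i)"
proof (cases "i = 0")
  case False
  then show ?thesis
    using assms by (auto simp: lower_central_Suc commutator_subgroup_def intro!: generate.incl)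
qed (use assms in auto)

lemma lower_central_Suc_subset: "lower_central G (Suc i) \<subseteq> lower_central G i"
proof (cases "i = 0")
  case False
  interpret N: normal "lower_central G i" G
    by (rule lower_central_normal)
  have "commutator G g x \<in> lower_central G i" if "g \<in> carrier G" "x \<in> lower_central G i" for g x
    using that N.inv_op_closed1 [of g "inv x"] by (simp add: commutator_def)
  then have "generate G {commutator G x y |x y. x \<in> carrier G \<and> y \<in> lower_central G i}
      \<subseteq> lower_central G i"
    by (intro generate_subgroup_incl N.subgroup_axioms) auto
  with False show ?thesis
    by (simp add: lower_central_Suc commutator_subgroup_def)
qed auto

text \<open>Centrality of a coset, expressed by commutators as for the lower series.\<close>

lemma upper_central_Suc_iff:
  assumes "upper_central G i \<lhd> G"
  shows "x \<in> upper_central G (Suc i) \<longleftrightarrow>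
    x \<in> carrier G \<and> (\<forall>g\<in>carrier G. commutator G g x \<in> upper_central G i)"
proof -
  interpret N: normal "upper_central G i" G by fact
  have "upper_central G i #> (x \<otimes> g) = upper_central G i #> (g \<otimes> x)
      \<longleftrightarrow> commutator G g x \<in> upper_central G i" if x: "x \<in> carrier G" and g: "g \<in> carrier G" for g
  proof
    assume "commutator G g x \<in> upper_central G i"
    then have "upper_central G i #> (x \<otimes> g \<otimes> commutator G g x) = upper_central G i #> (x \<otimes> g)"
      using x g assms by (simp add: coset_absorb_right)
    then show "upper_central G i #> (x \<otimes> g) = upper_central G i #> (g \<otimes> x)"
      using mult_eq_mult_commutator [OF g x] x g by (simp add: m_assoc)
  next
    assume "upper_central G i #> (x \<otimes> g) = upper_central G i #> (g \<otimes> x)"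
    then have "g \<otimes> x \<in> upper_central G i #> (x \<otimes> g)"
      using x g N.subgroup_axioms by (simp add: rcos_self)
    then have "(g \<otimes> x) \<otimes> inv (x \<otimes> g) \<in> upper_central G i"
      using x g by (simp add: N.rcos_module_imp)
    then have "inv (x \<otimes> g) \<otimes> ((g \<otimes> x) \<otimes> inv (x \<otimes> g)) \<otimes> (x \<otimes> g) \<in> upper_central G i"
      using x g by (intro N.inv_op_closed1) auto
    moreover have "inv (x \<otimes> g) \<otimes> ((g \<otimes> x) \<otimes> inv (x \<otimes> g)) \<otimes> (x \<otimes> g) = commutator G g x"
      using x g by (simp add: commutator_def word_simps)
    ultimately show "commutator G g x \<in> upper_central G i"
      by simp
  qed
  then show ?thesis
    by (auto simp: group_center_def carrier_FactGroup N.rcos_sum)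
qed

lemma upper_central_normal: "upper_central G i \<lhd> G"
proof (induction i)
  case 0
  then show ?case
    by (simp add: one_is_normal)
next
  case (Suc i)
  interpret N: normal "upper_central G i" G by fact
  note iff = upper_central_Suc_iff [OF Suc]
  have comm: "commutator G x g \<in> upper_central G i \<longleftrightarrow> commutator G g x \<in> upper_central G i"
    if "x \<in> carrier G" "g \<in> carrier G" for x g
    using that inv_commutator N.m_inv_closed by metis
  have "upper_central G (Suc i)
      = {u \<in> carrier G. \<forall>y\<in>carrier G. commutator G u y \<in> upper_central G i}"
    using iff comm by blast
  then have sub: "subgroup (upper_central G (Suc i)) G"
    using centralizer_mod_subgroup [OF Suc, of "carrier G"] by simp
  show ?case
  proof (rule normal_invI [OF sub])
    fix g x assume g: "g \<in> carrier G" and x: "x \<in> upper_central G (Suc i)"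
    have xc: "x \<in> carrier G"
      using x iff by blast
    have "commutator G h (g \<otimes> x \<otimes> inv g) \<in> upper_central G i" if h: "h \<in> carrier G" for h
    proof -
      have "commutator G h (g \<otimes> x \<otimes> inv g)
          = g \<otimes> commutator G (inv g \<otimes> h \<otimes> g) x \<otimes> inv g"
        using g xc h by (simp add: commutator_def word_simps)
      then show ?thesis
        using g h x iff by (simp add: N.inv_op_closed2)
    qed
    then show "g \<otimes> x \<otimes> inv g \<in> upper_central G (Suc i)"
      using iff g xc by simp
  qed
qed

lemma upper_central_commutator:
  assumes "g \<in> carrier G" "x \<in> upper_central G i"
  shows "commutator G g x \<in> upper_central G (i - 1)"
proof (cases i)
  case 0
  then show ?thesis
    using assms by (simp add: commutator_def)
next
  case (Suc j)
  then show ?thesis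
    using assms upper_central_Suc_iff [OF upper_central_normal] by simp
qed

lemma upper_central_subset_Suc: "upper_central G i \<subseteq> upper_central G (Suc i)"
proof
  fix x assume x: "x \<in> upper_central G i"
  interpret N: normal "upper_central G i" G
    by (rule upper_central_normal)
  have "commutator G g x \<in> upper_central G i" if "g \<in> carrier G" for g
    using that x N.inv_op_closed1 [of g "inv x"] by (simp add: commutator_def)
  then show "x \<in> upper_central G (Suc i)"
    using x upper_central_Suc_iff [OF upper_central_normal] by auto
qed

end

section \<open>Central filtrations\<close>

text \<open>
  Both series are families of normal subgroups \<open>M k\<close> with \<open>[G, M k] \<subseteq> M (s k)\<close>, where \<open>s\<close> is the
  successor for the lower series and the predecessor for the upper one. For each such family the
  commutator makes the sum of the sections \<open>M k / M (s k)\<close> a module for the Lie ring of the lower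
  central series. For the lower series this is the adjoint module, whose axioms are those of the
  Lie product itself; dualizing it for the upper series gives the module of the theorem.
\<close>

locale central_filtration = group G for G (structure) +
  fixes M :: "nat \<Rightarrow> 'a set" and s :: "nat \<Rightarrow> nat"
  assumes M_normal: "M k \<lhd> G"
    and M_desc: "M (s k) \<subseteq> M k"
    and M_commutator: "\<lbrakk>g \<in> carrier G; m \<in> M k\<rbrakk> \<Longrightarrow> commutator G g m \<in> M (s k)"
begin

lemma M_subgroup: "subgroup (M k) G"
  using M_normal by (rule normal_imp_subgroup)

lemma M_subset: "M k \<subseteq> carrier G"
  by (rule subgroup.subset [OF M_subgroup])

lemma M_carrier: "m \<in> M k \<Longrightarrow> m \<in> carrier G"
  by (rule normal_mem_carrier [OF M_normal])

text \<open>The three subgroup lemma for \<open>G\<close>, \<open>\<gamma>\<^sub>i\<close> and \<open>M k\<close>. Every element of \<open>M k\<close> is a conjugate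
  of one of \<open>M k\<close>, which puts \<open>[[g, x], z]\<close> into the shape required by the Hall--Witt identity.\<close>

lemma lower_central_commutator_M:
  "\<lbrakk>0 < i; x \<in> lower_central G i; m \<in> M k\<rbrakk> \<Longrightarrow> commutator G x m \<in> M ((s ^^ i) k)"
proof (induction i arbitrary: x m k rule: nat_induct_non_zero)
  case 1
  then show ?case
    using M_commutator by simp
next
  case (Suc i)
  let ?N = "M ((s ^^ Suc i) k)"
  let ?C = "{u \<in> carrier G. \<forall>y\<in>M k. commutator G u y \<in> ?N}"
  interpret N: normal ?N G
    by (rule M_normal)
  have "commutator G (commutator G g x) z \<in> ?N"
    if g: "g \<in> carrier G" and x: "x \<in> lower_central G i" and z: "z \<in> M k" for g x z
  proof -
    define w where "w = g \<otimes> z \<otimes> inv g"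
    have w: "w \<in> M k"
      unfolding w_def using g z M_normal by (simp add: normal.inv_op_closed2)
    have carr: "x \<in> carrier G" "z \<in> carrier G" "w \<in> carrier G"
      using x z w M_carrier lower_central_carrier by auto
    have z_eq: "z = inv g \<otimes> w \<otimes> g"
      unfolding w_def using g carr by (simp add: word_simps)
    have "inv w \<otimes> x \<otimes> w \<in> lower_central G i"
      using x carr lower_central_normal by (simp add: normal.inv_op_closed1)
    moreover have "commutator G w g \<in> M (s k)"
      using M_commutator [OF g w] inv_commutator [OF g] carr
      by (metis subgroup.m_inv_closed [OF M_subgroup])
    ultimately have "commutator G (inv w \<otimes> x \<otimes> w) (commutator G w g) \<in> ?N"
      using Suc.IH [of "inv w \<otimes> x \<otimes> w" "commutator G w g" "s k"] by (simp add: funpow_swap1)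
    then have b: "commutator G (commutator G w g) (inv w \<otimes> x \<otimes> w) \<in> ?N"
      using N.m_inv_closed carr g by (metis commutator_closed inv_closed inv_commutator m_closed)
    have "commutator G (inv x \<otimes> g \<otimes> x) (commutator G x w) \<in> ?N"
      using Suc.IH [OF x w] carr g by (simp add: M_commutator)
    then have c: "commutator G (commutator G x w) (inv x \<otimes> g \<otimes> x) \<in> ?N"
      using N.m_inv_closed carr g by (metis commutator_closed inv_closed inv_commutator m_closed)
    have "commutator G (commutator G g x) z
        \<otimes> commutator G (commutator G w g) (inv w \<otimes> x \<otimes> w)
        \<otimes> commutator G (commutator G x w) (inv x \<otimes> g \<otimes> x) = \<one>"
      unfolding z_eq using Hall_Witt [of g x w] g carr by simp
    then have "commutator G (commutator G g x) z
       = inv (commutator G (commutator G w g) (inv w \<otimes> x \<otimes> w)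
        \<otimes> commutator G (commutator G x w) (inv x \<otimes> g \<otimes> x))"
      using g carr by (intro inv_equality [symmetric]) (auto simp: m_assoc)
    with b c show ?thesis
      by (simp add: N.m_closed N.m_inv_closed del: funpow.simps)
  qed
  then have "{commutator G g x |g x. g \<in> carrier G \<and> x \<in> lower_central G i} \<subseteq> ?C"
    using lower_central_carrier by blast
  moreover have "subgroup ?C G"
    by (rule centralizer_mod_subgroup [OF M_normal]) (use M_carrier in auto)
  ultimately have "lower_central G (Suc i) \<subseteq> ?C"
    using Suc.hyps generate_subgroup_incl by (simp add: lower_central_Suc commutator_subgroup_def)
  with Suc.prems show ?case
    by blast
qed

definition sect :: "nat \<Rightarrow> 'a set monoid"
  where "sect k = (G\<lparr>carrier := M k\<rparr>) Mod M (s k)"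

lemma sect_carrier: "carrier (sect k) = (\<lambda>a. M (s k) #> a) ` M k"
  by (simp add: sect_def carrier_FactGroup)

lemma sect_one: "\<one>\<^bsub>sect k\<^esub> = M (s k)"
  by (simp add: sect_def)

lemma sect_mult:
  "\<lbrakk>a \<in> M k; b \<in> M k\<rbrakk> \<Longrightarrow> (M (s k) #> a) \<otimes>\<^bsub>sect k\<^esub> (M (s k) #> b) = M (s k) #> (a \<otimes> b)"
  using normal.rcos_sum [OF M_normal] M_carrier by (simp add: sect_def)

lemma coset_mult_commute:
  assumes a: "a \<in> M k" and b: "b \<in> carrier G"
  shows "M (s k) #> (a \<otimes> b) = M (s k) #> (b \<otimes> a)"
proof -
  have "M (s k) #> (a \<otimes> b \<otimes> commutator G b a) = M (s k) #> (a \<otimes> b)"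
    using a b M_carrier M_normal M_commutator by (intro coset_absorb_right) auto
  moreover have "a \<otimes> b \<otimes> commutator G b a = b \<otimes> a"
    using mult_eq_mult_commutator [of b a] a b M_carrier by (simp add: m_assoc)
  ultimately show ?thesis
    by simp
qed

lemma coset_conjugate:
  assumes a: "a \<in> M k" and b: "b \<in> carrier G"
  shows "M (s k) #> (inv b \<otimes> a \<otimes> b) = M (s k) #> a"
proof -
  have ac: "a \<in> carrier G"
    using a by (rule M_carrier)
  have "inv (commutator G b a) \<in> M (s k)"
    using M_commutator [OF b a] by (rule subgroup.m_inv_closed [OF M_subgroup])
  then have "M (s k) #> (a \<otimes> inv (commutator G b a)) = M (s k) #> a"
    using ac M_normal by (simp add: coset_absorb_right)
  then show ?thesis
    using ac b by (simp add: commutator_def word_simps)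
qed

lemma sect_comm_group: "comm_group (sect k)"
proof -
  have "M (s k) \<lhd> G\<lparr>carrier := M k\<rparr>"
    using M_subgroup M_normal M_desc by (rule normal_restrict_supergroup)
  then interpret S: group "sect k"
    unfolding sect_def by (rule normal.factorgroup_is_group)
  show ?thesis
  proof (rule S.group_comm_groupI)
    show "x \<otimes>\<^bsub>sect k\<^esub> y = y \<otimes>\<^bsub>sect k\<^esub> x"
      if "x \<in> carrier (sect k)" "y \<in> carrier (sect k)" for x y
      using that M_carrier by (auto simp: sect_carrier sect_mult coset_mult_commute)
  qed
qed

lemma sect_inv:
  assumes a: "a \<in> M k"
  shows "inv\<^bsub>sect k\<^esub> (M (s k) #> a) = M (s k) #> inv a"
proof -
  interpret S: comm_group "sect k" by (rule sect_comm_group)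
  have ia: "inv a \<in> M k"
    using a by (rule subgroup.m_inv_closed [OF M_subgroup])
  show ?thesis
  proof (rule S.inv_equality)
    show "(M (s k) #> inv a) \<otimes>\<^bsub>sect k\<^esub> (M (s k) #> a) = \<one>\<^bsub>sect k\<^esub>"
      using a ia M_carrier M_subset
      by (simp add: sect_mult sect_one coset_mult_one)
  qed (use a ia in \<open>auto simp: sect_carrier\<close>)
qed

text \<open>As \<open>bracket_cosets\<close> shows, the union is a single coset if \<open>A\<close> is a class in \<open>\<gamma>\<^sub>i/\<gamma>\<^sub>i\<^sub>+\<^sub>1\<close> and
  \<open>B\<close> is a class in \<open>M k/M (s k)\<close>.\<close>

definition bracket :: "nat \<Rightarrow> nat \<Rightarrow> 'a set \<Rightarrow> 'a set \<Rightarrow> 'a set"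
  where "bracket i k A B = (\<Union>x\<in>A. \<Union>y\<in>B. M ((s ^^ Suc i) k) #> commutator G x y)"

text \<open>The conjugation in the expansion of \<open>[a b, y]\<close> acts trivially on the central section that
  contains \<open>[a, y]\<close>.\<close>

lemma commutator_mult_left_mod:
  assumes i: "0 < i" and a: "a \<in> lower_central G i" and b: "b \<in> lower_central G i"
    and y: "y \<in> M k"
  shows "M ((s ^^ Suc i) k) #> commutator G (a \<otimes> b) y
    = M ((s ^^ Suc i) k) #> (commutator G a y \<otimes> commutator G b y)"
proof -
  have carr: "a \<in> carrier G" "b \<in> carrier G" "y \<in> carrier G"
    using assms lower_central_carrier M_carrier by auto
  have "commutator G a y \<in> M ((s ^^ i) k)"
    using i a y by (rule lower_central_commutator_M)
  then have "M ((s ^^ Suc i) k) #> (inv b \<otimes> commutator G a y \<otimes> b)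
      = M ((s ^^ Suc i) k) #> commutator G a y"
    using coset_conjugate [of "commutator G a y" "(s ^^ i) k" b] carr by simp
  then have "M ((s ^^ Suc i) k) #> (inv b \<otimes> commutator G a y \<otimes> b) #> commutator G b y
      = M ((s ^^ Suc i) k) #> commutator G a y #> commutator G b y"
    by simp
  then show ?thesis
    using carr M_subset
    by (simp add: commutator_mult_left coset_mult_assoc del: funpow.simps)
qed

lemma commutator_mult_right_mod:
  assumes i: "0 < i" and x: "x \<in> lower_central G i" and a: "a \<in> M k" and b: "b \<in> M k"
  shows "M ((s ^^ Suc i) k) #> commutator G x (a \<otimes> b)
    = M ((s ^^ Suc i) k) #> (commutator G x a \<otimes> commutator G x b)"
proof -
  have carr: "a \<in> carrier G" "b \<in> carrier G" "x \<in> carrier G"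
    using assms lower_central_carrier M_carrier by auto
  have xa: "commutator G x a \<in> M ((s ^^ i) k)" and xb: "commutator G x b \<in> M ((s ^^ i) k)"
    using i x a b by (auto intro: lower_central_commutator_M)
  have "M ((s ^^ Suc i) k) #> (commutator G x b \<otimes> (inv b \<otimes> commutator G x a \<otimes> b))
      = M ((s ^^ Suc i) k) #> ((inv b \<otimes> commutator G x a \<otimes> b) \<otimes> commutator G x b)"
    using coset_mult_commute [of "commutator G x b" "(s ^^ i) k"] carr xb by simp
  also have "\<dots> = M ((s ^^ Suc i) k) #> (inv b \<otimes> commutator G x a \<otimes> b) #> commutator G x b"
    using carr M_subset by (simp add: coset_mult_assoc del: funpow.simps)
  also have "\<dots> = M ((s ^^ Suc i) k) #> commutator G x a #> commutator G x b"
    using coset_conjugate [of "commutator G x a" "(s ^^ i) k" b] carr xa by simp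
  finally show ?thesis
    using carr M_subset
    by (simp add: commutator_mult_right coset_mult_assoc del: funpow.simps)
qed

text \<open>Changing \<open>x\<close> by \<open>\<gamma>\<^sub>i\<^sub>+\<^sub>1\<close> or \<open>y\<close> by \<open>M (s k)\<close> changes the commutator by a commutator that lies one
  step deeper in the filtration.\<close>

lemma bracket_cosets:
  assumes i: "0 < i" and x: "x \<in> lower_central G i" and y: "y \<in> M k"
  shows "bracket i k (lower_central G (Suc i) #> x) (M (s k) #> y)
    = M ((s ^^ Suc i) k) #> commutator G x y"
proof -
  let ?N = "M ((s ^^ Suc i) k)"
  have carr: "x \<in> carrier G" "y \<in> carrier G"
    using assms lower_central_carrier M_carrier by auto
  have "?N #> commutator G x' y' = ?N #> commutator G x y"
    if x': "x' \<in> lower_central G (Suc i) #> x" and y': "y' \<in> M (s k) #> y" for x' y'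
  proof -
    obtain u where u: "u \<in> lower_central G (Suc i)" "x' = u \<otimes> x"
      using x' by (auto simp: r_coset_def)
    obtain v where v: "v \<in> M (s k)" "y' = v \<otimes> y"
      using y' by (auto simp: r_coset_def)
    have uv: "u \<in> lower_central G i" "v \<in> M k" "y' \<in> M k"
      using u v y lower_central_Suc_subset M_desc
      by (auto intro!: subgroup.m_closed [OF M_subgroup])
    have carr': "u \<in> carrier G" "v \<in> carrier G" "y' \<in> carrier G"
      using uv lower_central_carrier M_carrier by auto
    have 1: "commutator G u y' \<in> ?N"
      using lower_central_commutator_M [OF _ u(1) uv(3)] by simp
    have 2: "commutator G x v \<in> ?N"
      using lower_central_commutator_M [OF i x v(1)] by (simp add: funpow_swap1)
    have "?N #> commutator G x' y' = ?N #> (commutator G u y' \<otimes> commutator G x y')"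
      unfolding u(2) using i uv x by (rule_tac commutator_mult_left_mod)
    also have "\<dots> = ?N #> commutator G x y'"
      using 1 carr carr' M_subgroup by (simp add: coset_absorb_left del: funpow.simps)
    also have "\<dots> = ?N #> (commutator G x v \<otimes> commutator G x y)"
      unfolding v(2) using i uv x y by (rule_tac commutator_mult_right_mod)
    also have "\<dots> = ?N #> commutator G x y"
      using 2 carr carr' M_subgroup by (simp add: coset_absorb_left del: funpow.simps)
    finally show ?thesis .
  qed
  moreover have "x \<in> lower_central G (Suc i) #> x" "y \<in> M (s k) #> y"
    using carr by (auto intro: rcos_self M_subgroup normal_imp_subgroup [OF lower_central_normal])
  ultimately show ?thesis
    unfolding bracket_def by blast
qed

end

context group
begin

lemma lower_central_filtration: "central_filtration G (lower_central G) Suc"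
  by (intro central_filtration.intro central_filtration_axioms.intro is_group
      lower_central_normal lower_central_Suc_subset lower_central_commutator)

lemma lower_quotient_eq_sect: "lower_quotient G i = central_filtration.sect G (lower_central G) Suc i"
  by (simp add: lower_quotient_def central_filtration.sect_def [OF lower_central_filtration])

lemma lower_bracket_eq_bracket:
  "lower_bracket G i j = central_filtration.bracket G (lower_central G) Suc i j"
  by (simp add: fun_eq_iff lower_bracket_def Suc_funpow
      central_filtration.bracket_def [OF lower_central_filtration] del: funpow.simps)

lemma lower_quotient_carrier:
  "carrier (lower_quotient G i) = (\<lambda>x. lower_central G (Suc i) #> x) ` lower_central G i"
  by (simp add: lower_quotient_eq_sect central_filtration.sect_carrier [OF lower_central_filtration])

end

context central_filtration
begin

lemma bracket_biadditive:
  assumes i: "0 < i"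
  shows "biadditive (lower_quotient G i) (sect k) (sect ((s ^^ i) k)) (bracket i k)"
proof -
  interpret lower: central_filtration G "lower_central G" Suc
    by (rule lower_central_filtration)
  show ?thesis
  proof (rule biadditiveI)
    show "bracket i k A B \<in> carrier (sect ((s ^^ i) k))"
      if "A \<in> carrier (lower_quotient G i)" "B \<in> carrier (sect k)" for A B
      using that i
      by (auto simp: lower_quotient_carrier sect_carrier bracket_cosets lower_central_commutator_M)
  next
    fix A A' B assume A: "A \<in> carrier (lower_quotient G i)"
      and A': "A' \<in> carrier (lower_quotient G i)" and B: "B \<in> carrier (sect k)"
    obtain x x' y where A_eq: "A = lower_central G (Suc i) #> x"
      and A'_eq: "A' = lower_central G (Suc i) #> x'" and B_eq: "B = M (s k) #> y"
      and x: "x \<in> lower_central G i" and x': "x' \<in> lower_central G i" and y: "y \<in> M k"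
      using A A' B by (auto simp: lower_quotient_carrier sect_carrier)
    have 1: "commutator G x y \<in> M ((s ^^ i) k)"
      using i x y by (rule lower_central_commutator_M)
    have xx': "x \<otimes> x' \<in> lower_central G i"
      using x x' by (rule subgroup.m_closed [OF lower.M_subgroup])
    have 2: "commutator G x' y \<in> M ((s ^^ i) k)"
      using i x' y by (rule lower_central_commutator_M)
    show "bracket i k (A \<otimes>\<^bsub>lower_quotient G i\<^esub> A') B
        = bracket i k A B \<otimes>\<^bsub>sect ((s ^^ i) k)\<^esub> bracket i k A' B"
      using sect_mult [OF 1 2] commutator_mult_left_mod [OF i x x' y]
      by (simp add: A_eq A'_eq B_eq lower_quotient_eq_sect lower.sect_mult [OF x x'] bracket_cosets [OF i _ y] x x' xx')
  next
    fix A B B' assume A: "A \<in> carrier (lower_quotient G i)"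
      and B: "B \<in> carrier (sect k)" and B': "B' \<in> carrier (sect k)"
    obtain x y y' where A_eq: "A = lower_central G (Suc i) #> x"
      and B_eq: "B = M (s k) #> y" and B'_eq: "B' = M (s k) #> y'"
      and x: "x \<in> lower_central G i" and y: "y \<in> M k" and y': "y' \<in> M k"
      using A B B' by (auto simp: lower_quotient_carrier sect_carrier)
    have yy': "y \<otimes> y' \<in> M k"
      using y y' by (rule subgroup.m_closed [OF M_subgroup])
    have 1: "commutator G x y \<in> M ((s ^^ i) k)" and 2: "commutator G x y' \<in> M ((s ^^ i) k)"
      using i x y y' by (auto intro: lower_central_commutator_M)
    show "bracket i k A (B \<otimes>\<^bsub>sect k\<^esub> B')
        = bracket i k A B \<otimes>\<^bsub>sect ((s ^^ i) k)\<^esub> bracket i k A B'"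
      using sect_mult [OF 1 2] commutator_mult_right_mod [OF i x y y']
      by (simp add: A_eq B_eq B'_eq sect_mult [OF y y'] bracket_cosets [OF i x] y y' yy')
  qed
qed

text \<open>The Hall--Witt identity, read in \<open>M ((s ^^ (i + j)) k)\<close> modulo the next term. The conjugated
  arguments represent the same classes as the original ones.\<close>

lemma bracket_jacobi:
  assumes i: "0 < i" and j: "0 < j" and A: "A \<in> carrier (lower_quotient G i)"
    and B: "B \<in> carrier (lower_quotient G j)" and C: "C \<in> carrier (sect k)"
  defines "T \<equiv> sect ((s ^^ (i + j)) k)"
  shows "bracket (i + j) k (lower_bracket G i j A B) C
    = bracket i ((s ^^ j) k) A (bracket j k B C)
      \<otimes>\<^bsub>T\<^esub> inv\<^bsub>T\<^esub> bracket j ((s ^^ i) k) B (bracket i k A C)"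
proof -
  interpret lower: central_filtration G "lower_central G" Suc
    by (rule lower_central_filtration)
  interpret T: comm_group T
    unfolding T_def by (rule sect_comm_group)
  obtain x where x: "x \<in> lower_central G i" and A_eq: "A = lower_central G (Suc i) #> x"
    using A by (auto simp: lower_quotient_carrier)
  obtain y where y: "y \<in> lower_central G j" and B_eq: "B = lower_central G (Suc j) #> y"
    using B by (auto simp: lower_quotient_carrier)
  obtain z where z: "z \<in> M k" and C_eq: "C = M (s k) #> z"
    using C by (auto simp: sect_carrier)
  have carr: "x \<in> carrier G" "y \<in> carrier G" "z \<in> carrier G"
    using x y z lower_central_carrier M_carrier by auto
  let ?N = "M ((s ^^ Suc (i + j)) k)"
  have ij: "(s ^^ i) ((s ^^ j) k) = (s ^^ (i + j)) k" "(s ^^ j) ((s ^^ i) k) = (s ^^ (i + j)) k"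
    by (metis comp_apply funpow_add, metis add.commute comp_apply funpow_add)
  have Sij: "(s ^^ Suc i) ((s ^^ j) k) = (s ^^ Suc (i + j)) k"
      "(s ^^ Suc j) ((s ^^ i) k) = (s ^^ Suc (i + j)) k"
    using ij by simp_all
  have xy: "commutator G x y \<in> lower_central G (i + j)"
    using lower.lower_central_commutator_M [OF i x y] by (simp add: Suc_funpow)
  have xz: "commutator G x z \<in> M ((s ^^ i) k)" and yz: "commutator G y z \<in> M ((s ^^ j) k)"
    using i j x y z by (auto intro: lower_central_commutator_M)
  have zx: "commutator G z x \<in> M ((s ^^ i) k)"
    using subgroup.m_inv_closed [OF M_subgroup xz] carr by (simp add: inv_commutator)
  let ?zx = "inv x \<otimes> z \<otimes> x" and ?yz = "inv z \<otimes> y \<otimes> z" and ?xy = "inv y \<otimes> x \<otimes> y"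
  have conj: "?zx \<in> M k" "?yz \<in> lower_central G j" "?xy \<in> lower_central G i"
    using x y z carr by (auto intro: normal.inv_op_closed1 M_normal lower_central_normal)
  have conj_eq: "M (s k) #> ?zx = M (s k) #> z"
      "lower_central G (Suc j) #> ?yz = lower_central G (Suc j) #> y"
      "lower_central G (Suc i) #> ?xy = lower_central G (Suc i) #> x"
    using coset_conjugate [OF z carr(1)] lower.coset_conjugate [OF y carr(3)]
      lower.coset_conjugate [OF x carr(2)] by simp_all
  have yz_zx: "commutator G ?yz (commutator G z x) \<in> M ((s ^^ (i + j)) k)"
    using lower_central_commutator_M [OF j conj(2) zx] by (simp add: ij)
  have xy_yz: "commutator G ?xy (commutator G y z) \<in> M ((s ^^ (i + j)) k)"
    using lower_central_commutator_M [OF i conj(3) yz] by (simp add: ij)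
  have term1: "bracket (i + j) k (lower_bracket G i j A B) C
      = ?N #> commutator G (commutator G x y) ?zx"
  proof -
    have "lower_bracket G i j A B = lower_central G (Suc (i + j)) #> commutator G x y"
      unfolding A_eq B_eq lower_bracket_eq_bracket lower.bracket_cosets [OF i x y]
      by (simp add: Suc_funpow)
    then show ?thesis
      using bracket_cosets [OF _ xy conj(1)] i by (simp add: C_eq conj_eq del: funpow.simps)
  qed
  have B_hom: "bracket j ((s ^^ i) k) B \<in> hom (sect ((s ^^ i) k)) T"
    using biadditive_hom_right [OF bracket_biadditive [OF j] B, of "(s ^^ i) k"]
    by (simp add: T_def ij)
  interpret B_hom: group_hom "sect ((s ^^ i) k)" T "bracket j ((s ^^ i) k) B"
    using B_hom sect_comm_group
    by (simp add: group_hom_def group_hom_axioms_def T.is_group comm_group.axioms)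
  have term2: "bracket j ((s ^^ i) k) B (bracket i k A C)
      = ?N #> commutator G (commutator G z x) ?yz"
  proof -
    have AC: "bracket i k A C = M (s ((s ^^ i) k)) #> commutator G x z"
      unfolding A_eq C_eq bracket_cosets [OF i x z] by simp
    have "bracket j ((s ^^ i) k) B (inv\<^bsub>sect ((s ^^ i) k)\<^esub> (bracket i k A C))
        = bracket j ((s ^^ i) k) B (M (s ((s ^^ i) k)) #> commutator G z x)"
      unfolding AC sect_inv [OF xz] using carr by (simp add: inv_commutator)
    also have "\<dots> = ?N #> commutator G ?yz (commutator G z x)"
      unfolding B_eq conj_eq(2) [symmetric] bracket_cosets [OF j conj(2) zx] Sij ..
    finally have 1: "inv\<^bsub>T\<^esub> bracket j ((s ^^ i) k) B (bracket i k A C)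
        = ?N #> commutator G ?yz (commutator G z x)"
      using xz AC by (simp add: sect_carrier del: funpow.simps)
    have "bracket j ((s ^^ i) k) B (bracket i k A C) \<in> carrier T"
      using xz AC by (intro B_hom.hom_closed) (simp add: sect_carrier)
    then have "bracket j ((s ^^ i) k) B (bracket i k A C)
        = inv\<^bsub>T\<^esub> (?N #> commutator G ?yz (commutator G z x))"
      unfolding 1 [symmetric] by simp
    then show ?thesis
      using sect_inv [OF yz_zx] carr by (simp add: T_def inv_commutator)
  qed
  have term3: "inv\<^bsub>T\<^esub> bracket i ((s ^^ j) k) A (bracket j k B C)
      = ?N #> commutator G (commutator G y z) ?xy"
  proof -
    have "bracket j k B C = M (s ((s ^^ j) k)) #> commutator G y z"
      unfolding B_eq C_eq bracket_cosets [OF j y z] by simp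
    then have "bracket i ((s ^^ j) k) A (bracket j k B C)
        = ?N #> commutator G ?xy (commutator G y z)"
      unfolding A_eq conj_eq(3) [symmetric] using bracket_cosets [OF i conj(3) yz] Sij by simp
    then show ?thesis
      using sect_inv [OF xy_yz] carr by (simp add: T_def inv_commutator)
  qed
  have in_M: "commutator G (commutator G x y) ?zx \<in> M ((s ^^ (i + j)) k)"
      "commutator G (commutator G z x) ?yz \<in> M ((s ^^ (i + j)) k)"
      "commutator G (commutator G y z) ?xy \<in> M ((s ^^ (i + j)) k)"
    using lower_central_commutator_M [OF _ xy conj(1)] i carr
      subgroup.m_inv_closed [OF M_subgroup yz_zx] subgroup.m_inv_closed [OF M_subgroup xy_yz]
    by (simp_all add: inv_commutator)
  have "(?N #> commutator G (commutator G x y) ?zx) \<otimes>\<^bsub>T\<^esub> (?N #> commutator G (commutator G z x) ?yz)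
      \<otimes>\<^bsub>T\<^esub> (?N #> commutator G (commutator G y z) ?xy) = \<one>\<^bsub>T\<^esub>"
    using in_M Hall_Witt [OF carr] M_subset
    by (simp add: T_def sect_mult subgroup.m_closed [OF M_subgroup] sect_one)
  then have 0: "bracket (i + j) k (lower_bracket G i j A B) C
      \<otimes>\<^bsub>T\<^esub> bracket j ((s ^^ i) k) B (bracket i k A C)
      \<otimes>\<^bsub>T\<^esub> inv\<^bsub>T\<^esub> bracket i ((s ^^ j) k) A (bracket j k B C) = \<one>\<^bsub>T\<^esub>"
    unfolding term1 term2 term3 .
  have closed: "bracket (i + j) k (lower_bracket G i j A B) C \<in> carrier T"
      "bracket j ((s ^^ i) k) B (bracket i k A C) \<in> carrier T"
      "bracket i ((s ^^ j) k) A (bracket j k B C) \<in> carrier T"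
    using biadditive_closed [OF bracket_biadditive [OF i] A
          biadditive_closed [OF bracket_biadditive [OF j] B C]] in_M
    unfolding term1 term2 by (auto simp: T_def sect_carrier ij)
  show ?thesis
    using closed 0
    by (metis T.inv_closed T.inv_equality T.inv_inv T.inv_solve_right T.m_closed T.r_inv)
qed

end

section \<open>Direct sums of abelian groups\<close>

lemma carrier_sum_group_iff:
  assumes "\<And>i. 0 < i \<Longrightarrow> group (A i)"
  shows "x \<in> carrier (sum_group {0<..} A) \<longleftrightarrow>
    x \<in> extensional {0<..} \<and> (\<forall>i>0. x i \<in> carrier (A i)) \<and> finite {i. 0 < i \<and> x i \<noteq> \<one>\<^bsub>A i\<^esub>}"
proof -
  have "carrier (sum_group {0<..} A)
      = {x \<in> \<Pi>\<^sub>E i\<in>{0<..}. carrier (A i). finite {i \<in> {0<..}. x i \<noteq> \<one>\<^bsub>A i\<^esub>}}"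
    using assms by (intro carrier_sum_group) auto
  then show ?thesis
    by (auto simp: PiE_iff)
qed

lemma comm_group_sum_group:
  assumes A: "\<And>i. 0 < i \<Longrightarrow> comm_group (A i)"
  shows "comm_group (sum_group {0<..} A)"
proof -
  have grp: "group (A i)" if "0 < i" for i
    using A [OF that] by (rule comm_group.axioms)
  interpret group "sum_group {0<..} A"
    using grp by (intro sum_group) auto
  show ?thesis
  proof (rule group_comm_groupI)
    fix x y assume x: "x \<in> carrier (sum_group {0<..} A)" and y: "y \<in> carrier (sum_group {0<..} A)"
    have "x i \<otimes>\<^bsub>A i\<^esub> y i = y i \<otimes>\<^bsub>A i\<^esub> x i" if i: "0 < i" for i
    proof -
      interpret Ai: comm_group "A i"
        using i by (rule A)
      show ?thesis
        using x y i grp by (simp add: carrier_sum_group_iff Ai.m_comm)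
    qed
    then show "x \<otimes>\<^bsub>sum_group {0<..} A\<^esub> y = y \<otimes>\<^bsub>sum_group {0<..} A\<^esub> x"
      by auto
  qed
qed

lemma homogeneous_apply:
  "0 < k \<Longrightarrow> homogeneous A i a k = (if k = i then a else \<one>\<^bsub>A k\<^esub>)"
  by (simp add: homogeneous_def)

lemma homogeneous_closed:
  assumes grp: "\<And>i. 0 < i \<Longrightarrow> group (A i)" and "0 < i" "a \<in> carrier (A i)"
  shows "homogeneous A i a \<in> carrier (sum_group {0<..} A)"
proof -
  have "{k. 0 < k \<and> homogeneous A i a k \<noteq> \<one>\<^bsub>A k\<^esub>} \<subseteq> {i}"
    by (auto simp: homogeneous_apply split: if_splits)
  then have "finite {k. 0 < k \<and> homogeneous A i a k \<noteq> \<one>\<^bsub>A k\<^esub>}"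
    by (rule finite_subset) simp
  moreover have "homogeneous A i a k \<in> carrier (A k)" if "0 < k" for k
    using that assms group.is_monoid [OF grp [OF that]] by (simp add: homogeneous_apply)
  ultimately show ?thesis
    using grp by (simp add: carrier_sum_group_iff homogeneous_def [of A i a])
qed

lemma homogeneous_mult:
  assumes "\<And>i. 0 < i \<Longrightarrow> group (A i)" "0 < i" "a \<in> carrier (A i)" "b \<in> carrier (A i)"
  shows "homogeneous A i (a \<otimes>\<^bsub>A i\<^esub> b)
    = homogeneous A i a \<otimes>\<^bsub>sum_group {0<..} A\<^esub> homogeneous A i b"
proof -
  have "\<one>\<^bsub>A k\<^esub> \<otimes>\<^bsub>A k\<^esub> \<one>\<^bsub>A k\<^esub> = \<one>\<^bsub>A k\<^esub>" if "0 < k" for k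
    using assms(1) [OF that] by (simp add: group.is_monoid)
  then show ?thesis
    by (auto simp: homogeneous_def)
qed

lemma homogeneous_one: "homogeneous A i \<one>\<^bsub>A i\<^esub> = \<one>\<^bsub>sum_group {0<..} A\<^esub>"
  by (auto simp: homogeneous_def)

text \<open>A direct sum is generated, even as a monoid, by its homogeneous elements. This reduces every
  multiadditive identity to homogeneous arguments.\<close>

lemma sum_group_induct [consumes 1, case_names group homogeneous mult]:
  assumes x: "x \<in> carrier (sum_group {0<..} A)"
    and grp: "\<And>i. 0 < i \<Longrightarrow> group (A i)"
    and hom: "\<And>i a. \<lbrakk>0 < i; a \<in> carrier (A i)\<rbrakk> \<Longrightarrow> P (homogeneous A i a)"
    and mult: "\<And>x y. \<lbrakk>x \<in> carrier (sum_group {0<..} A); y \<in> carrier (sum_group {0<..} A); P x; P y\<rbrakk>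
      \<Longrightarrow> P (x \<otimes>\<^bsub>sum_group {0<..} A\<^esub> y)"
  shows "P x"
proof -
  have "P x" if "finite F" "x \<in> carrier (sum_group {0<..} A)"
    "{k. 0 < k \<and> x k \<noteq> \<one>\<^bsub>A k\<^esub>} \<subseteq> F" for F x
    using that
  proof (induction F arbitrary: x rule: finite_induct)
    case empty
    then have "x k = \<one>\<^bsub>A k\<^esub>" if "0 < k" for k
      using empty.prems(2) that by blast
    moreover have "x \<in> extensional {0<..}"
      using empty grp by (simp add: carrier_sum_group_iff)
    ultimately have "x = homogeneous A 1 \<one>\<^bsub>A 1\<^esub>"
      by (auto simp: fun_eq_iff homogeneous_def extensional_def)
    then show ?case
      using hom [of 1 "\<one>\<^bsub>A 1\<^esub>"] grp [of 1] by (simp add: group.is_monoid)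
  next
    case (insert i F)
    show ?case
    proof (cases "0 < i")
      case False
      then show ?thesis
        using insert by (intro insert.IH) auto
    next
      case True
      define y where "y = x(i := \<one>\<^bsub>A i\<^esub>)"
      have sub: "{k. 0 < k \<and> y k \<noteq> \<one>\<^bsub>A k\<^esub>} \<subseteq> F"
        using insert.prems by (auto simp: y_def)
      have x: "x \<in> extensional {0<..}" "\<And>k. 0 < k \<Longrightarrow> x k \<in> carrier (A k)"
        using insert.prems grp by (auto simp: carrier_sum_group_iff)
      have one: "\<one>\<^bsub>A k\<^esub> \<in> carrier (A k)" if "0 < k" for k
        using grp [OF that] by (simp add: group.is_monoid)
      have y: "y \<in> carrier (sum_group {0<..} A)"
        using True x one finite_subset [OF sub insert.hyps(1)] grp
        by (simp add: carrier_sum_group_iff y_def extensional_def)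
      have "x = homogeneous A i (x i) \<otimes>\<^bsub>sum_group {0<..} A\<^esub> y"
        using x one grp True
        by (fastforce simp: homogeneous_def y_def extensional_def group.is_monoid)
      moreover have "P (homogeneous A i (x i))" "P y"
        using hom True x(2) insert.IH [OF y sub] by auto
      moreover have "homogeneous A i (x i) \<in> carrier (sum_group {0<..} A)"
        using grp by (rule homogeneous_closed) (use True x(2) in auto)
      ultimately show ?thesis
        using mult [of "homogeneous A i (x i)" y] y by metis
    qed
  qed
  moreover have "finite {k. 0 < k \<and> x k \<noteq> \<one>\<^bsub>A k\<^esub>}"
    using x grp by (simp add: carrier_sum_group_iff)
  ultimately show ?thesis
    using x by blast
qed

text \<open>Injectivity comes from the projections, which recover the components of a sum, and surjectivity
  from generation.\<close>

lemma (in comm_group) direct_sum_by_projections: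
  fixes H :: "nat \<Rightarrow> 'a set" and p :: "nat \<Rightarrow> 'a \<Rightarrow> 'a"
  assumes sub: "\<And>i. 0 < i \<Longrightarrow> subgroup (H i) G"
    and gen: "\<And>K. \<lbrakk>subgroup K G; \<And>i. 0 < i \<Longrightarrow> H i \<subseteq> K\<rbrakk> \<Longrightarrow> carrier G \<subseteq> K"
    and p_hom: "\<And>i. 0 < i \<Longrightarrow> p i \<in> hom G G"
    and p_id: "\<And>i x. \<lbrakk>0 < i; x \<in> H i\<rbrakk> \<Longrightarrow> p i x = x"
    and p_one: "\<And>i j x. \<lbrakk>0 < i; 0 < j; i \<noteq> j; x \<in> H j\<rbrakk> \<Longrightarrow> p i x = \<one>"
  shows "(\<lambda>h. gfinprod G h {0<..}) \<in> iso (sum_group {0<..} (\<lambda>i. G\<lparr>carrier := H i\<rparr>)) G"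
proof -
  let ?A = "\<lambda>i. G\<lparr>carrier := H i\<rparr>"
  let ?S = "sum_group {0<..} ?A"
  let ?f = "\<lambda>h. gfinprod G h {0<..}"
  have grp: "group (?A i)" if "0 < i" for i
    using sub [OF that] by (rule subgroup.subgroup_is_group) (rule is_group)
  have in_carrier: "a \<in> carrier G" if "0 < i" "a \<in> H i" for i a
    using sub that by (auto intro: subgroup.mem_carrier)
  have "(\<lambda>h. gfinprod G (\<lambda>i. h i) {0<..}) \<in> hom ?S G"
    using grp in_carrier by (intro hom_group_sum) (auto simp: hom_def)
  then interpret f: group_hom ?S G ?f
    using grp by (auto simp: group_hom_def group_hom_axioms_def is_group intro!: sum_group)
  have f_homogeneous: "?f (homogeneous ?A i a) = a" if i: "0 < i" and a: "a \<in> H i" for i a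
  proof -
    have "?f (homogeneous ?A i a) = gfinprod G (homogeneous ?A i a) {i}"
      by (rule gfinprod_mono_neutral_cong_right)
        (use i a in_carrier in \<open>auto simp: homogeneous_apply split: if_splits\<close>)
    also have "\<dots> = a"
      using i a in_carrier by (simp add: homogeneous_apply)
    finally show ?thesis .
  qed
  have p_f: "p i (?f h) = h i" if i: "0 < i" and h: "h \<in> carrier ?S" for i h
    using h
  proof (induction rule: sum_group_induct)
    case (homogeneous j a)
    then show ?case
      using i f_homogeneous p_id p_one by (auto simp: homogeneous_apply)
  next
    case (mult x y)
    then show ?case
      using hom_mult [OF p_hom [OF i]] f.hom_closed f.hom_mult i by (simp del: mult_sum_group) simp
  qed (use grp in auto)
  have "?f ` carrier ?S = carrier G"
  proof
    show "carrier G \<subseteq> ?f ` carrier ?S"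
    proof (rule gen)
      show "subgroup (?f ` carrier ?S) G"
        by (rule f.img_is_subgroup)
      show "H i \<subseteq> ?f ` carrier ?S" if i: "0 < i" for i
      proof
        fix a assume a: "a \<in> H i"
        show "a \<in> ?f ` carrier ?S"
        proof (rule image_eqI)
          show "a = ?f (homogeneous ?A i a)"
            using i a by (simp add: f_homogeneous)
          show "homogeneous ?A i a \<in> carrier ?S"
            using grp by (rule homogeneous_closed) (use i a in auto)
        qed
      qed
    qed
  qed (use f.hom_closed in auto)
  moreover have "inj_on ?f (carrier ?S)"
  proof (rule inj_onI)
    fix g h assume g: "g \<in> carrier ?S" and h: "h \<in> carrier ?S" and eq: "?f g = ?f h"
    have "g i = h i" if "0 < i" for i
      using p_f [OF that g] p_f [OF that h] eq by simp
    moreover have "g \<in> extensional {0<..}" "h \<in> extensional {0<..}"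
      using g h grp by (simp_all add: carrier_sum_group_iff)
    ultimately show "g = h"
      by (metis extensionalityI greaterThan_iff)
  qed
  ultimately show ?thesis
    using f.homh by (simp add: iso_def bij_betw_def)
qed

text \<open>The direct sums below are additive groups of records of several types, and are compared with
  \<open>sum_group\<close> through their carriers and operations only.\<close>

lemma comm_group_cong:
  assumes A: "comm_group A" and eq: "carrier B = carrier A" "(\<otimes>\<^bsub>B\<^esub>) = (\<otimes>\<^bsub>A\<^esub>)" "\<one>\<^bsub>B\<^esub> = \<one>\<^bsub>A\<^esub>"
  shows "comm_group B"
proof -
  interpret comm_group A by fact
  show ?thesis
    by (rule comm_groupI) (use m_assoc m_comm l_inv_ex in \<open>auto simp: eq\<close>)
qed

lemma sum_group_direct_sum:
  fixes S :: "(nat \<Rightarrow> 'a, 'm) monoid_scheme"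
  assumes A: "\<And>i. 0 < i \<Longrightarrow> comm_group (A i)"
    and carrier_S: "carrier S = carrier (sum_group {0<..} A)"
    and mult_S: "(\<otimes>\<^bsub>S\<^esub>) = (\<otimes>\<^bsub>sum_group {0<..} A\<^esub>)"
    and one_S: "\<one>\<^bsub>S\<^esub> = \<one>\<^bsub>sum_group {0<..} A\<^esub>"
  shows "comm_group S"
    and "\<And>i. 0 < i \<Longrightarrow> subgroup (homogeneous A i ` carrier (A i)) S"
    and "(\<lambda>h. gfinprod S h {0<..})
      \<in> iso (sum_group {0<..} (\<lambda>i. S\<lparr>carrier := homogeneous A i ` carrier (A i)\<rparr>)) S"
proof -
  note S_simps = carrier_S mult_S one_S
  have grp: "group (A i)" if "0 < i" for i
    using A [OF that] by (rule comm_group.axioms)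
  show "comm_group S"
    using comm_group_sum_group [OF A] S_simps by (rule comm_group_cong)
  then interpret S: comm_group S .
  have hom: "homogeneous A i \<in> hom (A i) S" if "0 < i" for i
    using that grp
    by (auto simp: hom_def homogeneous_closed homogeneous_mult S_simps simp del: mult_sum_group)
  show sub: "subgroup (homogeneous A i ` carrier (A i)) S" if "0 < i" for i
    using hom grp that
    by (intro group_hom.img_is_subgroup) (simp add: group_hom_def group_hom_axioms_def S.is_group)
  have proj: "(\<lambda>x. x i) \<in> hom S (A i)" if "0 < i" for i
    using that grp by (auto simp: hom_def S_simps carrier_sum_group_iff)
  show "(\<lambda>h. gfinprod S h {0<..})
      \<in> iso (sum_group {0<..} (\<lambda>i. S\<lparr>carrier := homogeneous A i ` carrier (A i)\<rparr>)) S"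
  proof (rule S.direct_sum_by_projections [where p = "\<lambda>i x. homogeneous A i (x i)"])
    show "carrier S \<subseteq> K"
      if K: "subgroup K S" and H: "\<And>i. 0 < i \<Longrightarrow> homogeneous A i ` carrier (A i) \<subseteq> K" for K
    proof
      fix x assume "x \<in> carrier S"
      then show "x \<in> K"
        unfolding carrier_S
      proof (induction rule: sum_group_induct)
        case (mult x y)
        then show ?case
          using subgroup.m_closed [OF K] by (simp add: mult_S del: mult_sum_group)
      qed (use H grp in auto)
    qed
    show "(\<lambda>x. homogeneous A i (x i)) \<in> hom S S" if "0 < i" for i
      using hom_compose [OF proj hom, OF that that] by (simp add: comp_def)
    show "homogeneous A i (x i) = \<one>\<^bsub>S\<^esub>"
      if "0 < i" "0 < j" "i \<noteq> j" "x \<in> homogeneous A j ` carrier (A j)" for i j x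
      using that homogeneous_one [of A i] by (auto simp: homogeneous_apply S_simps)
    show "homogeneous A i (x i) = x" if "0 < i" "x \<in> homogeneous A i ` carrier (A i)" for i x
      using that by (auto simp: homogeneous_apply)
  qed (rule sub)
qed

context graded_abelian_group
begin

lemma component_group: "0 < i \<Longrightarrow> group ((add_monoid V)\<lparr>carrier := H i\<rparr>)"
  using component_subgroup by (intro subgroup.subgroup_is_group a_group) (rule additive_subgroup.a_subgroup)

lemma component_carrier: "\<lbrakk>0 < i; x \<in> H i\<rbrakk> \<Longrightarrow> x \<in> carrier V"
  using component_subgroup by (rule additive_subgroup.a_Hcarr)

lemma sum_homogeneous:
  assumes i: "0 < i" and a: "a \<in> H i"
  shows "gfinprod (add_monoid V) (homogeneous (\<lambda>i. (add_monoid V)\<lparr>carrier := H i\<rparr>) i a) {0<..} = a"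
proof -
  let ?h = "homogeneous (\<lambda>i. (add_monoid V)\<lparr>carrier := H i\<rparr>) i a"
  have "gfinprod (add_monoid V) ?h {0<..} = gfinprod (add_monoid V) ?h {i}"
    by (rule add.gfinprod_mono_neutral_cong_right)
      (use i a component_carrier in \<open>auto simp: homogeneous_apply split: if_splits\<close>)
  also have "\<dots> = a"
    using i a component_carrier by (simp add: homogeneous_apply)
  finally show ?thesis .
qed

lemma graded_induct [consumes 1, case_names homogeneous add]:
  assumes x: "x \<in> carrier V"
    and hom: "\<And>i a. \<lbrakk>0 < i; a \<in> H i\<rbrakk> \<Longrightarrow> P a"
    and add: "\<And>x y. \<lbrakk>x \<in> carrier V; y \<in> carrier V; P x; P y\<rbrakk> \<Longrightarrow> P (x \<oplus> y)"
  shows "P x"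
proof -
  let ?A = "\<lambda>i. (add_monoid V)\<lparr>carrier := H i\<rparr>"
  let ?f = "\<lambda>h. gfinprod (add_monoid V) h {0<..}"
  have f: "?f \<in> hom (sum_group {0<..} ?A) (add_monoid V)"
    "?f ` carrier (sum_group {0<..} ?A) = carrier V"
    using direct_sum by (auto simp: iso_def bij_betw_def)
  have P_f: "P (?f h)" if "h \<in> carrier (sum_group {0<..} ?A)" for h
    using that
  proof (induction rule: sum_group_induct)
    case (group i)
    then show ?case
      by (rule component_group)
  next
    case (homogeneous i a)
    then show ?case
      using hom by (subst sum_homogeneous) auto
  next
    case (mult x y)
    then show ?case
      using add hom_mult [OF f(1)] hom_in_carrier [OF f(1)] by (simp del: mult_sum_group)
  qed
  have "x \<in> ?f ` carrier (sum_group {0<..} ?A)"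
    by (subst f(2)) (rule x)
  then obtain h where "x = ?f h" "h \<in> carrier (sum_group {0<..} ?A)"
    by (rule imageE)
  with P_f show ?thesis
    by (simp only:)
qed

text \<open>The converse of \<open>direct_sum_by_projections\<close>, used to carry a grading over to a tensor product.\<close>

lemma projections:
  obtains p where "\<And>i. 0 < i \<Longrightarrow> p i \<in> hom (add_monoid V) (add_monoid V)"
    and "\<And>i x. \<lbrakk>0 < i; x \<in> carrier V\<rbrakk> \<Longrightarrow> p i x \<in> H i"
    and "\<And>i x. \<lbrakk>0 < i; x \<in> H i\<rbrakk> \<Longrightarrow> p i x = x"
    and "\<And>i j x. \<lbrakk>0 < i; 0 < j; i \<noteq> j; x \<in> H j\<rbrakk> \<Longrightarrow> p i x = \<zero>"
proof -
  let ?A = "\<lambda>i. (add_monoid V)\<lparr>carrier := H i\<rparr>"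
  let ?S = "sum_group {0<..} ?A"
  let ?f = "\<lambda>h. gfinprod (add_monoid V) h {0<..}"
  have S: "group ?S"
    using component_group by (intro sum_group) auto
  define g where "g = inv_into (carrier ?S) ?f"
  have g: "g \<in> hom (add_monoid V) ?S"
    using group.iso_set_sym [OF S direct_sum] by (simp add: g_def iso_def)
  have inj: "inj_on ?f (carrier ?S)"
    using direct_sum by (simp add: iso_def bij_betw_def)
  have g_homogeneous: "g x = homogeneous ?A j x" if "0 < j" "x \<in> H j" for j x
  proof -
    have "homogeneous ?A j x \<in> carrier ?S"
      using component_group by (rule homogeneous_closed) (use that in auto)
    then show ?thesis
      unfolding g_def using inv_into_f_f [OF inj] that by (metis sum_homogeneous)
  qed
  have g_carrier: "g x i \<in> H i" if "0 < i" "x \<in> carrier V" for i x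
  proof -
    have "g x \<in> carrier ?S"
      using hom_in_carrier [OF g] that by simp
    then show ?thesis
      using that component_group by (simp add: carrier_sum_group_iff)
  qed
  show thesis
  proof (rule that [of "\<lambda>i x. g x i"])
    show "(\<lambda>x. g x i) \<in> hom (add_monoid V) (add_monoid V)" if i: "0 < i" for i
    proof (rule homI)
      show "g (x \<otimes>\<^bsub>add_monoid V\<^esub> y) i = g x i \<otimes>\<^bsub>add_monoid V\<^esub> g y i"
        if "x \<in> carrier (add_monoid V)" "y \<in> carrier (add_monoid V)" for x y
        using hom_mult [OF g that] i by simp
      show "g x i \<in> carrier (add_monoid V)" if "x \<in> carrier (add_monoid V)" for x
        using that i g_carrier component_carrier by simp
    qed
    show "g x i = \<zero>" if "0 < i" "0 < j" "i \<noteq> j" "x \<in> H j" for i j x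
      using that by (simp add: g_homogeneous homogeneous_apply)
  qed (use g_homogeneous g_carrier in \<open>auto simp: homogeneous_apply\<close>)
qed

end

section \<open>Convolution of graded pairings\<close>

text \<open>
  Multiplication of formal sums, given the products of homogeneous elements. The Lie product of
  \<open>L\<^sub>*(\<gamma>)\<close> has this form, and so has the action of \<open>x \<otimes> r\<close> for fixed \<open>r\<close>. As degrees are positive,
  only the finitely many decompositions \<open>k = i + j\<close> with \<open>0 < i < k\<close> contribute in degree \<open>k\<close>.
\<close>

definition convolution ::
  "(nat \<Rightarrow> nat \<Rightarrow> 'a \<Rightarrow> 'b \<Rightarrow> 'c) \<Rightarrow> (nat \<Rightarrow> ('c, 'm) monoid_scheme)
    \<Rightarrow> (nat \<Rightarrow> 'a) \<Rightarrow> (nat \<Rightarrow> 'b) \<Rightarrow> nat \<Rightarrow> 'c"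
  where "convolution \<beta> C a b =
    (\<lambda>k\<in>{0<..}. finprod (C k) (\<lambda>i. \<beta> i (k - i) (a i) (b (k - i))) {0<..<k})"

locale graded_pairing =
  fixes A :: "nat \<Rightarrow> ('a, 'k) monoid_scheme" and B :: "nat \<Rightarrow> ('b, 'l) monoid_scheme"
    and C :: "nat \<Rightarrow> ('c, 'm) monoid_scheme" and \<beta> :: "nat \<Rightarrow> nat \<Rightarrow> 'a \<Rightarrow> 'b \<Rightarrow> 'c"
  assumes A: "0 < i \<Longrightarrow> comm_group (A i)"
    and B: "0 < i \<Longrightarrow> comm_group (B i)"
    and C: "0 < i \<Longrightarrow> comm_group (C i)"
    and pairing: "\<lbrakk>0 < i; 0 < j\<rbrakk> \<Longrightarrow> biadditive (A i) (B j) (C (i + j)) (\<beta> i j)"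
begin

lemma groups:
  "0 < i \<Longrightarrow> group (A i)" "0 < i \<Longrightarrow> group (B i)" "0 < i \<Longrightarrow> group (C i)"
  using A B C by (auto intro: comm_group.axioms)

lemma pairing_sub:
  assumes "i \<in> {0<..<k}"
  shows "biadditive (A i) (B (k - i)) (C k) (\<beta> i (k - i))"
  using assms pairing [of i "k - i"] by simp

lemma convolution_apply:
  "0 < k \<Longrightarrow> convolution \<beta> C a b k
    = finprod (C k) (\<lambda>i. \<beta> i (k - i) (a i) (b (k - i))) {0<..<k}"
  by (simp add: convolution_def)

lemma term_closed:
  assumes "a \<in> carrier (sum_group {0<..} A)" "b \<in> carrier (sum_group {0<..} B)" "i \<in> {0<..<k}"
  shows "\<beta> i (k - i) (a i) (b (k - i)) \<in> carrier (C k)"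
  using assms groups by (intro biadditive_closed [OF pairing_sub]) (auto simp: carrier_sum_group_iff)

lemma convolution_closed:
  assumes a: "a \<in> carrier (sum_group {0<..} A)" and b: "b \<in> carrier (sum_group {0<..} B)"
  shows "convolution \<beta> C a b \<in> carrier (sum_group {0<..} C)"
proof -
  let ?SA = "{i. 0 < i \<and> a i \<noteq> \<one>\<^bsub>A i\<^esub>}" and ?SB = "{i. 0 < i \<and> b i \<noteq> \<one>\<^bsub>B i\<^esub>}"
  let ?SC = "{k. 0 < k \<and> convolution \<beta> C a b k \<noteq> \<one>\<^bsub>C k\<^esub>}"
  have "k \<in> (\<lambda>(i, j). i + j) ` (?SA \<times> ?SB)" if k: "k \<in> ?SC" for k
  proof (rule ccontr)
    assume notin: "k \<notin> (\<lambda>(i, j). i + j) ` (?SA \<times> ?SB)"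
    interpret C: comm_group "C k"
      using k C by simp
    have "\<beta> i (k - i) (a i) (b (k - i)) = \<one>\<^bsub>C k\<^esub>" if i: "i \<in> {0<..<k}" for i
    proof -
      have "k = (\<lambda>(i, j). i + j) (i, k - i)"
        using i by simp
      then have "(i, k - i) \<notin> ?SA \<times> ?SB"
        using notin by blast
      then have "a i = \<one>\<^bsub>A i\<^esub> \<or> b (k - i) = \<one>\<^bsub>B (k - i)\<^esub>"
        using i by auto
      moreover have "a i \<in> carrier (A i)" "b (k - i) \<in> carrier (B (k - i))"
        using i a b groups by (auto simp: carrier_sum_group_iff)
      ultimately show ?thesis
        using i groups biadditive_one_left [OF pairing_sub [OF i]]
          biadditive_one_right [OF pairing_sub [OF i]] by auto
    qed
    then have "convolution \<beta> C a b k = \<one>\<^bsub>C k\<^esub>"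
      using k by (auto simp: convolution_apply intro!: C.finprod_one_eqI)
    with k show False
      by simp
  qed
  moreover have "finite (?SA \<times> ?SB)"
    using a b groups by (simp add: carrier_sum_group_iff)
  ultimately have "finite ?SC"
    by (meson finite_imageI finite_subset subsetI)
  moreover have "convolution \<beta> C a b k \<in> carrier (C k)" if k: "0 < k" for k
  proof -
    interpret C: comm_group "C k"
      using k C by simp
    show ?thesis
      unfolding convolution_apply [OF k] using term_closed [OF a b] by (intro C.finprod_closed) auto
  qed
  moreover have "convolution \<beta> C a b \<in> extensional {0<..}"
    by (simp add: convolution_def)
  ultimately show ?thesis
    using groups by (simp add: carrier_sum_group_iff)
qed

lemma convolution_mult:
  assumes a1: "a1 \<in> carrier (sum_group {0<..} A)" and b1: "b1 \<in> carrier (sum_group {0<..} B)"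
    and a2: "a2 \<in> carrier (sum_group {0<..} A)" and b2: "b2 \<in> carrier (sum_group {0<..} B)"
    and mult: "\<And>k i. i \<in> {0<..<k} \<Longrightarrow> \<beta> i (k - i) (a i) (b (k - i))
      = \<beta> i (k - i) (a1 i) (b1 (k - i)) \<otimes>\<^bsub>C k\<^esub> \<beta> i (k - i) (a2 i) (b2 (k - i))"
  shows "convolution \<beta> C a b
    = convolution \<beta> C a1 b1 \<otimes>\<^bsub>sum_group {0<..} C\<^esub> convolution \<beta> C a2 b2"
proof -
  have "convolution \<beta> C a b k = convolution \<beta> C a1 b1 k \<otimes>\<^bsub>C k\<^esub> convolution \<beta> C a2 b2 k"
    if k: "0 < k" for k
  proof -
    interpret C: comm_group "C k"
      using k C by simp
    have "finprod (C k) (\<lambda>i. \<beta> i (k - i) (a i) (b (k - i))) {0<..<k}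
      = finprod (C k) (\<lambda>i. \<beta> i (k - i) (a1 i) (b1 (k - i)) \<otimes>\<^bsub>C k\<^esub> \<beta> i (k - i) (a2 i) (b2 (k - i)))
          {0<..<k}"
      by (rule C.finprod_cong') (use mult term_closed a1 b1 a2 b2 in auto)
    then show ?thesis
      using term_closed a1 b1 a2 b2 by (simp add: convolution_apply [OF k] C.finprod_multf Pi_iff)
  qed
  then show ?thesis
    by (auto simp: fun_eq_iff convolution_def)
qed

lemma convolution_biadditive:
  "biadditive (sum_group {0<..} A) (sum_group {0<..} B) (sum_group {0<..} C) (convolution \<beta> C)"
  by (rule biadditiveI; (rule convolution_closed convolution_mult; assumption?))
    (simp_all add: groups carrier_sum_group_iff biadditive_mult_left [OF pairing_sub]
      biadditive_mult_right [OF pairing_sub])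

lemma convolution_homogeneous:
  assumes i: "0 < i" and j: "0 < j" and a: "a \<in> carrier (A i)" and b: "b \<in> carrier (B j)"
  shows "convolution \<beta> C (homogeneous A i a) (homogeneous B j b) = homogeneous C (i + j) (\<beta> i j a b)"
proof
  fix k
  show "convolution \<beta> C (homogeneous A i a) (homogeneous B j b) k
      = homogeneous C (i + j) (\<beta> i j a b) k"
  proof (cases "0 < k")
    case True
    interpret C: comm_group "C k"
      using True C by simp
    let ?t = "\<lambda>l. \<beta> l (k - l) (homogeneous A i a l) (homogeneous B j b (k - l))"
    have one_A: "\<one>\<^bsub>A l\<^esub> \<in> carrier (A l)" if "0 < l" for l
      using groups that by (simp add: group.is_monoid)
    have one_B: "\<one>\<^bsub>B l\<^esub> \<in> carrier (B l)" if "0 < l" for l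
      using groups that by (simp add: group.is_monoid)
    have t: "?t l = (if l = i \<and> k = i + j then \<beta> i j a b else \<one>\<^bsub>C k\<^esub>)" if l: "l \<in> {0<..<k}" for l
    proof (cases "l = i \<and> k - l = j")
      case True
      then show ?thesis
        using i j l by (auto simp: homogeneous_apply)
    next
      case False
      then have "?t l = \<one>\<^bsub>C k\<^esub>"
        using i j l a b groups one_A one_B biadditive_one_left [OF pairing_sub [OF l]]
          biadditive_one_right [OF pairing_sub [OF l]]
        by (auto simp: homogeneous_apply)
      then show ?thesis
        using False l by auto
    qed
    show ?thesis
    proof (cases "k = i + j")
      case True
      have "finprod (C k) ?t {0<..<k} = finprod (C k) (\<lambda>l. if i = l then \<beta> i j a b else \<one>\<^bsub>C k\<^esub>) {0<..<k}"
        by (rule C.finprod_cong')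
          (use t True C.one_closed biadditive_closed [OF pairing [OF i j] a b] in auto)
      also have "\<dots> = \<beta> i j a b"
        using True i j biadditive_closed [OF pairing [OF i j] a b]
        by (subst C.finprod_singleton) auto
      finally show ?thesis
        using True i by (simp add: convolution_apply homogeneous_apply)
    next
      case False
      then have "finprod (C k) ?t {0<..<k} = \<one>\<^bsub>C k\<^esub>"
        using t by (intro C.finprod_one_eqI) auto
      then show ?thesis
        using False \<open>0 < k\<close> by (simp add: convolution_apply homogeneous_apply)
    qed
  next
    case False
    then show ?thesis
      by (simp add: convolution_def homogeneous_def)
  qed
qed

end

section \<open>Tensor products of abelian groups\<close>

locale tensor_product = L: abelian_group L + R: abelian_group R
  for L :: "('l, 'c) ring_scheme" and R :: "('r, 'd) ring_scheme"
begin

abbreviation F where "F \<equiv> free_Abelian_group (carrier L \<times> carrier R)"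
abbreviation N where "N \<equiv> tensor_relations L R"
abbreviation T where "T \<equiv> tensor_group L R"

lemma relation_left:
  "\<lbrakk>a \<in> carrier L; b \<in> carrier L; r \<in> carrier R\<rbrakk>
    \<Longrightarrow> frag_of (a \<oplus>\<^bsub>L\<^esub> b, r) - frag_of (a, r) - frag_of (b, r) \<in> N"
  unfolding tensor_relations_def by (rule generate.incl) blast

lemma relation_right:
  "\<lbrakk>a \<in> carrier L; r \<in> carrier R; s \<in> carrier R\<rbrakk>
    \<Longrightarrow> frag_of (a, r \<oplus>\<^bsub>R\<^esub> s) - frag_of (a, r) - frag_of (a, s) \<in> N"
  unfolding tensor_relations_def by (rule generate.incl) blast

lemma relations_subgroup: "subgroup N F"
proof -
  have "frag_of p \<in> carrier F" if "p \<in> carrier L \<times> carrier R" for p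
    using that by simp
  moreover have "c - d \<in> carrier F" if "c \<in> carrier F" "d \<in> carrier F" for c d
    using that keys_diff [of c d] by auto
  ultimately show ?thesis
    unfolding tensor_relations_def
    by (intro group.generate_is_subgroup group_free_Abelian_group) (fastforce simp: image_subset_iff)
qed

sublocale F: comm_group F
  by (rule abelian_free_Abelian_group)

sublocale N: normal N F
  by (rule F.subgroup_imp_normal [OF relations_subgroup])

sublocale T: comm_group T
  unfolding tensor_group_def by (rule F.abelian_FactGroup [OF relations_subgroup])

lemma tensor_class_hom: "tensor_class L R \<in> hom F T"
  using N.r_coset_hom_Mod by (simp add: tensor_group_def tensor_class_def [abs_def])

sublocale tensor_class: group_hom F T "tensor_class L R"
  using tensor_class_hom
  by (simp add: group_hom_def group_hom_axioms_def T.is_group F.is_group)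

lemma tensor_group_carrier: "carrier T = tensor_class L R ` carrier F"
  by (simp add: tensor_group_def tensor_class_def [abs_def] carrier_FactGroup)

lemma tensor_class_eq_iff:
  assumes "c \<in> carrier F" "d \<in> carrier F"
  shows "tensor_class L R c = tensor_class L R d \<longleftrightarrow> c - d \<in> N"
proof -
  have cd: "c - d \<in> carrier F"
    using assms keys_diff [of c d] by auto
  have "tensor_class L R c = tensor_class L R d \<otimes>\<^bsub>T\<^esub> tensor_class L R (c - d)"
    using tensor_class.hom_mult [OF assms(2) cd] by simp
  moreover have "tensor_class L R (c - d) = \<one>\<^bsub>T\<^esub> \<longleftrightarrow> c - d \<in> N"
    using F.coset_eq_subgroup_iff [OF relations_subgroup cd]
    by (simp add: tensor_class_def tensor_group_def)
  ultimately show ?thesis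
    using tensor_class.hom_closed [OF assms(1)] tensor_class.hom_closed [OF assms(2)]
      tensor_class.hom_closed [OF cd]
    by (simp del: carrier_free_Abelian_group_iff)
qed

lemma tensor_class_eq:
  assumes "A \<in> carrier T" "c \<in> A"
  shows "c \<in> carrier F" "tensor_class L R c = A"
proof -
  obtain d where d: "d \<in> carrier F" "A = tensor_class L R d"
    using assms by (auto simp: tensor_group_carrier)
  have c: "c \<in> N #>\<^bsub>F\<^esub> d"
    using assms d by (simp add: tensor_class_def)
  then show "c \<in> carrier F"
    using d N.elemrcos_carrier [OF F.is_group] by blast
  show "tensor_class L R c = A"
    unfolding d(2) tensor_class_def using c d F.repr_independence relations_subgroup by metis
qed

lemma tensor_nonempty: "A \<in> carrier T \<Longrightarrow> A \<noteq> {}"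
  using F.rcos_self [OF _ relations_subgroup]
  by (force simp: tensor_group_carrier tensor_class_def simp del: carrier_free_Abelian_group_iff)

lemma pure_tensor_closed:
  "\<lbrakk>a \<in> carrier L; r \<in> carrier R\<rbrakk> \<Longrightarrow> pure_tensor L R a r \<in> carrier T"
  unfolding pure_tensor_def by (rule tensor_class.hom_closed) simp

lemma pure_tensor_biadditive:
  "biadditive (add_monoid L) (add_monoid R) T (pure_tensor L R)"
proof (rule biadditiveI)
  have sum: "tensor_class L R c = tensor_class L R d \<otimes>\<^bsub>T\<^esub> tensor_class L R e"
    if "c \<in> carrier F" "d \<in> carrier F" "e \<in> carrier F" "c - d - e \<in> N" for c d e
  proof -
    have "d + e \<in> carrier F"
      using F.m_closed [OF that(2,3)] by simp
    then have "tensor_class L R c = tensor_class L R (d + e)"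
      using that by (simp add: tensor_class_eq_iff diff_diff_add)
    then show ?thesis
      using tensor_class.hom_mult [OF that(2,3)] by simp
  qed
  show "pure_tensor L R (a \<otimes>\<^bsub>add_monoid L\<^esub> b) r
      = pure_tensor L R a r \<otimes>\<^bsub>T\<^esub> pure_tensor L R b r"
    if "a \<in> carrier (add_monoid L)" "b \<in> carrier (add_monoid L)" "r \<in> carrier (add_monoid R)"
    for a b r
    unfolding pure_tensor_def
    by (rule sum) (use that relation_left in simp_all)
  show "pure_tensor L R a (r \<otimes>\<^bsub>add_monoid R\<^esub> s)
      = pure_tensor L R a r \<otimes>\<^bsub>T\<^esub> pure_tensor L R a s"
    if "a \<in> carrier (add_monoid L)" "r \<in> carrier (add_monoid R)" "s \<in> carrier (add_monoid R)"
    for a r s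
    unfolding pure_tensor_def
    by (rule sum) (use that relation_right in simp_all)
next
  show "pure_tensor L R a r \<in> carrier T"
    if "a \<in> carrier (add_monoid L)" "r \<in> carrier (add_monoid R)" for a r
    using that by (simp add: pure_tensor_closed)
qed

lemma pure_tensor_zero_left: "r \<in> carrier R \<Longrightarrow> pure_tensor L R \<zero>\<^bsub>L\<^esub> r = \<one>\<^bsub>T\<^esub>"
  using biadditive_one_left [OF pure_tensor_biadditive L.a_group T.is_group, of r] by simp

lemma pure_tensor_minus_left:
  assumes "a \<in> carrier L" "r \<in> carrier R"
  shows "pure_tensor L R (\<ominus>\<^bsub>L\<^esub> a) r = inv\<^bsub>T\<^esub> pure_tensor L R a r"
proof -
  have "pure_tensor L R (\<ominus>\<^bsub>L\<^esub> a) r \<otimes>\<^bsub>T\<^esub> pure_tensor L R a r = \<one>\<^bsub>T\<^esub>"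
    using biadditive_mult_left [OF pure_tensor_biadditive, of "\<ominus>\<^bsub>L\<^esub> a" a r] assms
    by (simp add: L.l_neg pure_tensor_zero_left)
  then show ?thesis
    using assms by (intro T.inv_equality [symmetric]) (simp_all add: pure_tensor_closed)
qed

text \<open>As \<open>-(a \<otimes> r) = (-a) \<otimes> r\<close>, pure tensors generate even as a monoid.\<close>

lemma tensor_induct [consumes 1, case_names pure mult]:
  assumes A: "A \<in> carrier T"
    and pure: "\<And>a r. \<lbrakk>a \<in> carrier L; r \<in> carrier R\<rbrakk> \<Longrightarrow> P (pure_tensor L R a r)"
    and mult: "\<And>A B. \<lbrakk>A \<in> carrier T; B \<in> carrier T; P A; P B\<rbrakk> \<Longrightarrow> P (A \<otimes>\<^bsub>T\<^esub> B)"
  shows "P A"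
proof -
  obtain c where c: "c \<in> carrier F" and A_eq: "A = tensor_class L R c"
    using A by (auto simp: tensor_group_carrier)
  have "Poly_Mapping.keys c \<subseteq> carrier L \<times> carrier R"
    using c by simp
  then have "P (tensor_class L R c) \<and> P (tensor_class L R (- c))"
  proof (induction rule: free_Abelian_group_induct [consumes 1, case_names zero diff generator])
    case zero
    have "tensor_class L R 0 = pure_tensor L R \<zero>\<^bsub>L\<^esub> \<zero>\<^bsub>R\<^esub>"
      using tensor_class.hom_one by (simp add: pure_tensor_zero_left)
    then show ?case
      using pure [of "\<zero>\<^bsub>L\<^esub>" "\<zero>\<^bsub>R\<^esub>"] by simp
  next
    case (diff x y)
    have x: "x \<in> carrier F" "- x \<in> carrier F" and y: "y \<in> carrier F" "- y \<in> carrier F"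
      using diff by simp_all
    have "tensor_class L R (x - y) = tensor_class L R x \<otimes>\<^bsub>T\<^esub> tensor_class L R (- y)"
      using tensor_class.hom_mult [OF x(1) y(2)] by simp
    moreover have "tensor_class L R (- (x - y)) = tensor_class L R y \<otimes>\<^bsub>T\<^esub> tensor_class L R (- x)"
      using tensor_class.hom_mult [OF y(1) x(2)] by simp
    ultimately show ?case
      using diff mult tensor_class.hom_closed x y by metis
  next
    case (generator p)
    then obtain a r where p: "p = (a, r)" and a: "a \<in> carrier L" and r: "r \<in> carrier R"
      by blast
    have "tensor_class L R (- frag_of p) = pure_tensor L R (\<ominus>\<^bsub>L\<^esub> a) r"
      using tensor_class.hom_inv [of "frag_of p"] a r
      by (simp add: p pure_tensor_minus_left) (simp add: pure_tensor_def)
    then show ?case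
      using pure [OF a r] pure [of "\<ominus>\<^bsub>L\<^esub> a" r] a r by (simp add: p pure_tensor_def)
  qed
  then show ?thesis
    by (simp add: A_eq)
qed

lemma hom_eq_on_pure_tensors:
  assumes "g \<in> hom T M" "h \<in> hom T M" "A \<in> carrier T"
    and "\<And>a r. \<lbrakk>a \<in> carrier L; r \<in> carrier R\<rbrakk>
      \<Longrightarrow> g (pure_tensor L R a r) = h (pure_tensor L R a r)"
  shows "g A = h A"
  using assms(3)
proof (induction rule: tensor_induct)
  case (mult A B)
  then show ?case
    using hom_mult [OF assms(1)] hom_mult [OF assms(2)] by simp
qed (rule assms(4))

text \<open>A biadditive map extends to the free abelian group and kills the relations.\<close>

lemma tensor_universal:
  assumes M: "comm_group M" and f: "biadditive (add_monoid L) (add_monoid R) M f"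
  obtains h where "h \<in> hom T M"
    and "\<And>a r. \<lbrakk>a \<in> carrier L; r \<in> carrier R\<rbrakk> \<Longrightarrow> h (pure_tensor L R a r) = f a r"
proof -
  interpret M: comm_group M by fact
  have f_closed: "f a r \<in> carrier M" if "a \<in> carrier L" "r \<in> carrier R" for a r
    using biadditive_closed [OF f] that by simp
  then have "(\<lambda>(a, r). f a r) ` (carrier L \<times> carrier R) \<subseteq> carrier M"
    by auto
  from M.free_Abelian_group_universal [OF this]
  obtain h where h: "h \<in> hom F M"
    and h_of: "\<And>p. p \<in> carrier L \<times> carrier R \<Longrightarrow> h (frag_of p) = (\<lambda>(a, r). f a r) p"
    by metis
  interpret h: group_hom F M h
    using h by (simp add: group_hom_def group_hom_axioms_def M.is_group F.is_group)
  have in_kernel: "c - d - e \<in> kernel F M h"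
    if "c \<in> carrier F" "d \<in> carrier F" "e \<in> carrier F" "h c = h d \<otimes>\<^bsub>M\<^esub> h e" for c d e
  proof -
    have de: "d + e \<in> carrier F"
      using F.m_closed [OF that(2,3)] by simp
    have eq: "c - d - e = c \<otimes>\<^bsub>F\<^esub> inv\<^bsub>F\<^esub> (d \<otimes>\<^bsub>F\<^esub> e)"
      using de by simp
    have "h (c \<otimes>\<^bsub>F\<^esub> inv\<^bsub>F\<^esub> (d \<otimes>\<^bsub>F\<^esub> e)) = \<one>\<^bsub>M\<^esub>"
      using that
      by (simp del: carrier_free_Abelian_group_iff mult_free_Abelian_group inv_free_Abelian_group)
    moreover have "c \<otimes>\<^bsub>F\<^esub> inv\<^bsub>F\<^esub> (d \<otimes>\<^bsub>F\<^esub> e) \<in> carrier F"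
      using that by (intro F.m_closed F.inv_closed)
    ultimately show ?thesis
      unfolding kernel_def eq by simp
  qed
  have "N \<subseteq> kernel F M h"
    unfolding tensor_relations_def
  proof (rule F.generate_subgroup_incl [OF _ h.subgroup_kernel], safe)
    fix a b r assume "a \<in> carrier L" "b \<in> carrier L" "r \<in> carrier R"
    then show "frag_of (a \<oplus>\<^bsub>L\<^esub> b, r) - frag_of (a, r) - frag_of (b, r) \<in> kernel F M h"
      using biadditive_mult_left [OF f, of a b r] by (intro in_kernel) (simp_all add: h_of)
  next
    fix a r s assume "a \<in> carrier L" "r \<in> carrier R" "s \<in> carrier R"
    then show "frag_of (a, r \<oplus>\<^bsub>R\<^esub> s) - frag_of (a, r) - frag_of (a, s) \<in> kernel F M h"
      using biadditive_mult_right [OF f, of a r s] by (intro in_kernel) (simp_all add: h_of)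
  qed
  have "h c = h d" if "c \<in> carrier F" "d \<in> carrier F" "N #>\<^bsub>F\<^esub> c = N #>\<^bsub>F\<^esub> d" for c d
  proof -
    have "c - d \<in> N"
      using that tensor_class_eq_iff by (simp add: tensor_class_def)
    then have cd: "c - d \<in> carrier F" "h (c - d) = \<one>\<^bsub>M\<^esub>"
      using \<open>N \<subseteq> kernel F M h\<close> unfolding kernel_def by blast+
    then show ?thesis
      using h.hom_mult [OF cd(1) that(2)] h.hom_closed [OF that(2)] by simp
  qed
  from FactGroup_universal [OF h N.normal_axioms this]
  obtain g where "g \<in> hom (F Mod N) M" "\<And>c. c \<in> carrier F \<Longrightarrow> g (N #>\<^bsub>F\<^esub> c) = h c"
    by metis
  then show thesis
    using that [of g] h_of by (simp add: tensor_group_def pure_tensor_def tensor_class_def)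
qed

text \<open>The operations of \<open>tensor_lie_ring\<close> are of the following form, a map on formal sums that is
  applied to all representatives of a class.\<close>

definition lift :: "('l \<times> 'r \<Rightarrow> ('l \<times> 'r \<Rightarrow>\<^sub>0 int))
    \<Rightarrow> ('l \<times> 'r \<Rightarrow>\<^sub>0 int) set \<Rightarrow> ('l \<times> 'r \<Rightarrow>\<^sub>0 int) set"
  where "lift g A = (\<Union>c\<in>A. tensor_class L R (frag_extend g c))"

text \<open>The map provided by the universal property agrees with \<open>frag_extend g\<close> on generators, and hence on
  every representative; this makes \<open>lift g\<close> single-valued.\<close>

lemma
  assumes g: "\<And>p. p \<in> carrier L \<times> carrier R \<Longrightarrow> g p \<in> carrier F"
    and bi: "biadditive (add_monoid L) (add_monoid R) T (\<lambda>a r. tensor_class L R (g (a, r)))"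
  shows lift_hom: "lift g \<in> hom T T"
    and lift_class: "c \<in> carrier F \<Longrightarrow> lift g (tensor_class L R c) = tensor_class L R (frag_extend g c)"
proof -
  obtain h where h: "h \<in> hom T T"
    and h_pure: "\<And>a r. \<lbrakk>a \<in> carrier L; r \<in> carrier R\<rbrakk>
      \<Longrightarrow> h (pure_tensor L R a r) = tensor_class L R (g (a, r))"
    using tensor_universal [OF T.comm_group_axioms bi] by metis
  interpret h: group_hom T T h
    using h by (simp add: group_hom_def group_hom_axioms_def T.is_group)
  have ext: "frag_extend g c \<in> carrier F" if c: "c \<in> carrier F" for c
  proof -
    have "Poly_Mapping.keys (g p) \<subseteq> carrier L \<times> carrier R" if "p \<in> Poly_Mapping.keys c" for p
      using g [of p] c that by (simp add: subsetD)
    then have "Poly_Mapping.keys (frag_extend g c) \<subseteq> carrier L \<times> carrier R"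
      by (intro order_trans [OF keys_frag_extend UN_least])
    then show ?thesis
      by simp
  qed
  have h_class: "h (tensor_class L R c) = tensor_class L R (frag_extend g c)"
    if "c \<in> carrier F" for c
  proof -
    have "Poly_Mapping.keys c \<subseteq> carrier L \<times> carrier R"
      using that by simp
    then show ?thesis
    proof (induction rule: free_Abelian_group_induct [consumes 1, case_names zero diff generator])
      case zero
      then show ?case
        using tensor_class.hom_one by simp
    next
      case (diff x y)
      have x: "x \<in> carrier F" and y: "y \<in> carrier F" "- y \<in> carrier F"
        using diff by simp_all
      have class_diff: "tensor_class L R (u - v) = tensor_class L R u \<otimes>\<^bsub>T\<^esub> inv\<^bsub>T\<^esub> tensor_class L R v"
        if "u \<in> carrier F" "v \<in> carrier F" for u v
        using that tensor_class.hom_mult [of u "- v"] tensor_class.hom_inv [of v] by simp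
      show ?case
        using diff x y ext by (simp add: class_diff frag_extend_diff del: carrier_free_Abelian_group_iff)
    next
      case (generator p)
      then show ?case
        using h_pure by (auto simp: pure_tensor_def)
    qed
  qed
  have lift_eq: "lift g A = h A" if "A \<in> carrier T" for A
  proof -
    have "tensor_class L R (frag_extend g c) = h A" if "c \<in> A" for c
      using tensor_class_eq [OF \<open>A \<in> carrier T\<close> that] h_class by metis
    then show ?thesis
      using tensor_nonempty [OF that] by (auto simp: lift_def)
  qed
  show "lift g \<in> hom T T"
    by (rule homI) (simp_all add: lift_eq)
  show "c \<in> carrier F \<Longrightarrow> lift g (tensor_class L R c) = tensor_class L R (frag_extend g c)"
    by (simp add: lift_eq h_class del: carrier_free_Abelian_group_iff)
qed

end

section \<open>Generation by sums\<close>

text \<open>All generating sets below are closed under negation, so that inverses need not be mentioned.\<close>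

definition sum_generated :: "('a, 'b) ring_scheme \<Rightarrow> 'a set \<Rightarrow> bool"
  where "sum_generated V S \<longleftrightarrow> S \<subseteq> carrier V \<and>
    (\<forall>K. S \<subseteq> K \<and> (\<forall>x\<in>carrier V \<inter> K. \<forall>y\<in>carrier V \<inter> K. x \<oplus>\<^bsub>V\<^esub> y \<in> K) \<longrightarrow> carrier V \<subseteq> K)"

lemma sum_generated_induct [consumes 2, case_names generator add]:
  assumes "sum_generated V S" "x \<in> carrier V"
    and "\<And>a. a \<in> S \<Longrightarrow> P a"
    and "\<And>x y. \<lbrakk>x \<in> carrier V; y \<in> carrier V; P x; P y\<rbrakk> \<Longrightarrow> P (x \<oplus>\<^bsub>V\<^esub> y)"
  shows "P x"
proof -
  have "carrier V \<subseteq> {x. P x}"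
    using assms unfolding sum_generated_def by (elim conjE allE [of _ "{x. P x}"]) blast
  then show ?thesis
    using assms(2) by blast
qed

lemma sum_generatedI:
  assumes "S \<subseteq> carrier V"
    and "\<And>P x. \<lbrakk>x \<in> carrier V; \<And>a. a \<in> S \<Longrightarrow> P a;
      \<And>x y. \<lbrakk>x \<in> carrier V; y \<in> carrier V; P x; P y\<rbrakk> \<Longrightarrow> P (x \<oplus>\<^bsub>V\<^esub> y)\<rbrakk> \<Longrightarrow> P x"
  shows "sum_generated V S"
  unfolding sum_generated_def
proof (intro conjI allI impI subsetI)
  fix K x assume K: "S \<subseteq> K \<and> (\<forall>x\<in>carrier V \<inter> K. \<forall>y\<in>carrier V \<inter> K. x \<oplus>\<^bsub>V\<^esub> y \<in> K)"
    and x: "x \<in> carrier V"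
  from x show "x \<in> K"
    by (rule assms(2)) (use K in auto)
qed (use assms(1) in blast)

lemma sum_generated_subset: "\<lbrakk>sum_generated V S; a \<in> S\<rbrakk> \<Longrightarrow> a \<in> carrier V"
  by (auto simp: sum_generated_def)

lemma (in graded_abelian_group) sum_generated_homogeneous: "sum_generated V (\<Union>i\<in>{0<..}. H i)"
proof (rule sum_generatedI)
  fix P x assume "x \<in> carrier V" and gen: "\<And>a. a \<in> (\<Union>i\<in>{0<..}. H i) \<Longrightarrow> P a"
    and add: "\<And>x y. \<lbrakk>x \<in> carrier V; y \<in> carrier V; P x; P y\<rbrakk> \<Longrightarrow> P (x \<oplus> y)"
  then show "P x"
    by (induction rule: graded_induct) auto
qed (use component_carrier in auto)

text \<open>The Lie ring axioms need only be checked on additive generators; the alternating law is not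
  additive, but it follows from its values and the antisymmetry on generators.\<close>

lemma lie_ring_by_generators:
  fixes L (structure)
  assumes "abelian_group L"
    and closed: "\<And>x y. \<lbrakk>x \<in> carrier L; y \<in> carrier L\<rbrakk> \<Longrightarrow> x \<otimes> y \<in> carrier L"
    and l_distr: "\<And>x y z. \<lbrakk>x \<in> carrier L; y \<in> carrier L; z \<in> carrier L\<rbrakk>
      \<Longrightarrow> (x \<oplus> y) \<otimes> z = (x \<otimes> z) \<oplus> (y \<otimes> z)"
    and r_distr: "\<And>x y z. \<lbrakk>x \<in> carrier L; y \<in> carrier L; z \<in> carrier L\<rbrakk>
      \<Longrightarrow> x \<otimes> (y \<oplus> z) = (x \<otimes> y) \<oplus> (x \<otimes> z)"
    and gen: "sum_generated L S"
    and alt: "\<And>a. a \<in> S \<Longrightarrow> a \<otimes> a = \<zero>"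
    and anti: "\<And>a b. \<lbrakk>a \<in> S; b \<in> S\<rbrakk> \<Longrightarrow> a \<otimes> b \<oplus> b \<otimes> a = \<zero>"
    and jacobi: "\<And>a b c. \<lbrakk>a \<in> S; b \<in> S; c \<in> S\<rbrakk> \<Longrightarrow>
      a \<otimes> (b \<otimes> c) \<oplus> b \<otimes> (c \<otimes> a) \<oplus> c \<otimes> (a \<otimes> b) = \<zero>"
  shows "lie_ring L"
proof -
  interpret abelian_group L by fact
  note S = sum_generated_subset [OF gen]
  note distr = closed l_distr r_distr
  have anti_gen: "x \<otimes> b \<oplus> b \<otimes> x = \<zero>" if x: "x \<in> carrier L" and b: "b \<in> S" for x b
    using gen x
  proof (induction rule: sum_generated_induct)
    case (generator a)
    then show ?case
      using b by (rule anti)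
  next
    case (add x y)
    have "(x \<oplus> y) \<otimes> b \<oplus> b \<otimes> (x \<oplus> y) = (x \<otimes> b \<oplus> b \<otimes> x) \<oplus> (y \<otimes> b \<oplus> b \<otimes> y)"
      using add.hyps S [OF b] by (simp add: distr a_ac)
    with add.IH show ?case
      by simp
  qed
  have anti_all: "x \<otimes> z \<oplus> z \<otimes> x = \<zero>" if z: "z \<in> carrier L" and x: "x \<in> carrier L" for x z
    using gen z
  proof (induction rule: sum_generated_induct)
    case (generator a)
    with x show ?case
      by (rule anti_gen)
  next
    case (add y z)
    have "x \<otimes> (y \<oplus> z) \<oplus> (y \<oplus> z) \<otimes> x = (x \<otimes> y \<oplus> y \<otimes> x) \<oplus> (x \<otimes> z \<oplus> z \<otimes> x)"
      using add.hyps x by (simp add: distr a_ac)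
    with add.IH show ?case
      by simp
  qed
  have alt_all: "x \<otimes> x = \<zero>" if x: "x \<in> carrier L" for x
    using gen x
  proof (induction rule: sum_generated_induct)
    case (add x y)
    have "(x \<oplus> y) \<otimes> (x \<oplus> y) = (x \<otimes> x) \<oplus> (y \<otimes> y) \<oplus> (x \<otimes> y \<oplus> y \<otimes> x)"
      using add.hyps by (simp add: distr a_ac)
    with add show ?case
      by (simp add: anti_all)
  qed (rule alt)
  \<comment> \<open>The Jacobi sum is cyclically invariant, so that additivity in the first argument suffices.\<close>
  define J where "J x y z = x \<otimes> (y \<otimes> z) \<oplus> y \<otimes> (z \<otimes> x) \<oplus> z \<otimes> (x \<otimes> y)" for x y z
  have cyclic: "J x y z = J y z x"
    if "x \<in> carrier L" "y \<in> carrier L" "z \<in> carrier L" for x y z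
    unfolding J_def using that by (simp add: closed a_ac)
  have J_induct: "J x y z = \<zero>"
    if "x \<in> carrier L" "y \<in> carrier L" "z \<in> carrier L" "\<And>a. a \<in> S \<Longrightarrow> J a y z = \<zero>" for x y z
    using gen that(1)
  proof (induction rule: sum_generated_induct)
    case (generator a)
    then show ?case
      by (rule that(4))
  next
    case (add x x')
    have "J (x \<oplus> x') y z = J x y z \<oplus> J x' y z"
      unfolding J_def using add.hyps that(2,3) by (simp add: distr a_ac)
    with add.IH show ?case
      by simp
  qed
  have J_gen: "J a b c = \<zero>" if "a \<in> S" "b \<in> S" "c \<in> S" for a b c
    unfolding J_def using that by (rule jacobi)
  have J1: "J a b z = \<zero>" if "a \<in> S" "b \<in> S" "z \<in> carrier L" for a b z
    using that S J_induct [of z a b] J_gen cyclic by metis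
  have J2: "J a y z = \<zero>" if "a \<in> S" "y \<in> carrier L" "z \<in> carrier L" for a y z
    using that S J_induct [of y z a] J1 cyclic by metis
  have "J x y z = \<zero>" if "x \<in> carrier L" "y \<in> carrier L" "z \<in> carrier L" for x y z
    using that by (rule J_induct) (rule J2 [OF _ that(2,3)])
  then show ?thesis
    by unfold_locales (simp_all add: distr alt_all J_def)
qed

lemma (in lie_ring) lie_antisymmetric:
  assumes "x \<in> carrier L" "y \<in> carrier L"
  shows "x \<otimes> y \<oplus> y \<otimes> x = \<zero>"
proof -
  have "(x \<otimes> x) \<oplus> (y \<otimes> y) \<oplus> (x \<otimes> y \<oplus> y \<otimes> x) = (x \<oplus> y) \<otimes> (x \<oplus> y)"
    using assms by (simp add: lie_closed lie_l_distr lie_r_distr a_ac)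
  then show ?thesis
    using assms by (simp add: lie_alternating lie_closed)
qed

section \<open>Extension of scalars of a Lie ring\<close>

lemma (in comm_group) hom_mult_hom:
  assumes "f \<in> hom A G" "g \<in> hom A G"
  shows "(\<lambda>x. f x \<otimes> g x) \<in> hom A G"
proof (rule homI)
  show "f (x \<otimes>\<^bsub>A\<^esub> y) \<otimes> g (x \<otimes>\<^bsub>A\<^esub> y) = f x \<otimes> g x \<otimes> (f y \<otimes> g y)"
    if "x \<in> carrier A" "y \<in> carrier A" for x y
    using that hom_mult [OF assms(1)] hom_mult [OF assms(2)]
      hom_in_carrier [OF assms(1)] hom_in_carrier [OF assms(2)] by (simp add: m_ac)
qed (use hom_in_carrier [OF assms(1)] hom_in_carrier [OF assms(2)] in simp)

locale lie_tensor = L: lie_ring L + R: cring R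
  for L :: "('l, 'c) ring_scheme" and R :: "('r, 'd) ring_scheme"

sublocale lie_tensor \<subseteq> tensor_product L R ..

context lie_tensor
begin

abbreviation TL where "TL \<equiv> tensor_lie_ring L R"

lemma TL_simps:
  "carrier TL = carrier T" "A \<oplus>\<^bsub>TL\<^esub> B = A \<otimes>\<^bsub>T\<^esub> B" "\<zero>\<^bsub>TL\<^esub> = \<one>\<^bsub>T\<^esub>"
  by (simp_all add: tensor_lie_ring_def)

lemma TL_abelian_group: "abelian_group TL"
  by (rule comm_group_abelian_groupI, rule comm_group_cong [OF T.comm_group_axioms])
    (simp_all add: tensor_lie_ring_def)

sublocale TL: abelian_group TL
  by (rule TL_abelian_group)

lemma TL_sum_generated:
  "sum_generated TL {pure_tensor L R a r | a r. a \<in> carrier L \<and> r \<in> carrier R}"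
proof (rule sum_generatedI)
  fix P A assume A: "A \<in> carrier TL"
    and gen: "\<And>A. A \<in> {pure_tensor L R a r | a r. a \<in> carrier L \<and> r \<in> carrier R} \<Longrightarrow> P A"
    and add: "\<And>A B. \<lbrakk>A \<in> carrier TL; B \<in> carrier TL; P A; P B\<rbrakk> \<Longrightarrow> P (A \<oplus>\<^bsub>TL\<^esub> B)"
  from A show "P A"
    unfolding TL_simps
  proof (induction rule: tensor_induct)
    case (pure a r)
    then show ?case
      by (intro gen) blast
  next
    case (mult A B)
    then show ?case
      using add [of A B] by (simp add: TL_simps)
  qed
qed (auto simp: TL_simps pure_tensor_closed)

lemma pure_add_left:
  "\<lbrakk>a \<in> carrier L; b \<in> carrier L; r \<in> carrier R\<rbrakk>
    \<Longrightarrow> pure_tensor L R (a \<oplus>\<^bsub>L\<^esub> b) r = pure_tensor L R a r \<oplus>\<^bsub>TL\<^esub> pure_tensor L R b r"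
  using biadditive_mult_left [OF pure_tensor_biadditive, of a b r] by (simp add: TL_simps)

lemma pure_add_right:
  "\<lbrakk>a \<in> carrier L; r \<in> carrier R; s \<in> carrier R\<rbrakk>
    \<Longrightarrow> pure_tensor L R a (r \<oplus>\<^bsub>R\<^esub> s) = pure_tensor L R a r \<oplus>\<^bsub>TL\<^esub> pure_tensor L R a s"
  using biadditive_mult_right [OF pure_tensor_biadditive, of a r s] by (simp add: TL_simps)

lemma pure_zero_left: "r \<in> carrier R \<Longrightarrow> pure_tensor L R \<zero>\<^bsub>L\<^esub> r = \<zero>\<^bsub>TL\<^esub>"
  by (simp add: TL_simps pure_tensor_zero_left)

lemma pure_TL_closed:
  "\<lbrakk>a \<in> carrier L; r \<in> carrier R\<rbrakk> \<Longrightarrow> pure_tensor L R a r \<in> carrier TL"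
  by (simp add: TL_simps pure_tensor_closed)

subsection \<open>Scalars\<close>

lemma smult_lift:
  "r \<odot>\<^bsub>TL\<^esub> A = lift (\<lambda>(a, s). frag_of (a, r \<otimes>\<^bsub>R\<^esub> s)) A"
  by (simp add: tensor_lie_ring_def lift_def)

lemma smult_hom:
  assumes "r \<in> carrier R"
  shows "(\<lambda>A. r \<odot>\<^bsub>TL\<^esub> A) \<in> hom T T"
    and "\<lbrakk>a \<in> carrier L; s \<in> carrier R\<rbrakk>
      \<Longrightarrow> r \<odot>\<^bsub>TL\<^esub> pure_tensor L R a s = pure_tensor L R a (r \<otimes>\<^bsub>R\<^esub> s)"
proof -
  let ?g = "\<lambda>(a, s). frag_of (a, r \<otimes>\<^bsub>R\<^esub> s) :: 'l \<times> 'r \<Rightarrow>\<^sub>0 int"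
  have g: "?g p \<in> carrier F" if "p \<in> carrier L \<times> carrier R" for p
    using that assms by auto
  have "biadditive (add_monoid L) (add_monoid R) T (\<lambda>a s. pure_tensor L R a (r \<otimes>\<^bsub>R\<^esub> s))"
    by (rule biadditiveI)
      (use assms pure_add_left pure_add_right in \<open>simp_all add: pure_tensor_closed R.r_distr TL_simps\<close>)
  then have bi: "biadditive (add_monoid L) (add_monoid R) T (\<lambda>a s. tensor_class L R (?g (a, s)))"
    by (simp add: pure_tensor_def)
  show "(\<lambda>A. r \<odot>\<^bsub>TL\<^esub> A) \<in> hom T T"
    unfolding smult_lift by (rule lift_hom [OF g bi])
  show "r \<odot>\<^bsub>TL\<^esub> pure_tensor L R a s = pure_tensor L R a (r \<otimes>\<^bsub>R\<^esub> s)"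
    if "a \<in> carrier L" "s \<in> carrier R"
    using that lift_class [OF g bi, of "frag_of (a, s)"] by (simp add: smult_lift pure_tensor_def)
qed

lemma TL_module: "module R TL"
proof (rule moduleI)
  show "cring R" "abelian_group TL"
    by (rule R.is_cring, rule TL_abelian_group)
  show closed: "r \<odot>\<^bsub>TL\<^esub> A \<in> carrier TL" if "r \<in> carrier R" "A \<in> carrier TL" for r A
    using hom_in_carrier [OF smult_hom(1)] that by (simp add: TL_simps)
  show smult_add: "r \<odot>\<^bsub>TL\<^esub> (A \<oplus>\<^bsub>TL\<^esub> B) = r \<odot>\<^bsub>TL\<^esub> A \<oplus>\<^bsub>TL\<^esub> r \<odot>\<^bsub>TL\<^esub> B"
    if "r \<in> carrier R" "A \<in> carrier TL" "B \<in> carrier TL" for r A B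
    using hom_mult [OF smult_hom(1)] that by (simp add: TL_simps)
  show "(r \<oplus>\<^bsub>R\<^esub> s) \<odot>\<^bsub>TL\<^esub> A = r \<odot>\<^bsub>TL\<^esub> A \<oplus>\<^bsub>TL\<^esub> s \<odot>\<^bsub>TL\<^esub> A"
    if r: "r \<in> carrier R" "s \<in> carrier R" and A: "A \<in> carrier TL" for r s A
    using TL_sum_generated A
  proof (induction rule: sum_generated_induct)
    case (generator A)
    then show ?case
      using r by (auto simp: smult_hom(2) R.l_distr pure_add_right)
  next
    case (add A B)
    then show ?case
      using r by (simp add: smult_add closed TL.a_ac)
  qed
  show "(r \<otimes>\<^bsub>R\<^esub> s) \<odot>\<^bsub>TL\<^esub> A = r \<odot>\<^bsub>TL\<^esub> (s \<odot>\<^bsub>TL\<^esub> A)"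
    if r: "r \<in> carrier R" "s \<in> carrier R" and A: "A \<in> carrier TL" for r s A
    using TL_sum_generated A
  proof (induction rule: sum_generated_induct)
    case (generator A)
    then show ?case
      using r by (auto simp: smult_hom(2) R.m_assoc)
  next
    case (add A B)
    then show ?case
      using r by (simp add: smult_add closed)
  qed
  show "\<one>\<^bsub>R\<^esub> \<odot>\<^bsub>TL\<^esub> A = A" if A: "A \<in> carrier TL" for A
    using TL_sum_generated A
  proof (induction rule: sum_generated_induct)
    case (generator A)
    then show ?case
      by (auto simp: smult_hom(2))
  next
    case (add A B)
    then show ?case
      by (simp add: smult_add)
  qed
qed

subsection \<open>Lie product\<close>

text \<open>The product is lifted in its second argument, for a pure tensor as first argument, and then
  in the first one.\<close>

definition left_factor :: "'l \<Rightarrow> 'r \<Rightarrow> 'l \<times> 'r \<Rightarrow> 'l \<times> 'r \<Rightarrow>\<^sub>0 int"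
  where "left_factor a r = (\<lambda>(b, s). frag_of (a \<otimes>\<^bsub>L\<^esub> b, r \<otimes>\<^bsub>R\<^esub> s))"

definition right_factor :: "('l \<times> 'r \<Rightarrow>\<^sub>0 int) \<Rightarrow> 'l \<times> 'r \<Rightarrow> 'l \<times> 'r \<Rightarrow>\<^sub>0 int"
  where "right_factor d = (\<lambda>(a, r). frag_extend (left_factor a r) d)"

lemma left_factor_lift:
  assumes a: "a \<in> carrier L" and r: "r \<in> carrier R"
  shows "lift (left_factor a r) \<in> hom T T"
    and "d \<in> carrier F
      \<Longrightarrow> lift (left_factor a r) (tensor_class L R d) = tensor_class L R (right_factor d (a, r))"
    and "\<lbrakk>b \<in> carrier L; s \<in> carrier R\<rbrakk>
      \<Longrightarrow> lift (left_factor a r) (pure_tensor L R b s) = pure_tensor L R (a \<otimes>\<^bsub>L\<^esub> b) (r \<otimes>\<^bsub>R\<^esub> s)"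
proof -
  have g: "left_factor a r p \<in> carrier F" if "p \<in> carrier L \<times> carrier R" for p
    using that a r by (auto simp: left_factor_def L.lie_closed)
  have "biadditive (add_monoid L) (add_monoid R) T
      (\<lambda>b s. pure_tensor L R (a \<otimes>\<^bsub>L\<^esub> b) (r \<otimes>\<^bsub>R\<^esub> s))"
    by (rule biadditiveI)
      (use a r pure_add_left pure_add_right in
        \<open>simp_all add: pure_tensor_closed L.lie_closed L.lie_r_distr R.r_distr TL_simps\<close>)
  then have bi: "biadditive (add_monoid L) (add_monoid R) T
      (\<lambda>b s. tensor_class L R (left_factor a r (b, s)))"
    by (simp add: pure_tensor_def left_factor_def)
  show "lift (left_factor a r) \<in> hom T T"
    by (rule lift_hom [OF g bi])
  show "lift (left_factor a r) (tensor_class L R d) = tensor_class L R (right_factor d (a, r))"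
    if "d \<in> carrier F"
    using lift_class [OF g bi that] by (simp add: right_factor_def)
  show "lift (left_factor a r) (pure_tensor L R b s) = pure_tensor L R (a \<otimes>\<^bsub>L\<^esub> b) (r \<otimes>\<^bsub>R\<^esub> s)"
    if "b \<in> carrier L" "s \<in> carrier R"
    using that lift_class [OF g bi, of "frag_of (b, s)"] by (simp add: pure_tensor_def left_factor_def)
qed

lemma left_factor_biadditive:
  assumes B: "B \<in> carrier T"
  shows "biadditive (add_monoid L) (add_monoid R) T (\<lambda>a r. lift (left_factor a r) B)"
proof (rule biadditiveI)
  fix a r assume "a \<in> carrier (add_monoid L)" "r \<in> carrier (add_monoid R)"
  then show "lift (left_factor a r) B \<in> carrier T"
    using hom_in_carrier [OF left_factor_lift(1) B] by simp
next
  fix a a' r assume "a \<in> carrier (add_monoid L)" "a' \<in> carrier (add_monoid L)"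
    "r \<in> carrier (add_monoid R)"
  then have a: "a \<in> carrier L" "a' \<in> carrier L" "r \<in> carrier R"
    by simp_all
  have "lift (left_factor (a \<oplus>\<^bsub>L\<^esub> a') r) B = lift (left_factor a r) B \<otimes>\<^bsub>T\<^esub> lift (left_factor a' r) B"
  proof (rule hom_eq_on_pure_tensors [OF _ _ B])
    show "lift (left_factor (a \<oplus>\<^bsub>L\<^esub> a') r) \<in> hom T T"
      using a by (intro left_factor_lift) simp_all
    show "(\<lambda>B. lift (left_factor a r) B \<otimes>\<^bsub>T\<^esub> lift (left_factor a' r) B) \<in> hom T T"
      using a by (intro T.hom_mult_hom left_factor_lift)
  qed (use a in \<open>simp add: left_factor_lift L.lie_l_distr L.lie_closed pure_add_left flip: TL_simps\<close>)
  then show "lift (left_factor (a \<otimes>\<^bsub>add_monoid L\<^esub> a') r) B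
      = lift (left_factor a r) B \<otimes>\<^bsub>T\<^esub> lift (left_factor a' r) B"
    by simp
next
  fix a r r' assume "a \<in> carrier (add_monoid L)" "r \<in> carrier (add_monoid R)"
    "r' \<in> carrier (add_monoid R)"
  then have a: "a \<in> carrier L" "r \<in> carrier R" "r' \<in> carrier R"
    by simp_all
  have "lift (left_factor a (r \<oplus>\<^bsub>R\<^esub> r')) B = lift (left_factor a r) B \<otimes>\<^bsub>T\<^esub> lift (left_factor a r') B"
  proof (rule hom_eq_on_pure_tensors [OF _ _ B])
    show "lift (left_factor a (r \<oplus>\<^bsub>R\<^esub> r')) \<in> hom T T"
      using a by (intro left_factor_lift) simp_all
    show "(\<lambda>B. lift (left_factor a r) B \<otimes>\<^bsub>T\<^esub> lift (left_factor a r') B) \<in> hom T T"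
      using a by (intro T.hom_mult_hom left_factor_lift)
  qed (use a in \<open>simp add: left_factor_lift R.l_distr L.lie_closed pure_add_right flip: TL_simps\<close>)
  then show "lift (left_factor a (r \<otimes>\<^bsub>add_monoid R\<^esub> r')) B
      = lift (left_factor a r) B \<otimes>\<^bsub>T\<^esub> lift (left_factor a r') B"
    by simp
qed

lemma right_factor_lift:
  assumes B: "B \<in> carrier T" and d: "d \<in> B"
  shows "lift (right_factor d) \<in> hom T T"
    and "\<lbrakk>a \<in> carrier L; r \<in> carrier R\<rbrakk>
      \<Longrightarrow> lift (right_factor d) (pure_tensor L R a r) = lift (left_factor a r) B"
proof -
  have d': "d \<in> carrier F" "tensor_class L R d = B"
    using tensor_class_eq [OF B d] by auto
  have g: "right_factor d p \<in> carrier F" if p: "p \<in> carrier L \<times> carrier R" for p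
  proof -
    obtain a r where ar: "p = (a, r)" "a \<in> carrier L" "r \<in> carrier R"
      using p by blast
    have "Poly_Mapping.keys (left_factor a r q) \<subseteq> carrier L \<times> carrier R"
      if "q \<in> Poly_Mapping.keys d" for q
      using that d'(1) ar by (auto simp: left_factor_def L.lie_closed split: prod.splits)
    then have "Poly_Mapping.keys (frag_extend (left_factor a r) d) \<subseteq> carrier L \<times> carrier R"
      by (intro order_trans [OF keys_frag_extend UN_least])
    then show ?thesis
      by (simp add: right_factor_def ar)
  qed
  have class_eq: "tensor_class L R (right_factor d (a, r)) = lift (left_factor a r) B"
    if "a \<in> carrier L" "r \<in> carrier R" for a r
    using left_factor_lift(2) [OF that d'(1)] d'(2) by simp
  have bi: "biadditive (add_monoid L) (add_monoid R) T (\<lambda>a r. tensor_class L R (right_factor d (a, r)))"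
    using left_factor_biadditive [OF B] by (simp add: biadditive_def class_eq)
  show "lift (right_factor d) \<in> hom T T"
    by (rule lift_hom [OF g bi])
  show "lift (right_factor d) (pure_tensor L R a r) = lift (left_factor a r) B"
    if "a \<in> carrier L" "r \<in> carrier R"
    using that lift_class [OF g bi, of "frag_of (a, r)"] by (simp add: pure_tensor_def class_eq)
qed

text \<open>The union over the second factor in the definition of the product is constant, since \<open>lift\<close> for
  any two representatives of \<open>B\<close> agrees on pure tensors.\<close>

lemma TL_mult_eq_lift:
  assumes A: "A \<in> carrier T" and B: "B \<in> carrier T" and d: "d \<in> B"
  shows "A \<otimes>\<^bsub>TL\<^esub> B = lift (right_factor d) A"
proof -
  have "lift (right_factor d') A = lift (right_factor d) A" if d': "d' \<in> B" for d'
    by (rule hom_eq_on_pure_tensors [OF right_factor_lift(1) [OF B d'] right_factor_lift(1) [OF B d] A])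
      (simp add: right_factor_lift(2) [OF B d'] right_factor_lift(2) [OF B d])
  moreover have "A \<otimes>\<^bsub>TL\<^esub> B = (\<Union>d'\<in>B. lift (right_factor d') A)"
    by (auto simp: tensor_lie_ring_def lift_def right_factor_def left_factor_def)
  ultimately have "A \<otimes>\<^bsub>TL\<^esub> B = (\<Union>d'\<in>B. lift (right_factor d) A)"
    by simp
  moreover have "B \<noteq> {}"
    using d by blast
  ultimately show ?thesis
    by simp
qed

lemma TL_mult_pure_left:
  assumes a: "a \<in> carrier L" and r: "r \<in> carrier R" and B: "B \<in> carrier T"
  shows "pure_tensor L R a r \<otimes>\<^bsub>TL\<^esub> B = lift (left_factor a r) B"
proof -
  obtain d where "d \<in> B"
    using tensor_nonempty [OF B] by blast
  then show ?thesis
    using assms by (simp add: TL_mult_eq_lift right_factor_lift(2) pure_tensor_closed)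
qed

lemma TL_mult_pure:
  "\<lbrakk>a \<in> carrier L; r \<in> carrier R; b \<in> carrier L; s \<in> carrier R\<rbrakk>
    \<Longrightarrow> pure_tensor L R a r \<otimes>\<^bsub>TL\<^esub> pure_tensor L R b s = pure_tensor L R (a \<otimes>\<^bsub>L\<^esub> b) (r \<otimes>\<^bsub>R\<^esub> s)"
  by (simp add: TL_mult_pure_left left_factor_lift(3) pure_tensor_closed)

lemma TL_mult_hom_left:
  assumes B: "B \<in> carrier T"
  shows "(\<lambda>A. A \<otimes>\<^bsub>TL\<^esub> B) \<in> hom T T"
proof -
  obtain d where d: "d \<in> B"
    using tensor_nonempty [OF B] by blast
  have "lift (right_factor d) \<in> hom T T"
    by (rule right_factor_lift [OF B d])
  then show ?thesis
    by (simp add: hom_def TL_mult_eq_lift [OF _ B d] Pi_iff)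
qed

lemma TL_lie_closed: "\<lbrakk>A \<in> carrier TL; B \<in> carrier TL\<rbrakk> \<Longrightarrow> A \<otimes>\<^bsub>TL\<^esub> B \<in> carrier TL"
  using hom_in_carrier [OF TL_mult_hom_left] by (simp add: TL_simps)

lemma TL_l_distr:
  "\<lbrakk>A \<in> carrier TL; A' \<in> carrier TL; B \<in> carrier TL\<rbrakk>
    \<Longrightarrow> (A \<oplus>\<^bsub>TL\<^esub> A') \<otimes>\<^bsub>TL\<^esub> B = A \<otimes>\<^bsub>TL\<^esub> B \<oplus>\<^bsub>TL\<^esub> A' \<otimes>\<^bsub>TL\<^esub> B"
  using hom_mult [OF TL_mult_hom_left] by (simp add: TL_simps)

lemma TL_r_distr:
  assumes A: "A \<in> carrier TL" and B: "B \<in> carrier TL" and B': "B' \<in> carrier TL"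
  shows "A \<otimes>\<^bsub>TL\<^esub> (B \<oplus>\<^bsub>TL\<^esub> B') = A \<otimes>\<^bsub>TL\<^esub> B \<oplus>\<^bsub>TL\<^esub> A \<otimes>\<^bsub>TL\<^esub> B'"
  using TL_sum_generated A
proof (induction rule: sum_generated_induct)
  case (generator A)
  then obtain a r where "A = pure_tensor L R a r" and ar: "a \<in> carrier L" "r \<in> carrier R"
    by blast
  then show ?case
    using B B' hom_mult [OF left_factor_lift(1) [OF ar]] by (simp add: TL_simps TL_mult_pure_left)
next
  case (add A A')
  then show ?case
    using B B' by (simp add: TL_l_distr TL_lie_closed TL.a_ac)
qed

lemma TL_lie_ring: "lie_ring TL"
proof (rule lie_ring_by_generators [OF TL_abelian_group TL_lie_closed TL_l_distr TL_r_distr TL_sum_generated])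
  let ?S = "{pure_tensor L R a r | a r. a \<in> carrier L \<and> r \<in> carrier R}"
  show "A \<otimes>\<^bsub>TL\<^esub> A = \<zero>\<^bsub>TL\<^esub>" if "A \<in> ?S" for A
    using that by (auto simp: TL_mult_pure L.lie_alternating pure_zero_left)
  show "A \<otimes>\<^bsub>TL\<^esub> B \<oplus>\<^bsub>TL\<^esub> B \<otimes>\<^bsub>TL\<^esub> A = \<zero>\<^bsub>TL\<^esub>" if S: "A \<in> ?S" "B \<in> ?S" for A B
  proof -
    obtain a r where A: "A = pure_tensor L R a r" "a \<in> carrier L" "r \<in> carrier R"
      using S(1) by blast
    obtain b s where B: "B = pure_tensor L R b s" "b \<in> carrier L" "s \<in> carrier R"
      using S(2) by blast
    have "A \<otimes>\<^bsub>TL\<^esub> B \<oplus>\<^bsub>TL\<^esub> B \<otimes>\<^bsub>TL\<^esub> A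
        = pure_tensor L R (a \<otimes>\<^bsub>L\<^esub> b \<oplus>\<^bsub>L\<^esub> b \<otimes>\<^bsub>L\<^esub> a) (r \<otimes>\<^bsub>R\<^esub> s)"
      using A B by (simp add: TL_mult_pure pure_add_left L.lie_closed R.m_comm [of s r])
    then show ?thesis
      using A B by (simp add: L.lie_antisymmetric pure_zero_left)
  qed
  show "A \<otimes>\<^bsub>TL\<^esub> (B \<otimes>\<^bsub>TL\<^esub> C) \<oplus>\<^bsub>TL\<^esub> B \<otimes>\<^bsub>TL\<^esub> (C \<otimes>\<^bsub>TL\<^esub> A) \<oplus>\<^bsub>TL\<^esub> C \<otimes>\<^bsub>TL\<^esub> (A \<otimes>\<^bsub>TL\<^esub> B) = \<zero>\<^bsub>TL\<^esub>"
    if S: "A \<in> ?S" "B \<in> ?S" "C \<in> ?S" for A B C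
  proof -
    obtain a r where A: "A = pure_tensor L R a r" "a \<in> carrier L" "r \<in> carrier R"
      using S(1) by blast
    obtain b s where B: "B = pure_tensor L R b s" "b \<in> carrier L" "s \<in> carrier R"
      using S(2) by blast
    obtain c t where C: "C = pure_tensor L R c t" "c \<in> carrier L" "t \<in> carrier R"
      using S(3) by blast
    have scalars: "s \<otimes>\<^bsub>R\<^esub> (t \<otimes>\<^bsub>R\<^esub> r) = r \<otimes>\<^bsub>R\<^esub> (s \<otimes>\<^bsub>R\<^esub> t)" "t \<otimes>\<^bsub>R\<^esub> (r \<otimes>\<^bsub>R\<^esub> s) = r \<otimes>\<^bsub>R\<^esub> (s \<otimes>\<^bsub>R\<^esub> t)"
      using A B C by (simp_all add: R.m_ac)
    have "A \<otimes>\<^bsub>TL\<^esub> (B \<otimes>\<^bsub>TL\<^esub> C) \<oplus>\<^bsub>TL\<^esub> B \<otimes>\<^bsub>TL\<^esub> (C \<otimes>\<^bsub>TL\<^esub> A) \<oplus>\<^bsub>TL\<^esub> C \<otimes>\<^bsub>TL\<^esub> (A \<otimes>\<^bsub>TL\<^esub> B)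
        = pure_tensor L R (a \<otimes>\<^bsub>L\<^esub> (b \<otimes>\<^bsub>L\<^esub> c) \<oplus>\<^bsub>L\<^esub> b \<otimes>\<^bsub>L\<^esub> (c \<otimes>\<^bsub>L\<^esub> a) \<oplus>\<^bsub>L\<^esub> c \<otimes>\<^bsub>L\<^esub> (a \<otimes>\<^bsub>L\<^esub> b))
            (r \<otimes>\<^bsub>R\<^esub> (s \<otimes>\<^bsub>R\<^esub> t))"
      using A B C by (simp add: TL_mult_pure pure_add_left L.lie_closed scalars)
    then show ?thesis
      using A B C by (simp add: L.lie_jacobi pure_zero_left)
  qed
qed

end

section \<open>The induced grading\<close>

text \<open>The projections of \<open>L\<close> extend to projections of the tensor product, so that the images of the
  tensor products of the components again form a direct sum.\<close>

theorem graded_lie_ring_tensor: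
  assumes "graded_lie_ring L H" and "cring R"
  defines "K \<equiv> \<lambda>i. generate (add_monoid (tensor_lie_ring L R))
    {pure_tensor L R a r | a r. a \<in> H i \<and> r \<in> carrier R}"
  shows "graded_lie_ring (tensor_lie_ring L R) K"
proof -
  interpret G: graded_lie_ring L H by fact
  interpret R: cring R by fact
  interpret lie_tensor L R
    by (intro lie_tensor.intro G.lie_ring_axioms assms(2))
  interpret Lie: lie_ring TL
    by (rule TL_lie_ring)
  obtain p where p_hom: "\<And>i. 0 < i \<Longrightarrow> p i \<in> hom (add_monoid L) (add_monoid L)"
    and p_in: "\<And>i x. \<lbrakk>0 < i; x \<in> carrier L\<rbrakk> \<Longrightarrow> p i x \<in> H i"
    and p_id: "\<And>i x. \<lbrakk>0 < i; x \<in> H i\<rbrakk> \<Longrightarrow> p i x = x"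
    and p_zero: "\<And>i j x. \<lbrakk>0 < i; 0 < j; i \<noteq> j; x \<in> H j\<rbrakk> \<Longrightarrow> p i x = \<zero>\<^bsub>L\<^esub>"
    by (rule G.projections) (rule that; assumption)
  have p_carrier: "p i x \<in> carrier L" if "0 < i" "x \<in> carrier L" for i x
    using that by (intro G.component_carrier [OF _ p_in])
  have "\<exists>h. h \<in> hom T T \<and>
      (\<forall>a\<in>carrier L. \<forall>r\<in>carrier R. h (pure_tensor L R a r) = pure_tensor L R (p i a) r)"
    if i: "0 < i" for i
  proof -
    have "biadditive (add_monoid L) (add_monoid R) T (\<lambda>a r. pure_tensor L R (p i a) r)"
      by (rule biadditiveI)
        (use i p_carrier hom_mult [OF p_hom [OF i]] pure_add_left pure_add_right in
          \<open>simp_all add: pure_TL_closed flip: TL_simps\<close>)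
    then show ?thesis
      using tensor_universal [OF T.comm_group_axioms] by metis
  qed
  then obtain q where q_hom: "\<And>i. 0 < i \<Longrightarrow> q i \<in> hom T T"
    and q_pure: "\<And>i a r. \<lbrakk>0 < i; a \<in> carrier L; r \<in> carrier R\<rbrakk>
      \<Longrightarrow> q i (pure_tensor L R a r) = pure_tensor L R (p i a) r"
    by metis
  have q_hom_TL: "q i \<in> hom (add_monoid TL) (add_monoid TL)" if "0 < i" for i
    using q_hom [OF that] by (simp add: hom_def TL_simps)
  have gen_in: "pure_tensor L R a r \<in> carrier TL" if "0 < i" "a \<in> H i" "r \<in> carrier R" for i a r
    using that G.component_carrier by (simp add: pure_TL_closed)
  have K_subgroup: "subgroup (K i) (add_monoid TL)" if "0 < i" for i
    unfolding K_def using gen_in that by (intro TL.add.generate_is_subgroup) auto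
  have K_pure: "pure_tensor L R a r \<in> K i" if "a \<in> H i" "r \<in> carrier R" for i a r
    unfolding K_def by (rule generate.incl) (use that in blast)
  have K_add: "x \<oplus>\<^bsub>TL\<^esub> y \<in> K i" if "0 < i" "x \<in> K i" "y \<in> K i" for i x y
    using subgroup.m_closed [OF K_subgroup] that by simp
  have q_K: "q i x \<in> K i" if i: "0 < i" and x: "x \<in> carrier TL" for i x
    using TL_sum_generated x
  proof (induction rule: sum_generated_induct)
    case (generator a)
    then show ?case
      using i p_in by (auto simp: q_pure intro!: K_pure)
  next
    case (add x y)
    then show ?case
      using hom_mult [OF q_hom_TL [OF i], of x y] i K_add by simp
  qed
  have q_id: "q i x = x" if i: "0 < i" and x: "x \<in> K i" for i x
  proof -
    interpret q: group_hom "add_monoid TL" "add_monoid TL" "q i"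
      using q_hom_TL [OF i] by (simp add: group_hom_def group_hom_axioms_def TL.a_group)
    have "subgroup {x \<in> carrier TL. q i x = x} (add_monoid TL)"
    proof (rule subgroup.intro)
      show "inv\<^bsub>add_monoid TL\<^esub> x \<in> {x \<in> carrier TL. q i x = x}" if "x \<in> {x \<in> carrier TL. q i x = x}" for x
        using that q.hom_inv [of x] group.inv_closed [OF TL.a_group, of x] by simp
    qed (use q.hom_mult q.hom_one in auto)
    then have "K i \<subseteq> {x \<in> carrier TL. q i x = x}"
      unfolding K_def
    proof (rule TL.add.generate_subgroup_incl [rotated])
      show "{pure_tensor L R a r | a r. a \<in> H i \<and> r \<in> carrier R} \<subseteq> {x \<in> carrier TL. q i x = x}"
        using i gen_in G.component_carrier by (auto simp: q_pure p_id)
    qed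
    with x show ?thesis
      by blast
  qed
  have q_zero: "q i x = \<zero>\<^bsub>TL\<^esub>" if ij: "0 < i" "0 < j" "i \<noteq> j" and x: "x \<in> K j" for i j x
  proof -
    interpret q: group_hom "add_monoid TL" "add_monoid TL" "q i"
      using q_hom_TL [OF ij(1)] by (simp add: group_hom_def group_hom_axioms_def TL.a_group)
    have "K j \<subseteq> kernel (add_monoid TL) (add_monoid TL) (q i)"
      unfolding K_def
    proof (rule TL.add.generate_subgroup_incl [OF _ q.subgroup_kernel])
      show "{pure_tensor L R a r | a r. a \<in> H j \<and> r \<in> carrier R}
          \<subseteq> kernel (add_monoid TL) (add_monoid TL) (q i)"
        using ij gen_in G.component_carrier
        by (auto simp: kernel_def q_pure p_zero pure_zero_left)
    qed
    with x show ?thesis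
      by (auto simp: kernel_def)
  qed
  have K_generates: "carrier TL \<subseteq> U"
    if U: "subgroup U (add_monoid TL)" and K_U: "\<And>i. 0 < i \<Longrightarrow> K i \<subseteq> U" for U
  proof
    have U_add: "x \<oplus>\<^bsub>TL\<^esub> y \<in> U" if "x \<in> U" "y \<in> U" for x y
      using subgroup.m_closed [OF U that] by simp
    have pure: "pure_tensor L R a r \<in> U" if "a \<in> carrier L" and r: "r \<in> carrier R" for a r
      using that(1)
    proof (induction rule: G.graded_induct)
      case (homogeneous i a)
      then show ?case
        using K_pure [of a i r] K_U r by blast
    next
      case (add x y)
      then show ?case
        using U_add r by (simp add: pure_add_left)
    qed
    fix x assume "x \<in> carrier TL"
    with TL_sum_generated show "x \<in> U"
      by (induction rule: sum_generated_induct) (use pure U_add in auto)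
  qed
  have direct: "(\<lambda>h. gfinprod (add_monoid TL) h {0<..})
      \<in> iso (sum_group {0<..} (\<lambda>i. (add_monoid TL)\<lparr>carrier := K i\<rparr>)) (add_monoid TL)"
    by (rule TL.add.direct_sum_by_projections [where p = q])
      (use K_subgroup K_generates q_hom_TL q_id q_zero in simp_all)
  have degree: "x \<otimes>\<^bsub>TL\<^esub> y \<in> K (i + j)"
    if i: "0 < i" and j: "0 < j" and x: "x \<in> K i" and y: "y \<in> K j" for i j x y
  proof -
    have ij: "0 < i + j"
      using i by simp
    have carr: "x \<in> carrier TL" "y \<in> carrier TL"
      using subgroup.mem_carrier [OF K_subgroup [OF i] x]
        subgroup.mem_carrier [OF K_subgroup [OF j] y] by simp_all
    have q_add: "q k (u \<oplus>\<^bsub>TL\<^esub> v) = q k u \<oplus>\<^bsub>TL\<^esub> q k v"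
      if "0 < k" "u \<in> carrier TL" "v \<in> carrier TL" for k u v
      using hom_mult [OF q_hom_TL] that by simp
    have q_closed: "q k u \<in> carrier TL" if "0 < k" "u \<in> carrier TL" for k u
      using hom_in_carrier [OF q_hom_TL] that by simp
    have gen: "q i (pure_tensor L R a r) \<otimes>\<^bsub>TL\<^esub> q j v \<in> K (i + j)"
      if a: "a \<in> carrier L" and r: "r \<in> carrier R" and v: "v \<in> carrier TL" for a r v
      using TL_sum_generated v
    proof (induction rule: sum_generated_induct)
      case (generator v)
      then obtain b s where v: "v = pure_tensor L R b s" "b \<in> carrier L" "s \<in> carrier R"
        by blast
      have "p i a \<otimes>\<^bsub>L\<^esub> p j b \<in> H (i + j)"
        using G.lie_degree [OF i j] p_in i j a v by blast
      then show ?case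
        using i j a r v p_carrier by (simp add: q_pure TL_mult_pure K_pure)
    next
      case (add u v)
      then show ?case
        using a r i j ij K_add q_closed pure_TL_closed
        by (simp add: q_add Lie.lie_r_distr)
    qed
    have "q i u \<otimes>\<^bsub>TL\<^esub> q j y \<in> K (i + j)" if u: "u \<in> carrier TL" for u
      using TL_sum_generated u
    proof (induction rule: sum_generated_induct)
      case (generator u)
      then show ?case
        using gen carr by auto
    next
      case (add u v)
      then show ?case
        using i j ij K_add q_closed carr by (simp add: q_add Lie.lie_l_distr)
    qed
    from this [OF carr(1)] show ?thesis
      using x y i j by (simp add: q_id)
  qed
  show ?thesis
    by (intro graded_lie_ring.intro graded_lie_ring_axioms.intro graded_abelian_group.intro
        graded_abelian_group_axioms.intro additive_subgroup.intro Lie.lie_ring_axioms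
        TL.abelian_group_axioms K_subgroup direct degree)
qed

section \<open>The Lie ring of the lower central series\<close>

context group
begin

lemma lower_quotient_comm_group: "comm_group (lower_quotient G i)"
  using central_filtration.sect_comm_group [OF lower_central_filtration]
  by (simp add: lower_quotient_eq_sect)

lemma lower_quotient_group: "group (lower_quotient G i)"
  using lower_quotient_comm_group by (rule comm_group.axioms)

lemma lower_bracket_biadditive:
  assumes "0 < i"
  shows "biadditive (lower_quotient G i) (lower_quotient G j) (lower_quotient G (i + j)) (lower_bracket G i j)"
  using central_filtration.bracket_biadditive [OF lower_central_filtration assms, of j]
  by (simp add: lower_bracket_eq_bracket Suc_funpow flip: lower_quotient_eq_sect)

lemma lower_bracket_cosets:
  assumes "0 < i" "x \<in> lower_central G i" "y \<in> lower_central G j"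
  shows "lower_bracket G i j (lower_central G (Suc i) #> x) (lower_central G (Suc j) #> y)
    = lower_central G (Suc (i + j)) #> commutator G x y"
  using central_filtration.bracket_cosets [OF lower_central_filtration assms]
  by (simp add: lower_bracket_eq_bracket Suc_funpow)

lemma lower_bracket_self:
  assumes "0 < i" "A \<in> carrier (lower_quotient G i)"
  shows "lower_bracket G i i A A = \<one>\<^bsub>lower_quotient G (i + i)\<^esub>"
proof -
  obtain x where "A = lower_central G (Suc i) #> x" "x \<in> lower_central G i"
    using assms by (auto simp: lower_quotient_carrier)
  then show ?thesis
    using assms lower_central_carrier subgroup.subset [OF normal_imp_subgroup [OF lower_central_normal]]
    by (simp add: lower_bracket_cosets commutator_self lower_quotient_def)
qed

lemma lower_bracket_antisymmetric:
  assumes i: "0 < i" and j: "0 < j" and A: "A \<in> carrier (lower_quotient G i)"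
    and B: "B \<in> carrier (lower_quotient G j)"
  shows "lower_bracket G j i B A = inv\<^bsub>lower_quotient G (i + j)\<^esub> lower_bracket G i j A B"
proof -
  obtain x where x: "A = lower_central G (Suc i) #> x" "x \<in> lower_central G i"
    using A by (auto simp: lower_quotient_carrier)
  obtain y where y: "B = lower_central G (Suc j) #> y" "y \<in> lower_central G j"
    using B by (auto simp: lower_quotient_carrier)
  have "commutator G x y \<in> lower_central G (i + j)"
    using central_filtration.lower_central_commutator_M [OF lower_central_filtration i x(2) y(2)]
    by (simp add: Suc_funpow)
  then have "inv\<^bsub>lower_quotient G (i + j)\<^esub> (lower_central G (Suc (i + j)) #> commutator G x y)
      = lower_central G (Suc (i + j)) #> commutator G y x"
    using central_filtration.sect_inv [OF lower_central_filtration] x y lower_central_carrier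
    by (simp add: inv_commutator flip: lower_quotient_eq_sect)
  then show ?thesis
    using i j x y by (simp add: lower_bracket_cosets add.commute [of j i])
qed

text \<open>The cyclic form of \<open>bracket_jacobi\<close>, by antisymmetry.\<close>

lemma lower_bracket_jacobi:
  assumes i: "0 < i" and j: "0 < j" and k: "0 < k" and A: "A \<in> carrier (lower_quotient G i)"
    and B: "B \<in> carrier (lower_quotient G j)" and C: "C \<in> carrier (lower_quotient G k)"
  defines "S \<equiv> lower_quotient G (i + j + k)"
  shows "lower_bracket G i (j + k) A (lower_bracket G j k B C)
    \<otimes>\<^bsub>S\<^esub> lower_bracket G j (k + i) B (lower_bracket G k i C A)
    \<otimes>\<^bsub>S\<^esub> lower_bracket G k (i + j) C (lower_bracket G i j A B) = \<one>\<^bsub>S\<^esub>"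
proof -
  interpret S: comm_group S
    unfolding S_def by (rule lower_quotient_comm_group)
  have bc: "lower_bracket G j k B C \<in> carrier (lower_quotient G (j + k))"
    and ac: "lower_bracket G i k A C \<in> carrier (lower_quotient G (i + k))"
    and ab: "lower_bracket G i j A B \<in> carrier (lower_quotient G (i + j))"
    using i j A B C by (auto intro: biadditive_closed [OF lower_bracket_biadditive])
  have a_bc: "lower_bracket G i (j + k) A (lower_bracket G j k B C) \<in> carrier S"
    using biadditive_closed [OF lower_bracket_biadditive [OF i] A bc] by (simp add: S_def add.assoc)
  have b_ac: "lower_bracket G j (i + k) B (lower_bracket G i k A C) \<in> carrier S"
    using biadditive_closed [OF lower_bracket_biadditive [OF j] B ac] by (simp add: S_def ac_simps)
  have ab_c: "lower_bracket G (i + j) k (lower_bracket G i j A B) C \<in> carrier S"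
    using biadditive_closed [OF lower_bracket_biadditive ab C] i by (simp add: S_def)
  have 1: "lower_bracket G (i + j) k (lower_bracket G i j A B) C
      = lower_bracket G i (j + k) A (lower_bracket G j k B C)
        \<otimes>\<^bsub>S\<^esub> inv\<^bsub>S\<^esub> lower_bracket G j (i + k) B (lower_bracket G i k A C)"
    using central_filtration.bracket_jacobi [OF lower_central_filtration i j A B, of C k] C
    by (simp add: S_def Suc_funpow flip: lower_quotient_eq_sect lower_bracket_eq_bracket)
  have 2: "lower_bracket G j (k + i) B (lower_bracket G k i C A)
      = inv\<^bsub>S\<^esub> lower_bracket G j (i + k) B (lower_bracket G i k A C)"
    unfolding lower_bracket_antisymmetric [OF i k A C]
    using biadditive_inv_right [OF lower_bracket_biadditive [OF j]
        lower_quotient_group lower_quotient_group B ac]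
    by (simp add: S_def ac_simps)
  have 3: "lower_bracket G k (i + j) C (lower_bracket G i j A B)
      = inv\<^bsub>S\<^esub> lower_bracket G (i + j) k (lower_bracket G i j A B) C"
    using lower_bracket_antisymmetric [OF _ k ab C] i by (simp add: S_def)
  show ?thesis
    unfolding 2 3 using a_bc b_ac ab_c 1 by simp
qed

lemma lower_pairing:
  "graded_pairing (lower_quotient G) (lower_quotient G) (lower_quotient G) (lower_bracket G)"
  by (intro graded_pairing.intro lower_quotient_comm_group lower_bracket_biadditive)

lemma lower_lie_ring_simps:
  "carrier (lower_lie_ring G) = carrier (sum_group {0<..} (lower_quotient G))"
  "add (lower_lie_ring G) = (\<otimes>\<^bsub>sum_group {0<..} (lower_quotient G)\<^esub>)"
  "\<zero>\<^bsub>lower_lie_ring G\<^esub> = \<one>\<^bsub>sum_group {0<..} (lower_quotient G)\<^esub>"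
  "(\<otimes>\<^bsub>lower_lie_ring G\<^esub>) = convolution (lower_bracket G) (lower_quotient G)"
  by (simp_all add: lower_lie_ring_def Let_def convolution_def fun_eq_iff)

definition lower_component :: "nat \<Rightarrow> (nat \<Rightarrow> 'a set) set"
  where "lower_component i = homogeneous (lower_quotient G) i ` carrier (lower_quotient G i)"

lemma lower_graded_abelian_group: "graded_abelian_group (lower_lie_ring G) lower_component"
proof -
  have S: "comm_group (add_monoid (lower_lie_ring G))"
    and sub: "\<And>i. 0 < i \<Longrightarrow> subgroup (lower_component i) (add_monoid (lower_lie_ring G))"
    and direct: "(\<lambda>h. gfinprod (add_monoid (lower_lie_ring G)) h {0<..})
      \<in> iso (sum_group {0<..} (\<lambda>i. (add_monoid (lower_lie_ring G))\<lparr>carrier := lower_component i\<rparr>))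
          (add_monoid (lower_lie_ring G))"
    unfolding lower_component_def
    by (rule sum_group_direct_sum [OF lower_quotient_comm_group];
        simp add: lower_lie_ring_simps del: mult_sum_group one_sum_group)+
  show ?thesis
    by (intro graded_abelian_group.intro graded_abelian_group_axioms.intro additive_subgroup.intro
        comm_group_abelian_groupI S sub direct)
qed

lemma lower_mult_homogeneous:
  assumes "0 < i" "0 < j" "A \<in> carrier (lower_quotient G i)" "B \<in> carrier (lower_quotient G j)"
  shows "homogeneous (lower_quotient G) i A \<otimes>\<^bsub>lower_lie_ring G\<^esub> homogeneous (lower_quotient G) j B
    = homogeneous (lower_quotient G) (i + j) (lower_bracket G i j A B)"
  using graded_pairing.convolution_homogeneous [OF lower_pairing] assms
  by (simp add: lower_lie_ring_simps)

lemma lower_add_homogeneous: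
  assumes "0 < i" "A \<in> carrier (lower_quotient G i)" "B \<in> carrier (lower_quotient G i)"
  shows "homogeneous (lower_quotient G) i A \<oplus>\<^bsub>lower_lie_ring G\<^esub> homogeneous (lower_quotient G) i B
    = homogeneous (lower_quotient G) i (A \<otimes>\<^bsub>lower_quotient G i\<^esub> B)"
  using homogeneous_mult [of "lower_quotient G", OF lower_quotient_group] assms
  by (simp add: lower_lie_ring_simps del: mult_sum_group)

lemma lower_zero_homogeneous:
  "homogeneous (lower_quotient G) i \<one>\<^bsub>lower_quotient G i\<^esub> = \<zero>\<^bsub>lower_lie_ring G\<^esub>"
  by (simp add: lower_lie_ring_simps homogeneous_one del: one_sum_group)

lemma lower_graded_lie_ring: "graded_lie_ring (lower_lie_ring G) lower_component"
proof -
  interpret graded: graded_abelian_group "lower_lie_ring G" lower_component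
    by (rule lower_graded_abelian_group)
  let ?L = "lower_lie_ring G" and ?h = "homogeneous (lower_quotient G)"
  have conv: "biadditive (sum_group {0<..} (lower_quotient G)) (sum_group {0<..} (lower_quotient G))
      (sum_group {0<..} (lower_quotient G)) (convolution (lower_bracket G) (lower_quotient G))"
    by (rule graded_pairing.convolution_biadditive [OF lower_pairing])
  have "lie_ring ?L"
  proof (rule lie_ring_by_generators [OF graded.abelian_group_axioms])
    show "x \<otimes>\<^bsub>?L\<^esub> y \<in> carrier ?L" if "x \<in> carrier ?L" "y \<in> carrier ?L" for x y
      using that biadditive_closed [OF conv] by (simp add: lower_lie_ring_simps)
    show "(x \<oplus>\<^bsub>?L\<^esub> y) \<otimes>\<^bsub>?L\<^esub> z = x \<otimes>\<^bsub>?L\<^esub> z \<oplus>\<^bsub>?L\<^esub> y \<otimes>\<^bsub>?L\<^esub> z"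
      if "x \<in> carrier ?L" "y \<in> carrier ?L" "z \<in> carrier ?L" for x y z
      using that biadditive_mult_left [OF conv] by (simp add: lower_lie_ring_simps del: mult_sum_group)
    show "x \<otimes>\<^bsub>?L\<^esub> (y \<oplus>\<^bsub>?L\<^esub> z) = x \<otimes>\<^bsub>?L\<^esub> y \<oplus>\<^bsub>?L\<^esub> x \<otimes>\<^bsub>?L\<^esub> z"
      if "x \<in> carrier ?L" "y \<in> carrier ?L" "z \<in> carrier ?L" for x y z
      using that biadditive_mult_right [OF conv] by (simp add: lower_lie_ring_simps del: mult_sum_group)
    show "sum_generated ?L (\<Union>i\<in>{0<..}. lower_component i)"
      by (rule graded.sum_generated_homogeneous)
    fix a assume "a \<in> (\<Union>i\<in>{0<..}. lower_component i)"
    then obtain i A where i: "0 < i" and A: "A \<in> carrier (lower_quotient G i)" and a: "a = ?h i A"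
      by (auto simp: lower_component_def)
    show "a \<otimes>\<^bsub>?L\<^esub> a = \<zero>\<^bsub>?L\<^esub>"
      using i A by (simp add: a lower_mult_homogeneous lower_bracket_self lower_zero_homogeneous)
    fix b assume "b \<in> (\<Union>i\<in>{0<..}. lower_component i)"
    then obtain j B where j: "0 < j" and B: "B \<in> carrier (lower_quotient G j)" and b: "b = ?h j B"
      by (auto simp: lower_component_def)
    have ab: "lower_bracket G i j A B \<in> carrier (lower_quotient G (i + j))"
      by (rule biadditive_closed [OF lower_bracket_biadditive [OF i] A B])
    have "a \<otimes>\<^bsub>?L\<^esub> b \<oplus>\<^bsub>?L\<^esub> b \<otimes>\<^bsub>?L\<^esub> a
        = ?h (i + j) (lower_bracket G i j A B) \<oplus>\<^bsub>?L\<^esub> ?h (i + j) (lower_bracket G j i B A)"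
      using i j A B by (simp add: a b lower_mult_homogeneous add.commute [of j i])
    also have "\<dots> = \<zero>\<^bsub>?L\<^esub>"
      unfolding lower_bracket_antisymmetric [OF i j A B]
      using i ab group.inv_closed [OF lower_quotient_group ab] group.r_inv [OF lower_quotient_group ab]
      by (simp add: lower_add_homogeneous lower_zero_homogeneous)
    finally show "a \<otimes>\<^bsub>?L\<^esub> b \<oplus>\<^bsub>?L\<^esub> b \<otimes>\<^bsub>?L\<^esub> a = \<zero>\<^bsub>?L\<^esub>" .
    fix c assume "c \<in> (\<Union>i\<in>{0<..}. lower_component i)"
    then obtain k C where k: "0 < k" and C: "C \<in> carrier (lower_quotient G k)" and c: "c = ?h k C"
      by (auto simp: lower_component_def)
    have bc: "lower_bracket G j k B C \<in> carrier (lower_quotient G (j + k))"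
      and ca: "lower_bracket G k i C A \<in> carrier (lower_quotient G (k + i))"
      using j k A B C by (auto intro: biadditive_closed [OF lower_bracket_biadditive])
    have sums: "j + (k + i) = i + (j + k)" "k + (i + j) = i + (j + k)" "i + j + k = i + (j + k)"
      by simp_all
    have triple: "lower_bracket G i (j + k) A (lower_bracket G j k B C) \<in> carrier (lower_quotient G (i + (j + k)))"
      "lower_bracket G j (k + i) B (lower_bracket G k i C A) \<in> carrier (lower_quotient G (i + (j + k)))"
      "lower_bracket G k (i + j) C (lower_bracket G i j A B) \<in> carrier (lower_quotient G (i + (j + k)))"
      using biadditive_closed [OF lower_bracket_biadditive [OF i] A bc]
        biadditive_closed [OF lower_bracket_biadditive [OF j] B ca]
        biadditive_closed [OF lower_bracket_biadditive [OF k] C ab] unfolding sums by simp_all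
    have "?h (i + (j + k)) (lower_bracket G i (j + k) A (lower_bracket G j k B C))
        \<oplus>\<^bsub>?L\<^esub> ?h (i + (j + k)) (lower_bracket G j (k + i) B (lower_bracket G k i C A))
        \<oplus>\<^bsub>?L\<^esub> ?h (i + (j + k)) (lower_bracket G k (i + j) C (lower_bracket G i j A B)) = \<zero>\<^bsub>?L\<^esub>"
      using lower_bracket_jacobi [OF i j k A B C] i triple
        monoid.m_closed [OF group.is_monoid [OF lower_quotient_group] triple(1,2)]
      by (simp add: lower_add_homogeneous sums lower_zero_homogeneous)
    then show "a \<otimes>\<^bsub>?L\<^esub> (b \<otimes>\<^bsub>?L\<^esub> c) \<oplus>\<^bsub>?L\<^esub> b \<otimes>\<^bsub>?L\<^esub> (c \<otimes>\<^bsub>?L\<^esub> a) \<oplus>\<^bsub>?L\<^esub> c \<otimes>\<^bsub>?L\<^esub> (a \<otimes>\<^bsub>?L\<^esub> b) = \<zero>\<^bsub>?L\<^esub>"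
      using i j k A B C ab bc ca by (simp add: a b c lower_mult_homogeneous sums)
  qed
  moreover have "x \<otimes>\<^bsub>?L\<^esub> y \<in> lower_component (i + j)"
    if ij: "0 < i" "0 < j" and xy: "x \<in> lower_component i" "y \<in> lower_component j" for i j x y
    using xy ij biadditive_closed [OF lower_bracket_biadditive]
    by (auto simp: lower_component_def lower_mult_homogeneous)
  ultimately show ?thesis
    by (intro graded_lie_ring.intro graded_lie_ring_axioms.intro lower_graded_abelian_group)
qed

end

section \<open>The dual of the upper central series\<close>

lemma hom_group_simps:
  "f \<in> carrier (hom_group A Q) \<longleftrightarrow> f \<in> hom A (add_monoid Q) \<and> f \<in> extensional (carrier A)"
  "(\<otimes>\<^bsub>hom_group A Q\<^esub>) = (\<lambda>f g. \<lambda>x\<in>carrier A. f x \<oplus>\<^bsub>Q\<^esub> g x)"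
  "\<one>\<^bsub>hom_group A Q\<^esub> = (\<lambda>x\<in>carrier A. \<zero>\<^bsub>Q\<^esub>)"
  by (simp_all add: hom_group_def)

lemma hom_group_closed: "\<lbrakk>f \<in> carrier (hom_group A Q); x \<in> carrier A\<rbrakk> \<Longrightarrow> f x \<in> carrier Q"
  using hom_in_carrier [of f A "add_monoid Q"] by (simp add: hom_group_simps)

lemma hom_group_mult:
  "\<lbrakk>f \<in> carrier (hom_group A Q); x \<in> carrier A; y \<in> carrier A\<rbrakk>
    \<Longrightarrow> f (x \<otimes>\<^bsub>A\<^esub> y) = f x \<oplus>\<^bsub>Q\<^esub> f y"
  using hom_mult [of f A "add_monoid Q"] by (simp add: hom_group_simps)

lemma hom_group_eqI:
  "\<lbrakk>f \<in> carrier (hom_group A Q); g \<in> carrier (hom_group A Q); \<And>x. x \<in> carrier A \<Longrightarrow> f x = g x\<rbrakk>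
    \<Longrightarrow> f = g"
  by (auto simp: hom_group_simps intro: extensionalityI)

lemma restrict_in_hom_group:
  assumes "monoid A" "\<And>x. x \<in> carrier A \<Longrightarrow> f x \<in> carrier Q"
    and "\<And>x y. \<lbrakk>x \<in> carrier A; y \<in> carrier A\<rbrakk> \<Longrightarrow> f (x \<otimes>\<^bsub>A\<^esub> y) = f x \<oplus>\<^bsub>Q\<^esub> f y"
  shows "(\<lambda>x\<in>carrier A. f x) \<in> carrier (hom_group A Q)"
  using assms by (auto simp: hom_group_simps hom_def monoid.m_closed)

lemma hom_group_comm_group:
  assumes A: "group A" and "abelian_group Q"
  shows "comm_group (hom_group A Q)"
proof -
  interpret A: group A by fact
  interpret Q: abelian_group Q by fact
  note closed = hom_group_closed [of _ A Q] and mult = hom_group_mult [of _ A Q]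
  have mult_closed: "f \<otimes>\<^bsub>hom_group A Q\<^esub> g \<in> carrier (hom_group A Q)"
    if "f \<in> carrier (hom_group A Q)" "g \<in> carrier (hom_group A Q)" for f g
    unfolding hom_group_simps(2)
    by (rule restrict_in_hom_group) (use that in \<open>auto simp: closed mult Q.a_ac A.is_monoid\<close>)
  have one_closed: "\<one>\<^bsub>hom_group A Q\<^esub> \<in> carrier (hom_group A Q)"
    unfolding hom_group_simps(3) by (rule restrict_in_hom_group) (auto simp: A.is_monoid)
  show ?thesis
  proof (rule comm_groupI)
    show "\<exists>g\<in>carrier (hom_group A Q). g \<otimes>\<^bsub>hom_group A Q\<^esub> f = \<one>\<^bsub>hom_group A Q\<^esub>"
      if f: "f \<in> carrier (hom_group A Q)" for f
    proof
      show "(\<lambda>x\<in>carrier A. \<ominus>\<^bsub>Q\<^esub> f x) \<in> carrier (hom_group A Q)"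
        by (rule restrict_in_hom_group)
          (use f in \<open>auto simp: closed mult Q.minus_add A.is_monoid Q.a_comm\<close>)
      show "(\<lambda>x\<in>carrier A. \<ominus>\<^bsub>Q\<^esub> f x) \<otimes>\<^bsub>hom_group A Q\<^esub> f = \<one>\<^bsub>hom_group A Q\<^esub>"
        using f by (auto simp: hom_group_simps(2,3) closed Q.l_neg intro!: restrict_ext)
    qed
    show "f \<otimes>\<^bsub>hom_group A Q\<^esub> g \<otimes>\<^bsub>hom_group A Q\<^esub> h = f \<otimes>\<^bsub>hom_group A Q\<^esub> (g \<otimes>\<^bsub>hom_group A Q\<^esub> h)"
      if "f \<in> carrier (hom_group A Q)" "g \<in> carrier (hom_group A Q)" "h \<in> carrier (hom_group A Q)" for f g h
      using that by (auto simp: hom_group_simps(2) closed Q.a_assoc intro!: restrict_ext)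
    show "f \<otimes>\<^bsub>hom_group A Q\<^esub> g = g \<otimes>\<^bsub>hom_group A Q\<^esub> f"
      if "f \<in> carrier (hom_group A Q)" "g \<in> carrier (hom_group A Q)" for f g
      using that by (auto simp: hom_group_simps(2) closed Q.a_comm intro!: restrict_ext)
    show "\<one>\<^bsub>hom_group A Q\<^esub> \<otimes>\<^bsub>hom_group A Q\<^esub> f = f" if "f \<in> carrier (hom_group A Q)" for f
    proof (rule hom_group_eqI [OF mult_closed [OF one_closed that] that])
      show "(\<one>\<^bsub>hom_group A Q\<^esub> \<otimes>\<^bsub>hom_group A Q\<^esub> f) x = f x" if "x \<in> carrier A" for x
        using that \<open>f \<in> carrier (hom_group A Q)\<close> by (simp add: hom_group_simps(2,3) closed)
    qed
  qed (use mult_closed one_closed in auto)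
qed

lemma hom_group_inv_apply:
  assumes "group A" "abelian_group Q" "f \<in> carrier (hom_group A Q)" "x \<in> carrier A"
  shows "(inv\<^bsub>hom_group A Q\<^esub> f) x = \<ominus>\<^bsub>Q\<^esub> f x"
proof -
  interpret Q: abelian_group Q by fact
  interpret H: comm_group "hom_group A Q"
    using assms by (intro hom_group_comm_group)
  have "(inv\<^bsub>hom_group A Q\<^esub> f \<otimes>\<^bsub>hom_group A Q\<^esub> f) x = \<zero>\<^bsub>Q\<^esub>"
    using assms by (simp add: H.l_inv) (simp add: hom_group_simps(3))
  then have "(inv\<^bsub>hom_group A Q\<^esub> f) x \<oplus>\<^bsub>Q\<^esub> f x = \<zero>\<^bsub>Q\<^esub>"
    using assms(4) by (simp add: hom_group_simps(2))
  then show ?thesis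
    using assms hom_group_closed [OF H.inv_closed [OF assms(3)]] hom_group_closed [OF assms(3)]
    by (simp add: Q.minus_equality)
qed

lemma funpow_pred: "((\<lambda>k. k - Suc 0) ^^ i) k = k - i"
  by (induction i) auto

context group
begin

lemma upper_central_filtration: "central_filtration G (upper_central G) (\<lambda>k. k - Suc 0)"
proof (intro central_filtration.intro central_filtration_axioms.intro is_group
    upper_central_normal)
  show "commutator G g x \<in> upper_central G (k - Suc 0)"
    if "g \<in> carrier G" "x \<in> upper_central G k" for g x k
    using upper_central_commutator [OF that] by simp
  show "upper_central G (k - Suc 0) \<subseteq> upper_central G k" for k
    using upper_central_subset_Suc [of "k - 1"] by (cases k) simp_all
qed

lemma upper_quotient_eq_sect:
  "upper_quotient G i = central_filtration.sect G (upper_central G) (\<lambda>k. k - Suc 0) i"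
  by (simp add: upper_quotient_def central_filtration.sect_def [OF upper_central_filtration])

text \<open>Here the second index is the degree of the second argument; the result has the difference as its
  degree, so that most statements are about \<open>upper_bracket i (i + j)\<close>, with values in degree \<open>j\<close>.\<close>

definition upper_bracket :: "nat \<Rightarrow> nat \<Rightarrow> 'a set \<Rightarrow> 'a set \<Rightarrow> 'a set"
  where "upper_bracket = central_filtration.bracket G (upper_central G) (\<lambda>k. k - Suc 0)"

lemma upper_quotient_group: "group (upper_quotient G i)"
  using central_filtration.sect_comm_group [OF upper_central_filtration]
  by (simp add: upper_quotient_eq_sect comm_group.axioms)

lemma upper_quotient_carrier:
  "carrier (upper_quotient G i) = (\<lambda>y. upper_central G (i - Suc 0) #> y) ` upper_central G i"
  by (simp add: upper_quotient_eq_sect central_filtration.sect_carrier [OF upper_central_filtration])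

lemma upper_bracket_biadditive:
  assumes "0 < i"
  shows "biadditive (lower_quotient G i) (upper_quotient G (i + j)) (upper_quotient G j)
    (upper_bracket i (i + j))"
  using central_filtration.bracket_biadditive [OF upper_central_filtration assms, of "i + j"]
  by (simp add: upper_bracket_def funpow_pred flip: upper_quotient_eq_sect)

lemma upper_bracket_cosets:
  assumes "0 < i" "x \<in> lower_central G i" "y \<in> upper_central G (i + j)"
  shows "upper_bracket i (i + j) (lower_central G (Suc i) #> x) (upper_central G (i + j - Suc 0) #> y)
    = upper_central G (j - Suc 0) #> commutator G x y"
  using central_filtration.bracket_cosets [OF upper_central_filtration assms]
  by (simp add: upper_bracket_def funpow_pred del: funpow.simps)

lemma lower_upper_commutator:
  "\<lbrakk>0 < i; x \<in> lower_central G i; y \<in> upper_central G (i + j)\<rbrakk>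
    \<Longrightarrow> commutator G x y \<in> upper_central G j"
  using central_filtration.lower_central_commutator_M [OF upper_central_filtration, of i x y "i + j"]
  by (simp add: funpow_pred)

lemma upper_bracket_jacobi:
  assumes i: "0 < i" and j: "0 < j" and A: "A \<in> carrier (lower_quotient G i)"
    and B: "B \<in> carrier (lower_quotient G j)" and C: "C \<in> carrier (upper_quotient G (i + j + k))"
  shows "upper_bracket (i + j) (i + j + k) (lower_bracket G i j A B) C
    = upper_bracket i (i + k) A (upper_bracket j (i + j + k) B C)
      \<otimes>\<^bsub>upper_quotient G k\<^esub>
      inv\<^bsub>upper_quotient G k\<^esub> upper_bracket j (j + k) B (upper_bracket i (i + j + k) A C)"
  using central_filtration.bracket_jacobi [OF upper_central_filtration i j A B, of C "i + j + k"] C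
  by (simp add: funpow_pred add.commute [of i j] add.assoc flip: upper_quotient_eq_sect upper_bracket_def)

end

locale central_series_duality = group G + Q: module R Q
  for G :: "('a, 'b) monoid_scheme" (structure)
    and R :: "('r, 'd) ring_scheme"
    and Q :: "('r, 'q, 'm) module_scheme"
begin

abbreviation V where "V \<equiv> upper_dual G Q"

lemma Q_abelian_group: "abelian_group Q"
  by (rule Q.abelian_group_axioms)

lemma upper_hom_comm_group: "comm_group (upper_hom G Q i)"
  unfolding upper_hom_def by (rule hom_group_comm_group [OF upper_quotient_group Q_abelian_group])

lemma upper_hom_group: "group (upper_hom G Q i)"
  using upper_hom_comm_group by (rule comm_group.axioms)

lemma upper_dual_simps:
  "carrier V = carrier (sum_group {0<..} (upper_hom G Q))"
  "add V = (\<otimes>\<^bsub>sum_group {0<..} (upper_hom G Q)\<^esub>)"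
  "\<zero>\<^bsub>V\<^esub> = \<one>\<^bsub>sum_group {0<..} (upper_hom G Q)\<^esub>"
  by (simp_all add: upper_dual_def Let_def)

lemma upper_graded_abelian_group: "graded_abelian_group V (upper_dual_component G Q)"
proof -
  have S: "comm_group (add_monoid V)"
    and sub: "\<And>i. 0 < i \<Longrightarrow> subgroup (upper_dual_component G Q i) (add_monoid V)"
    and direct: "(\<lambda>h. gfinprod (add_monoid V) h {0<..})
      \<in> iso (sum_group {0<..} (\<lambda>i. (add_monoid V)\<lparr>carrier := upper_dual_component G Q i\<rparr>))
          (add_monoid V)"
    unfolding upper_dual_component_def
    by (rule sum_group_direct_sum [OF upper_hom_comm_group];
        simp add: upper_dual_simps del: mult_sum_group one_sum_group)+
  show ?thesis
    by (intro graded_abelian_group.intro graded_abelian_group_axioms.intro additive_subgroup.intro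
        comm_group_abelian_groupI S sub direct)
qed

sublocale V: graded_abelian_group V "upper_dual_component G Q"
  by (rule upper_graded_abelian_group)

definition scale :: "'r \<Rightarrow> nat \<Rightarrow> ('a set \<Rightarrow> 'q) \<Rightarrow> 'a set \<Rightarrow> 'q"
  where "scale r i f = (\<lambda>B\<in>carrier (upper_quotient G i). r \<odot>\<^bsub>Q\<^esub> f B)"

lemma upper_hom_closed:
  "\<lbrakk>f \<in> carrier (upper_hom G Q i); B \<in> carrier (upper_quotient G i)\<rbrakk> \<Longrightarrow> f B \<in> carrier Q"
  unfolding upper_hom_def by (rule hom_group_closed)

lemma upper_hom_mult:
  "\<lbrakk>f \<in> carrier (upper_hom G Q i); B \<in> carrier (upper_quotient G i); C \<in> carrier (upper_quotient G i)\<rbrakk>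
    \<Longrightarrow> f (B \<otimes>\<^bsub>upper_quotient G i\<^esub> C) = f B \<oplus>\<^bsub>Q\<^esub> f C"
  unfolding upper_hom_def by (rule hom_group_mult)

lemma upper_hom_eqI:
  "\<lbrakk>f \<in> carrier (upper_hom G Q i); g \<in> carrier (upper_hom G Q i);
    \<And>B. B \<in> carrier (upper_quotient G i) \<Longrightarrow> f B = g B\<rbrakk> \<Longrightarrow> f = g"
  unfolding upper_hom_def by (rule hom_group_eqI)

lemma restrict_in_upper_hom:
  assumes "\<And>B. B \<in> carrier (upper_quotient G i) \<Longrightarrow> f B \<in> carrier Q"
    and "\<And>B C. \<lbrakk>B \<in> carrier (upper_quotient G i); C \<in> carrier (upper_quotient G i)\<rbrakk>
      \<Longrightarrow> f (B \<otimes>\<^bsub>upper_quotient G i\<^esub> C) = f B \<oplus>\<^bsub>Q\<^esub> f C"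
  shows "(\<lambda>B\<in>carrier (upper_quotient G i). f B) \<in> carrier (upper_hom G Q i)"
  unfolding upper_hom_def using assms group.is_monoid [OF upper_quotient_group]
  by (intro restrict_in_hom_group)

lemma upper_hom_mult_apply:
  "B \<in> carrier (upper_quotient G i) \<Longrightarrow> (f \<otimes>\<^bsub>upper_hom G Q i\<^esub> g) B = f B \<oplus>\<^bsub>Q\<^esub> g B"
  by (simp add: upper_hom_def hom_group_simps(2))

lemma upper_hom_mult_closed:
  "\<lbrakk>f \<in> carrier (upper_hom G Q i); g \<in> carrier (upper_hom G Q i)\<rbrakk>
    \<Longrightarrow> f \<otimes>\<^bsub>upper_hom G Q i\<^esub> g \<in> carrier (upper_hom G Q i)"
  by (rule monoid.m_closed [OF group.is_monoid [OF upper_hom_group]])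

lemma upper_hom_inv_apply:
  "\<lbrakk>f \<in> carrier (upper_hom G Q i); B \<in> carrier (upper_quotient G i)\<rbrakk>
    \<Longrightarrow> (inv\<^bsub>upper_hom G Q i\<^esub> f) B = \<ominus>\<^bsub>Q\<^esub> f B"
  unfolding upper_hom_def by (rule hom_group_inv_apply [OF upper_quotient_group Q_abelian_group])

lemma scale_closed:
  assumes "r \<in> carrier R" "f \<in> carrier (upper_hom G Q i)"
  shows "scale r i f \<in> carrier (upper_hom G Q i)"
  unfolding scale_def using assms
  by (intro restrict_in_upper_hom) (simp_all add: upper_hom_closed upper_hom_mult Q.smult_r_distr)

lemma scale_zero: "r \<in> carrier R \<Longrightarrow> scale r i \<one>\<^bsub>upper_hom G Q i\<^esub> = \<one>\<^bsub>upper_hom G Q i\<^esub>"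
  by (auto simp: scale_def upper_hom_def hom_group_simps(3) intro!: restrict_ext)

lemma V_carrier_iff:
  "v \<in> carrier V \<longleftrightarrow> v \<in> extensional {0<..} \<and> (\<forall>i>0. v i \<in> carrier (upper_hom G Q i)) \<and>
    finite {i. 0 < i \<and> v i \<noteq> \<one>\<^bsub>upper_hom G Q i\<^esub>}"
  unfolding upper_dual_simps by (rule carrier_sum_group_iff [OF upper_hom_group])

lemma V_smult: "r \<odot>\<^bsub>V\<^esub> v = (\<lambda>i\<in>{0<..}. scale r i (v i))"
  by (simp add: upper_dual_def Let_def scale_def)

lemma V_module: "module R V"
proof (rule moduleI)
  show "cring R" "abelian_group V"
    by (rule Q.is_cring, rule V.abelian_group_axioms)
  show closed: "r \<odot>\<^bsub>V\<^esub> v \<in> carrier V" if r: "r \<in> carrier R" and v: "v \<in> carrier V" for r v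
  proof -
    have "{i. 0 < i \<and> (r \<odot>\<^bsub>V\<^esub> v) i \<noteq> \<one>\<^bsub>upper_hom G Q i\<^esub>} \<subseteq> {i. 0 < i \<and> v i \<noteq> \<one>\<^bsub>upper_hom G Q i\<^esub>}"
      using r by (auto simp: V_smult scale_zero)
    then have "finite {i. 0 < i \<and> (r \<odot>\<^bsub>V\<^esub> v) i \<noteq> \<one>\<^bsub>upper_hom G Q i\<^esub>}"
      by (rule finite_subset) (use v in \<open>simp add: V_carrier_iff\<close>)
    moreover have "r \<odot>\<^bsub>V\<^esub> v \<in> extensional {0<..}"
      "\<forall>i>0. (r \<odot>\<^bsub>V\<^esub> v) i \<in> carrier (upper_hom G Q i)"
      using r v by (simp_all add: V_carrier_iff V_smult scale_closed)
    ultimately show ?thesis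
      unfolding V_carrier_iff by blast
  qed
  have eqI: "v = w" if "v \<in> carrier V" "w \<in> carrier V"
    "\<And>i B. \<lbrakk>0 < i; B \<in> carrier (upper_quotient G i)\<rbrakk> \<Longrightarrow> v i B = w i B" for v w
  proof (rule extensionalityI [of _ "{0<..}"])
    show "v i = w i" if "i \<in> {0<..}" for i
      using \<open>v \<in> carrier V\<close> \<open>w \<in> carrier V\<close> that
        \<open>\<And>i B. \<lbrakk>0 < i; B \<in> carrier (upper_quotient G i)\<rbrakk> \<Longrightarrow> v i B = w i B\<close>
      by (intro upper_hom_eqI [of _ i]) (auto simp: V_carrier_iff)
  qed (use that in \<open>auto simp: V_carrier_iff\<close>)
  have add_apply: "(v \<oplus>\<^bsub>V\<^esub> w) i B = v i B \<oplus>\<^bsub>Q\<^esub> w i B"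
    if "0 < i" "B \<in> carrier (upper_quotient G i)" for v w i B
    using that by (simp add: upper_dual_simps upper_hom_mult_apply)
  have smult_apply: "(r \<odot>\<^bsub>V\<^esub> v) i B = r \<odot>\<^bsub>Q\<^esub> v i B"
    if "0 < i" "B \<in> carrier (upper_quotient G i)" for r v i B
    using that by (simp add: V_smult scale_def)
  have apply_closed: "v i B \<in> carrier Q"
    if "v \<in> carrier V" "0 < i" "B \<in> carrier (upper_quotient G i)" for v i B
    using that upper_hom_closed [of "v i" i B] by (simp add: V_carrier_iff)
  note apply_simps = add_apply smult_apply apply_closed
  show "(r \<oplus>\<^bsub>R\<^esub> s) \<odot>\<^bsub>V\<^esub> v = r \<odot>\<^bsub>V\<^esub> v \<oplus>\<^bsub>V\<^esub> s \<odot>\<^bsub>V\<^esub> v"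
    if "r \<in> carrier R" "s \<in> carrier R" "v \<in> carrier V" for r s v
    using that by (intro eqI V.add.m_closed closed) (simp_all add: apply_simps Q.smult_l_distr)
  show "r \<odot>\<^bsub>V\<^esub> (v \<oplus>\<^bsub>V\<^esub> w) = r \<odot>\<^bsub>V\<^esub> v \<oplus>\<^bsub>V\<^esub> r \<odot>\<^bsub>V\<^esub> w"
    if "r \<in> carrier R" "v \<in> carrier V" "w \<in> carrier V" for r v w
    using that by (intro eqI V.add.m_closed closed) (simp_all add: apply_simps Q.smult_r_distr)
  show "(r \<otimes>\<^bsub>R\<^esub> s) \<odot>\<^bsub>V\<^esub> v = r \<odot>\<^bsub>V\<^esub> (s \<odot>\<^bsub>V\<^esub> v)"
    if "r \<in> carrier R" "s \<in> carrier R" "v \<in> carrier V" for r s v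
    using that by (intro eqI V.add.m_closed closed) (simp_all add: apply_simps Q.smult_assoc1)
  show "\<one>\<^bsub>R\<^esub> \<odot>\<^bsub>V\<^esub> v = v" if "v \<in> carrier V" for v
    using that by (intro eqI closed) (simp_all add: apply_simps)
qed

lemma smult_homogeneous:
  assumes "r \<in> carrier R" "0 < i"
  shows "r \<odot>\<^bsub>V\<^esub> homogeneous (upper_hom G Q) i f = homogeneous (upper_hom G Q) i (scale r i f)"
  using assms by (auto simp: V_smult homogeneous_def scale_zero intro!: restrict_ext)

lemma add_homogeneous:
  assumes "0 < i" "f \<in> carrier (upper_hom G Q i)" "g \<in> carrier (upper_hom G Q i)"
  shows "homogeneous (upper_hom G Q) i f \<oplus>\<^bsub>V\<^esub> homogeneous (upper_hom G Q) i g
    = homogeneous (upper_hom G Q) i (f \<otimes>\<^bsub>upper_hom G Q i\<^esub> g)"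
  using homogeneous_mult [of "upper_hom G Q", OF upper_hom_group] assms
  by (simp add: upper_dual_simps del: mult_sum_group)

lemma minus_homogeneous:
  assumes i: "0 < i" and f: "f \<in> carrier (upper_hom G Q i)"
  shows "\<ominus>\<^bsub>V\<^esub> homogeneous (upper_hom G Q) i f = homogeneous (upper_hom G Q) i (inv\<^bsub>upper_hom G Q i\<^esub> f)"
proof (rule V.minus_equality)
  have inv: "inv\<^bsub>upper_hom G Q i\<^esub> f \<in> carrier (upper_hom G Q i)"
    using f by (rule group.inv_closed [OF upper_hom_group])
  show "homogeneous (upper_hom G Q) i (inv\<^bsub>upper_hom G Q i\<^esub> f) \<oplus>\<^bsub>V\<^esub> homogeneous (upper_hom G Q) i f = \<zero>\<^bsub>V\<^esub>"
    using i f inv group.l_inv [OF upper_hom_group f]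
    by (simp add: add_homogeneous homogeneous_one) (simp add: upper_dual_simps)
  show "homogeneous (upper_hom G Q) i f \<in> carrier V"
    "homogeneous (upper_hom G Q) i (inv\<^bsub>upper_hom G Q i\<^esub> f) \<in> carrier V"
    using i f inv V.component_carrier by (auto simp: upper_dual_component_def)
qed

section \<open>The action on homogeneous elements\<close>

text \<open>The value of the natural action of \<open>A \<otimes> r\<close> on \<open>f\<close>, in terms of cosets.\<close>

definition dual_bracket :: "'r \<Rightarrow> nat \<Rightarrow> nat \<Rightarrow> 'a set \<Rightarrow> ('a set \<Rightarrow> 'q) \<Rightarrow> 'a set \<Rightarrow> 'q"
  where "dual_bracket r i j A f =
    (\<lambda>B\<in>carrier (upper_quotient G (i + j)). \<ominus>\<^bsub>Q\<^esub> (r \<odot>\<^bsub>Q\<^esub> f (upper_bracket i (i + j) A B)))"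

lemma dual_bracket_apply:
  "B \<in> carrier (upper_quotient G (i + j))
    \<Longrightarrow> dual_bracket r i j A f B = \<ominus>\<^bsub>Q\<^esub> (r \<odot>\<^bsub>Q\<^esub> f (upper_bracket i (i + j) A B))"
  by (simp add: dual_bracket_def)

lemma upper_bracket_closed:
  "\<lbrakk>0 < i; A \<in> carrier (lower_quotient G i); B \<in> carrier (upper_quotient G (i + j))\<rbrakk>
    \<Longrightarrow> upper_bracket i (i + j) A B \<in> carrier (upper_quotient G j)"
  by (rule biadditive_closed [OF upper_bracket_biadditive])

lemma dual_bracket_closed:
  assumes "0 < i" "r \<in> carrier R" "A \<in> carrier (lower_quotient G i)" "f \<in> carrier (upper_hom G Q j)"
  shows "dual_bracket r i j A f \<in> carrier (upper_hom G Q (i + j))"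
  unfolding dual_bracket_def using assms biadditive_mult_right [OF upper_bracket_biadditive]
  by (intro restrict_in_upper_hom)
    (simp_all add: upper_bracket_closed upper_hom_closed upper_hom_mult Q.smult_r_distr Q.minus_add)

lemma dual_bracket_biadditive:
  assumes i: "0 < i" and r: "r \<in> carrier R"
  shows "biadditive (lower_quotient G i) (upper_hom G Q j) (upper_hom G Q (i + j)) (dual_bracket r i j)"
proof (rule biadditiveI)
  show "dual_bracket r i j A f \<in> carrier (upper_hom G Q (i + j))"
    if "A \<in> carrier (lower_quotient G i)" "f \<in> carrier (upper_hom G Q j)" for A f
    using i r that by (rule dual_bracket_closed)
  show "dual_bracket r i j (A \<otimes>\<^bsub>lower_quotient G i\<^esub> A') f
      = dual_bracket r i j A f \<otimes>\<^bsub>upper_hom G Q (i + j)\<^esub> dual_bracket r i j A' f"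
    if "A \<in> carrier (lower_quotient G i)" "A' \<in> carrier (lower_quotient G i)"
      "f \<in> carrier (upper_hom G Q j)" for A A' f
    using i r that monoid.m_closed [OF group.is_monoid [OF lower_quotient_group]]
    by (intro upper_hom_eqI [where i = "i + j"] upper_hom_mult_closed dual_bracket_closed)
      (simp_all add: dual_bracket_apply upper_hom_mult_apply upper_bracket_closed upper_hom_closed
        upper_hom_mult biadditive_mult_left [OF upper_bracket_biadditive] Q.smult_r_distr Q.minus_add)
  show "dual_bracket r i j A (f \<otimes>\<^bsub>upper_hom G Q j\<^esub> f')
      = dual_bracket r i j A f \<otimes>\<^bsub>upper_hom G Q (i + j)\<^esub> dual_bracket r i j A f'"
    if "A \<in> carrier (lower_quotient G i)" "f \<in> carrier (upper_hom G Q j)"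
      "f' \<in> carrier (upper_hom G Q j)" for A f f'
    using i r that
    by (intro upper_hom_eqI [where i = "i + j"] upper_hom_mult_closed dual_bracket_closed)
      (simp_all add: dual_bracket_apply upper_hom_mult_apply upper_bracket_closed upper_hom_closed
        Q.smult_r_distr Q.minus_add)
qed

lemma dual_bracket_add:
  assumes "0 < i" "r \<in> carrier R" "s \<in> carrier R"
    "A \<in> carrier (lower_quotient G i)" "f \<in> carrier (upper_hom G Q j)"
  shows "dual_bracket (r \<oplus>\<^bsub>R\<^esub> s) i j A f
    = dual_bracket r i j A f \<otimes>\<^bsub>upper_hom G Q (i + j)\<^esub> dual_bracket s i j A f"
  using assms
  by (intro upper_hom_eqI [where i = "i + j"] upper_hom_mult_closed dual_bracket_closed)
    (simp_all add: dual_bracket_apply upper_hom_mult_apply upper_bracket_closed upper_hom_closed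
      Q.smult_l_distr Q.minus_add)

lemma dual_bracket_mult_left:
  assumes "0 < i" "r \<in> carrier R" "s \<in> carrier R"
    "A \<in> carrier (lower_quotient G i)" "f \<in> carrier (upper_hom G Q j)"
  shows "dual_bracket (r \<otimes>\<^bsub>R\<^esub> s) i j A f = scale r (i + j) (dual_bracket s i j A f)"
  using assms
  by (intro upper_hom_eqI [where i = "i + j"] scale_closed dual_bracket_closed)
    (simp_all add: scale_def dual_bracket_apply upper_bracket_closed upper_hom_closed
      Q.smult_assoc1 Q.smult_r_minus)

lemma dual_bracket_scale:
  assumes "0 < i" "r \<in> carrier R" "s \<in> carrier R"
    "A \<in> carrier (lower_quotient G i)" "f \<in> carrier (upper_hom G Q j)"
  shows "dual_bracket s i j A (scale r j f) = scale r (i + j) (dual_bracket s i j A f)"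
  using assms
  by (intro upper_hom_eqI [where i = "i + j"] scale_closed dual_bracket_closed)
    (simp_all add: scale_def dual_bracket_apply upper_bracket_closed upper_hom_closed
      Q.smult_r_minus Q.m_comm flip: Q.smult_assoc1)

text \<open>
  In a product of two actions the signs cancel, while \<open>f\<close> is composed with the brackets in the opposite
  order. The single sign on the left-hand side therefore turns \<open>upper_bracket_jacobi\<close> into the module
  axiom.
\<close>

lemma dual_bracket_jacobi:
  assumes i: "0 < i" and j: "0 < j" and r: "r \<in> carrier R" and s: "s \<in> carrier R"
    and A: "A \<in> carrier (lower_quotient G i)" and B: "B \<in> carrier (lower_quotient G j)"
    and f: "f \<in> carrier (upper_hom G Q k)"
  defines "H \<equiv> upper_hom G Q (i + j + k)"
  shows "dual_bracket (r \<otimes>\<^bsub>R\<^esub> s) (i + j) k (lower_bracket G i j A B) f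
    = dual_bracket r i (j + k) A (dual_bracket s j k B f)
      \<otimes>\<^bsub>H\<^esub> inv\<^bsub>H\<^esub> dual_bracket s j (i + k) B (dual_bracket r i k A f)"
proof -
  have ij: "0 < i + j"
    using i by simp
  have rs: "r \<otimes>\<^bsub>R\<^esub> s \<in> carrier R"
    using r s by simp
  have ab: "lower_bracket G i j A B \<in> carrier (lower_quotient G (i + j))"
    by (rule biadditive_closed [OF lower_bracket_biadditive [OF i] A B])
  have sums: "i + (j + k) = i + j + k" "j + (i + k) = i + j + k"
    by simp_all
  have 1: "dual_bracket r i (j + k) A (dual_bracket s j k B f) \<in> carrier H"
    using dual_bracket_closed [OF i r A dual_bracket_closed [OF j s B f]] by (simp add: H_def sums)
  have 2: "dual_bracket s j (i + k) B (dual_bracket r i k A f) \<in> carrier H"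
    using dual_bracket_closed [OF j s B dual_bracket_closed [OF i r A f]] by (simp add: H_def sums)
  show ?thesis
    unfolding H_def
  proof (rule upper_hom_eqI)
    show "dual_bracket (r \<otimes>\<^bsub>R\<^esub> s) (i + j) k (lower_bracket G i j A B) f
        \<in> carrier (upper_hom G Q (i + j + k))"
      by (rule dual_bracket_closed [OF ij rs ab f])
    show "dual_bracket r i (j + k) A (dual_bracket s j k B f) \<otimes>\<^bsub>upper_hom G Q (i + j + k)\<^esub>
        inv\<^bsub>upper_hom G Q (i + j + k)\<^esub> dual_bracket s j (i + k) B (dual_bracket r i k A f)
        \<in> carrier (upper_hom G Q (i + j + k))"
      using 1 2 group.inv_closed [OF upper_hom_group] unfolding H_def
      by (intro upper_hom_mult_closed)
    fix C assume C: "C \<in> carrier (upper_quotient G (i + j + k))"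
    have bc: "upper_bracket j (i + j + k) B C \<in> carrier (upper_quotient G (i + k))"
      using upper_bracket_closed [OF j B, of C "i + k"] C by (simp add: sums)
    have ac: "upper_bracket i (i + j + k) A C \<in> carrier (upper_quotient G (j + k))"
      using upper_bracket_closed [OF i A, of C "j + k"] C by (simp add: sums)
    let ?a_bc = "upper_bracket i (i + k) A (upper_bracket j (i + j + k) B C)"
    let ?b_ac = "upper_bracket j (j + k) B (upper_bracket i (i + j + k) A C)"
    have a_bc: "?a_bc \<in> carrier (upper_quotient G k)" and b_ac: "?b_ac \<in> carrier (upper_quotient G k)"
      using upper_bracket_closed [OF i A bc] upper_bracket_closed [OF j B ac] by simp_all
    have inv_b_ac: "inv\<^bsub>upper_quotient G k\<^esub> ?b_ac \<in> carrier (upper_quotient G k)"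
      using b_ac by (rule group.inv_closed [OF upper_quotient_group])
    have f_closed: "f ?a_bc \<in> carrier Q" "f ?b_ac \<in> carrier Q"
      using f a_bc b_ac by (simp_all add: upper_hom_closed)
    interpret f: group_hom "upper_quotient G k" "add_monoid Q" f
      using f upper_quotient_group Q.a_group
      by (simp add: group_hom_def group_hom_axioms_def upper_hom_def hom_group_simps)
    have f_inv: "f (inv\<^bsub>upper_quotient G k\<^esub> ?b_ac) = \<ominus>\<^bsub>Q\<^esub> f ?b_ac"
      using f.hom_inv [OF b_ac] by (simp add: a_inv_def)
    have "dual_bracket (r \<otimes>\<^bsub>R\<^esub> s) (i + j) k (lower_bracket G i j A B) f C
        = \<ominus>\<^bsub>Q\<^esub> ((r \<otimes>\<^bsub>R\<^esub> s) \<odot>\<^bsub>Q\<^esub> (f ?a_bc \<oplus>\<^bsub>Q\<^esub> \<ominus>\<^bsub>Q\<^esub> f ?b_ac))"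
      using C upper_bracket_jacobi [OF i j A B C] f a_bc inv_b_ac
      by (simp add: dual_bracket_apply upper_hom_mult f_inv)
    also have "\<dots> = (r \<otimes>\<^bsub>R\<^esub> s) \<odot>\<^bsub>Q\<^esub> f ?b_ac \<oplus>\<^bsub>Q\<^esub> \<ominus>\<^bsub>Q\<^esub> ((r \<otimes>\<^bsub>R\<^esub> s) \<odot>\<^bsub>Q\<^esub> f ?a_bc)"
      using rs f_closed by (simp add: Q.smult_r_distr Q.smult_r_minus Q.minus_add Q.a_comm)
    also have "(r \<otimes>\<^bsub>R\<^esub> s) \<odot>\<^bsub>Q\<^esub> f ?b_ac
        = dual_bracket r i (j + k) A (dual_bracket s j k B f) C"
      using C r s f_closed ac
      by (simp add: dual_bracket_apply sums Q.smult_r_minus Q.smult_assoc1)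
    also have "(r \<otimes>\<^bsub>R\<^esub> s) \<odot>\<^bsub>Q\<^esub> f ?a_bc
        = dual_bracket s j (i + k) B (dual_bracket r i k A f) C"
      using C r s f_closed bc
      by (simp add: dual_bracket_apply sums Q.smult_r_minus Q.m_comm [of r s] Q.smult_assoc1)
    also have "dual_bracket r i (j + k) A (dual_bracket s j k B f) C
        \<oplus>\<^bsub>Q\<^esub> \<ominus>\<^bsub>Q\<^esub> dual_bracket s j (i + k) B (dual_bracket r i k A f) C
      = (dual_bracket r i (j + k) A (dual_bracket s j k B f) \<otimes>\<^bsub>upper_hom G Q (i + j + k)\<^esub>
        inv\<^bsub>upper_hom G Q (i + j + k)\<^esub> dual_bracket s j (i + k) B (dual_bracket r i k A f)) C"
      using C 2 by (simp add: upper_hom_mult_apply upper_hom_inv_apply H_def)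
    finally show "dual_bracket (r \<otimes>\<^bsub>R\<^esub> s) (i + j) k (lower_bracket G i j A B) f C
      = (dual_bracket r i (j + k) A (dual_bracket s j k B f) \<otimes>\<^bsub>upper_hom G Q (i + j + k)\<^esub>
        inv\<^bsub>upper_hom G Q (i + j + k)\<^esub> dual_bracket s j (i + k) B (dual_bracket r i k A f)) C" .
  qed
qed

end

section \<open>The module structure\<close>

lemma biadditive_action_iff:
  "biadditive_action L V act \<longleftrightarrow> biadditive (add_monoid L) (add_monoid V) (add_monoid V) act"
  by (simp add: biadditive_action_def biadditive_def)

lemma
  assumes "biadditive_action L V act"
  shows action_closed: "\<lbrakk>a \<in> carrier L; v \<in> carrier V\<rbrakk> \<Longrightarrow> act a v \<in> carrier V"
    and action_add_left: "\<lbrakk>a \<in> carrier L; b \<in> carrier L; v \<in> carrier V\<rbrakk>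
      \<Longrightarrow> act (a \<oplus>\<^bsub>L\<^esub> b) v = act a v \<oplus>\<^bsub>V\<^esub> act b v"
    and action_add_right: "\<lbrakk>a \<in> carrier L; v \<in> carrier V; w \<in> carrier V\<rbrakk>
      \<Longrightarrow> act a (v \<oplus>\<^bsub>V\<^esub> w) = act a v \<oplus>\<^bsub>V\<^esub> act a w"
  using assms by (auto simp: biadditive_action_def)

text \<open>All identities between actions reduce to generators by this lemma. It is also applied to
  biadditive maps such as \<open>\<lambda>b. act (a \<otimes> b)\<close>.\<close>

lemma actions_eq_on_generators:
  assumes act: "biadditive_action L V act" and act': "biadditive_action L V act'"
    and S: "sum_generated L S" and U: "sum_generated V U"
    and eq: "\<And>a v. \<lbrakk>a \<in> S; v \<in> U\<rbrakk> \<Longrightarrow> act a v = act' a v"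
    and a: "a \<in> carrier L" and v: "v \<in> carrier V"
  shows "act a v = act' a v"
proof -
  have gen: "act b v = act' b v" if b: "b \<in> S" for b
    using U v
  proof (induction rule: sum_generated_induct)
    case (generator v)
    then show ?case
      using b eq by blast
  next
    case (add v w)
    then show ?case
      using sum_generated_subset [OF S b] by (simp add: action_add_right [OF act] action_add_right [OF act'])
  qed
  from S a show ?thesis
  proof (induction rule: sum_generated_induct)
    case (generator a)
    then show ?case
      by (rule gen)
  next
    case (add a b)
    then show ?case
      using v by (simp add: action_add_left [OF act] action_add_left [OF act'])
  qed
qed

context central_series_duality
begin

abbreviation Lie where "Lie \<equiv> lower_lie_ring G"
abbreviation L where "L \<equiv> lower_lie_tensor G R"
abbreviation lie_gen where "lie_gen i A r \<equiv> pure_tensor Lie R (homogeneous (lower_quotient G) i A) r"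
abbreviation dual_gen where "dual_gen \<equiv> homogeneous (upper_hom G Q)"

sublocale Lie: graded_lie_ring Lie lower_component
  by (rule lower_graded_lie_ring)

sublocale LT: lie_tensor Lie R
  by (intro lie_tensor.intro Lie.lie_ring_axioms Q.is_cring)

lemma L_graded: "graded_lie_ring L (lower_lie_tensor_component G R)"
proof -
  have "lower_lie_tensor_component G R
      = (\<lambda>i. generate (add_monoid L) {pure_tensor Lie R a r | a r. a \<in> lower_component i \<and> r \<in> carrier R})"
    unfolding lower_lie_tensor_component_def lower_component_def
    by (intro ext arg_cong [of _ _ "generate (add_monoid L)"]) auto
  then show ?thesis
    using graded_lie_ring_tensor [OF lower_graded_lie_ring Q.is_cring] by (simp add: lower_lie_tensor_def)
qed

lemma homogeneous_in_Lie:
  "\<lbrakk>0 < i; A \<in> carrier (lower_quotient G i)\<rbrakk> \<Longrightarrow> homogeneous (lower_quotient G) i A \<in> carrier Lie"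
  using Lie.component_carrier by (auto simp: lower_component_def)

lemma dual_gen_closed: "\<lbrakk>0 < j; f \<in> carrier (upper_hom G Q j)\<rbrakk> \<Longrightarrow> dual_gen j f \<in> carrier V"
  using V.component_carrier by (auto simp: upper_dual_component_def)

lemma L_generated:
  "sum_generated L {lie_gen i A r | i A r. 0 < i \<and> A \<in> carrier (lower_quotient G i) \<and> r \<in> carrier R}"
proof (rule sum_generatedI)
  fix P x assume x: "x \<in> carrier L"
    and gen: "\<And>a. a \<in> {lie_gen i A r | i A r. 0 < i \<and> A \<in> carrier (lower_quotient G i) \<and> r \<in> carrier R}
      \<Longrightarrow> P a"
    and P_add: "\<And>x y. \<lbrakk>x \<in> carrier L; y \<in> carrier L; P x; P y\<rbrakk> \<Longrightarrow> P (x \<oplus>\<^bsub>L\<^esub> y)"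
  have pure: "P (pure_tensor Lie R a r)" if a: "a \<in> carrier Lie" and r: "r \<in> carrier R" for a r
    using a
  proof (induction rule: Lie.graded_induct)
    case (homogeneous i a)
    then show ?case
      using r by (intro gen) (auto simp: lower_component_def)
  next
    case (add x y)
    then show ?case
      using r P_add LT.pure_TL_closed
      by (simp add: LT.pure_add_left lower_lie_tensor_def)
  qed
  from LT.TL_sum_generated x [unfolded lower_lie_tensor_def] show "P x"
  proof (induction rule: sum_generated_induct)
    case (generator a)
    then show ?case
      using pure by blast
  next
    case (add x y)
    then show ?case
      using P_add
      by (simp add: lower_lie_tensor_def)
  qed
qed (auto simp: lower_lie_tensor_def intro!: LT.pure_TL_closed homogeneous_in_Lie)

lemma V_generated: "sum_generated V {dual_gen j f | j f. 0 < j \<and> f \<in> carrier (upper_hom G Q j)}"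
proof -
  have "{dual_gen j f | j f. 0 < j \<and> f \<in> carrier (upper_hom G Q j)}
      = (\<Union>i\<in>{0<..}. upper_dual_component G Q i)"
    by (auto simp: upper_dual_component_def)
  then show ?thesis
    using V.sum_generated_homogeneous by simp
qed

text \<open>Naturality on representatives is naturality on classes, with the explicit value of the action.\<close>

lemma natural_iff:
  "natural_on_generators G R Q act \<longleftrightarrow>
    (\<forall>i>0. \<forall>j>0. \<forall>A\<in>carrier (lower_quotient G i). \<forall>r\<in>carrier R. \<forall>f\<in>carrier (upper_hom G Q j).
      act (lie_gen i A r) (dual_gen j f) = dual_gen (i + j) (dual_bracket r i j A f))"
proof (intro iffI allI impI ballI)
  fix i j :: nat and A r f
  assume nat: "natural_on_generators G R Q act" and i: "0 < i" and j: "0 < j"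
    and A: "A \<in> carrier (lower_quotient G i)" and r: "r \<in> carrier R"
    and f: "f \<in> carrier (upper_hom G Q j)"
  obtain x where x: "x \<in> lower_central G i" and A_eq: "A = lower_central G (i + 1) #> x"
    using A by (auto simp: lower_quotient_carrier)
  obtain g where g: "g \<in> carrier (upper_hom G Q (i + j))"
    and act: "act (lie_gen i A r) (dual_gen j f) = dual_gen (i + j) g"
    and g_apply: "\<And>y. y \<in> upper_central G (i + j) \<Longrightarrow> g (upper_central G (i + j - 1) #> y)
      = \<ominus>\<^bsub>Q\<^esub> (r \<odot>\<^bsub>Q\<^esub> f (upper_central G (j - 1) #> commutator G x y))"
    using nat i j x r f unfolding natural_on_generators_def A_eq by meson
  have "g = dual_bracket r i j A f"
  proof (rule upper_hom_eqI [OF g dual_bracket_closed [OF i r A f]])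
    fix B assume B: "B \<in> carrier (upper_quotient G (i + j))"
    then obtain y where y: "y \<in> upper_central G (i + j)" and B_eq: "B = upper_central G (i + j - 1) #> y"
      by (auto simp: upper_quotient_carrier)
    show "g B = dual_bracket r i j A f B"
      using B g_apply [OF y] upper_bracket_cosets [OF i x y]
      by (simp add: dual_bracket_apply A_eq B_eq)
  qed
  with act show "act (lie_gen i A r) (dual_gen j f) = dual_gen (i + j) (dual_bracket r i j A f)"
    by simp
next
  assume act: "\<forall>i>0. \<forall>j>0. \<forall>A\<in>carrier (lower_quotient G i). \<forall>r\<in>carrier R. \<forall>f\<in>carrier (upper_hom G Q j).
      act (lie_gen i A r) (dual_gen j f) = dual_gen (i + j) (dual_bracket r i j A f)"
  show "natural_on_generators G R Q act"
    unfolding natural_on_generators_def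
  proof (intro allI impI ballI)
    fix i j :: nat and x r f
    assume i: "0 < i" and j: "0 < j" and x: "x \<in> lower_central G i" and r: "r \<in> carrier R"
      and f: "f \<in> carrier (upper_hom G Q j)"
    let ?A = "lower_central G (i + 1) #> x"
    have A: "?A \<in> carrier (lower_quotient G i)"
      using x by (auto simp: lower_quotient_carrier)
    show "\<exists>g\<in>carrier (upper_hom G Q (i + j)).
        act (lie_gen i ?A r) (dual_gen j f) = dual_gen (i + j) g \<and>
        (\<forall>y\<in>upper_central G (i + j). commutator G x y \<in> upper_central G j \<and>
           g (upper_central G (i + j - 1) #> y)
             = \<ominus>\<^bsub>Q\<^esub> (r \<odot>\<^bsub>Q\<^esub> f (upper_central G (j - 1) #> commutator G x y)))"
    proof (intro bexI conjI ballI)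
      show "act (lie_gen i ?A r) (dual_gen j f) = dual_gen (i + j) (dual_bracket r i j ?A f)"
        using act i j A r f by blast
      show "dual_bracket r i j ?A f \<in> carrier (upper_hom G Q (i + j))"
        by (rule dual_bracket_closed [OF i r A f])
      fix y assume y: "y \<in> upper_central G (i + j)"
      show "commutator G x y \<in> upper_central G j"
        using i x y by (rule lower_upper_commutator)
      have "upper_central G (i + j - 1) #> y \<in> carrier (upper_quotient G (i + j))"
        using y by (auto simp: upper_quotient_carrier)
      then show "dual_bracket r i j ?A f (upper_central G (i + j - 1) #> y)
          = \<ominus>\<^bsub>Q\<^esub> (r \<odot>\<^bsub>Q\<^esub> f (upper_central G (j - 1) #> commutator G x y))"
        using upper_bracket_cosets [OF i x y] by (simp add: dual_bracket_apply)
    qed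
  qed
qed

text \<open>For fixed \<open>v\<close>, the convolution of \<open>a\<close> and \<open>v\<close> by \<open>dual_bracket r\<close> is biadditive in \<open>a\<close> and \<open>r\<close>, and
  thus defines a homomorphism on the tensor product. It is additive in \<open>v\<close>, because it is so on pure
  tensors.\<close>

lemma action_exists:
  "\<exists>act. act \<in> carrier L \<rightarrow>\<^sub>E carrier V \<rightarrow>\<^sub>E carrier V \<and> biadditive_action L V act
    \<and> natural_on_generators G R Q act"
proof -
  define conv where "conv r = convolution (dual_bracket r) (upper_hom G Q)" for r
  have pairing: "graded_pairing (lower_quotient G) (upper_hom G Q) (upper_hom G Q) (dual_bracket r)"
    if "r \<in> carrier R" for r
    using that
    by (intro graded_pairing.intro lower_quotient_comm_group upper_hom_comm_group dual_bracket_biadditive)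
  have conv: "biadditive_action Lie V (conv r)" if "r \<in> carrier R" for r
    using graded_pairing.convolution_biadditive [OF pairing [OF that]]
    by (simp add: biadditive_action_iff biadditive_def conv_def lower_lie_ring_simps upper_dual_simps
        del: mult_sum_group)
  have conv_gen: "conv r (homogeneous (lower_quotient G) i A) (dual_gen j f)
      = dual_gen (i + j) (dual_bracket r i j A f)"
    if "0 < i" "0 < j" "r \<in> carrier R" "A \<in> carrier (lower_quotient G i)" "f \<in> carrier (upper_hom G Q j)"
    for r i j A f
    unfolding conv_def using that by (intro graded_pairing.convolution_homogeneous pairing)
  have conv_add: "conv (r \<oplus>\<^bsub>R\<^esub> s) a v = conv r a v \<oplus>\<^bsub>V\<^esub> conv s a v"
    if r: "r \<in> carrier R" and s: "s \<in> carrier R" and a: "a \<in> carrier Lie" and v: "v \<in> carrier V"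
    for r s a v
  proof -
    have rs: "r \<oplus>\<^bsub>R\<^esub> s \<in> carrier R"
      using r s by simp
    have sum: "biadditive_action Lie V (\<lambda>a v. conv r a v \<oplus>\<^bsub>V\<^esub> conv s a v)"
      using conv [OF r] conv [OF s] by (simp add: biadditive_action_def V.a_ac)
    show ?thesis
    proof (rule actions_eq_on_generators [OF conv [OF rs] sum Lie.sum_generated_homogeneous V_generated _ a v])
      fix b w assume "b \<in> (\<Union>i\<in>{0<..}. lower_component i)"
        and "w \<in> {dual_gen j f | j f. 0 < j \<and> f \<in> carrier (upper_hom G Q j)}"
      then obtain i A j f where "0 < i" "A \<in> carrier (lower_quotient G i)"
        "b = homogeneous (lower_quotient G) i A" "0 < j" "f \<in> carrier (upper_hom G Q j)" "w = dual_gen j f"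
        by (auto simp: lower_component_def)
      then show "conv (r \<oplus>\<^bsub>R\<^esub> s) b w = conv r b w \<oplus>\<^bsub>V\<^esub> conv s b w"
        using r s rs by (simp add: conv_gen dual_bracket_add add_homogeneous dual_bracket_closed)
    qed
  qed
  have "\<exists>h. h \<in> hom (tensor_group Lie R) (add_monoid V) \<and>
      (\<forall>a\<in>carrier Lie. \<forall>r\<in>carrier R. h (pure_tensor Lie R a r) = conv r a v)"
    if v: "v \<in> carrier V" for v
  proof -
    have "biadditive (add_monoid Lie) (add_monoid R) (add_monoid V) (\<lambda>a r. conv r a v)"
      by (rule biadditiveI)
        (use v conv_add action_closed [OF conv] action_add_left [OF conv] in simp_all)
    then show ?thesis
      using LT.tensor_universal [OF V.a_comm_group] by metis
  qed
  then obtain h where h_hom: "\<And>v. v \<in> carrier V \<Longrightarrow> h v \<in> hom (tensor_group Lie R) (add_monoid V)"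
    and h_pure: "\<And>v a r. \<lbrakk>v \<in> carrier V; a \<in> carrier Lie; r \<in> carrier R\<rbrakk>
      \<Longrightarrow> h v (pure_tensor Lie R a r) = conv r a v"
    by metis
  have L_simps: "carrier L = carrier (tensor_group Lie R)" "a \<oplus>\<^bsub>L\<^esub> b = a \<otimes>\<^bsub>tensor_group Lie R\<^esub> b" for a b
    by (simp_all add: lower_lie_tensor_def LT.TL_simps)
  have h_closed: "h v a \<in> carrier V" if "v \<in> carrier V" "a \<in> carrier L" for v a
    using hom_in_carrier [OF h_hom] that by (simp add: L_simps)
  have h_add_left: "h v (a \<oplus>\<^bsub>L\<^esub> b) = h v a \<oplus>\<^bsub>V\<^esub> h v b"
    if "v \<in> carrier V" "a \<in> carrier L" "b \<in> carrier L" for v a b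
    using hom_mult [OF h_hom] that by (simp add: L_simps)
  have h_add_right: "h (v \<oplus>\<^bsub>V\<^esub> w) a = h v a \<oplus>\<^bsub>V\<^esub> h w a"
    if v: "v \<in> carrier V" and w: "w \<in> carrier V" and a: "a \<in> carrier L" for v w a
  proof (rule LT.hom_eq_on_pure_tensors [where g = "h (v \<oplus>\<^bsub>V\<^esub> w)"])
    show "h (v \<oplus>\<^bsub>V\<^esub> w) \<in> hom (tensor_group Lie R) (add_monoid V)"
      using v w by (intro h_hom) simp
    show "(\<lambda>a. h v a \<oplus>\<^bsub>V\<^esub> h w a) \<in> hom (tensor_group Lie R) (add_monoid V)"
      using comm_group.hom_mult_hom [OF V.a_comm_group h_hom [OF v] h_hom [OF w]] by simp
    show "h (v \<oplus>\<^bsub>V\<^esub> w) (pure_tensor Lie R b r) = h v (pure_tensor Lie R b r) \<oplus>\<^bsub>V\<^esub> h w (pure_tensor Lie R b r)"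
      if "b \<in> carrier Lie" "r \<in> carrier R" for b r
      using that v w action_add_right [OF conv] by (simp add: h_pure)
  qed (use a in \<open>simp add: L_simps\<close>)
  define act where "act = (\<lambda>a\<in>carrier L. \<lambda>v\<in>carrier V. h v a)"
  have "act \<in> carrier L \<rightarrow>\<^sub>E carrier V \<rightarrow>\<^sub>E carrier V"
    unfolding act_def using h_closed by auto
  moreover have "biadditive_action L V act"
  proof -
    have "a \<oplus>\<^bsub>L\<^esub> b \<in> carrier L" if "a \<in> carrier L" "b \<in> carrier L" for a b
      using LT.TL.add.m_closed that by (simp add: lower_lie_tensor_def)
    then show ?thesis
      using h_closed h_add_left h_add_right by (simp add: biadditive_action_def act_def)
  qed
  moreover have "natural_on_generators G R Q act"
    unfolding natural_iff
  proof (intro allI impI ballI)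
    fix i j :: nat and A r f
    assume "0 < i" "0 < j" "A \<in> carrier (lower_quotient G i)" "r \<in> carrier R"
      "f \<in> carrier (upper_hom G Q j)"
    moreover from this have "lie_gen i A r \<in> carrier L" "dual_gen j f \<in> carrier V"
      using LT.pure_TL_closed by (simp_all add: lower_lie_tensor_def homogeneous_in_Lie dual_gen_closed)
    ultimately show "act (lie_gen i A r) (dual_gen j f) = dual_gen (i + j) (dual_bracket r i j A f)"
      by (simp add: act_def h_pure conv_gen homogeneous_in_Lie)
  qed
  ultimately show ?thesis
    by blast
qed

lemma action_unique:
  assumes act: "biadditive_action L V act" "natural_on_generators G R Q act"
    and act': "biadditive_action L V act'" "natural_on_generators G R Q act'"
    and a: "a \<in> carrier L" and v: "v \<in> carrier V"
  shows "act a v = act' a v"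
  by (rule actions_eq_on_generators [OF act(1) act'(1) L_generated V_generated _ a v])
    (use act(2) act'(2) in \<open>auto simp: natural_iff\<close>)

lemma action_graded_lie_module:
  assumes act: "biadditive_action L V act" and nat: "natural_on_generators G R Q act"
  shows "graded_lie_module L (lower_lie_tensor_component G R) V (upper_dual_component G Q) act"
proof -
  interpret L: graded_lie_ring L "lower_lie_tensor_component G R"
    by (rule L_graded)
  note closed = action_closed [OF act] and add_left = action_add_left [OF act]
    and add_right = action_add_right [OF act]
  have act_gen: "act (lie_gen i A r) (dual_gen j f) = dual_gen (i + j) (dual_bracket r i j A f)"
    if "0 < i" "0 < j" "A \<in> carrier (lower_quotient G i)" "r \<in> carrier R" "f \<in> carrier (upper_hom G Q j)"
    for i j A r f
    using nat that by (simp add: natural_iff)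
  have gen_closed: "lie_gen i A r \<in> carrier L"
    if "0 < i" "A \<in> carrier (lower_quotient G i)" "r \<in> carrier R" for i A r
    using that LT.pure_TL_closed by (simp add: lower_lie_tensor_def homogeneous_in_Lie)
  have mult_gen: "lie_gen i A r \<otimes>\<^bsub>L\<^esub> lie_gen j B s
      = lie_gen (i + j) (lower_bracket G i j A B) (r \<otimes>\<^bsub>R\<^esub> s)"
    if "0 < i" "A \<in> carrier (lower_quotient G i)" "r \<in> carrier R"
      "0 < j" "B \<in> carrier (lower_quotient G j)" "s \<in> carrier R" for i A r j B s
    using that by (simp add: lower_lie_tensor_def LT.TL_mult_pure homogeneous_in_Lie lower_mult_homogeneous)
  define comm where "comm a b v = act a (act b v) \<ominus>\<^bsub>V\<^esub> act b (act a v)" for a b v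
  have lie_gen_dual_gen: "act (lie_gen i A r \<otimes>\<^bsub>L\<^esub> lie_gen j B s) (dual_gen k f)
      = comm (lie_gen i A r) (lie_gen j B s) (dual_gen k f)"
    if i: "0 < i" and A: "A \<in> carrier (lower_quotient G i)" and r: "r \<in> carrier R"
      and j: "0 < j" and B: "B \<in> carrier (lower_quotient G j)" and s: "s \<in> carrier R"
      and k: "0 < k" and f: "f \<in> carrier (upper_hom G Q k)" for i A r j B s k f
  proof -
    have ij: "0 < i + j + k" "0 < i + j" "0 < i + k" "0 < j + k"
      using i j by simp_all
    have sums: "i + (j + k) = i + j + k" "j + (i + k) = i + j + k"
      by simp_all
    have ab: "lower_bracket G i j A B \<in> carrier (lower_quotient G (i + j))"
      by (rule biadditive_closed [OF lower_bracket_biadditive [OF i] A B])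
    have bf: "dual_bracket s j k B f \<in> carrier (upper_hom G Q (j + k))"
      and af: "dual_bracket r i k A f \<in> carrier (upper_hom G Q (i + k))"
      using i j r s A B f by (auto intro: dual_bracket_closed)
    have abf: "dual_bracket r i (j + k) A (dual_bracket s j k B f) \<in> carrier (upper_hom G Q (i + j + k))"
      using dual_bracket_closed [OF i r A bf] by (simp add: sums)
    have baf: "dual_bracket s j (i + k) B (dual_bracket r i k A f) \<in> carrier (upper_hom G Q (i + j + k))"
      using dual_bracket_closed [OF j s B af] by (simp add: sums)
    have "comm (lie_gen i A r) (lie_gen j B s) (dual_gen k f)
        = dual_gen (i + j + k) (dual_bracket r i (j + k) A (dual_bracket s j k B f))
          \<ominus>\<^bsub>V\<^esub> dual_gen (i + j + k) (dual_bracket s j (i + k) B (dual_bracket r i k A f))"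
      using i j k r s A B f af bf ij by (simp add: comm_def act_gen sums)
    also have "\<dots> = dual_gen (i + j + k) (dual_bracket (r \<otimes>\<^bsub>R\<^esub> s) (i + j) k (lower_bracket G i j A B) f)"
      unfolding dual_bracket_jacobi [OF i j r s A B f] V.minus_eq
      using ij abf baf group.inv_closed [OF upper_hom_group baf]
      by (simp add: minus_homogeneous add_homogeneous)
    also have "\<dots> = act (lie_gen i A r \<otimes>\<^bsub>L\<^esub> lie_gen j B s) (dual_gen k f)"
      using i j k r s A B f ab ij by (simp add: mult_gen act_gen)
    finally show ?thesis ..
  qed
  \<comment> \<open>Both sides of the module axiom are additive in each of the three arguments.\<close>
  have comm_add: "comm (a \<oplus>\<^bsub>L\<^esub> a') b v = comm a b v \<oplus>\<^bsub>V\<^esub> comm a' b v"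
      "comm b (a \<oplus>\<^bsub>L\<^esub> a') v = comm b a v \<oplus>\<^bsub>V\<^esub> comm b a' v"
    if "a \<in> carrier L" "a' \<in> carrier L" "b \<in> carrier L" "v \<in> carrier V" for a a' b v
    using that by (simp_all add: comm_def closed add_left add_right V.minus_eq V.minus_add V.a_ac)
  have comm_act: "biadditive_action L V (comm a)" if a: "a \<in> carrier L" for a
    using a by (auto simp: biadditive_action_def comm_add)
      (simp_all add: comm_def closed add_left add_right V.minus_eq V.minus_add V.a_ac)
  have mult_act: "biadditive_action L V (\<lambda>b. act (a \<otimes>\<^bsub>L\<^esub> b))" if a: "a \<in> carrier L" for a
    using a by (simp add: biadditive_action_def closed add_left add_right L.lie_closed L.lie_r_distr)
  have act_lie: "act (a \<otimes>\<^bsub>L\<^esub> b) v = comm a b v"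
    if a: "a \<in> carrier L" and b: "b \<in> carrier L" and v: "v \<in> carrier V" for a b v
    using L_generated a
  proof (induction rule: sum_generated_induct)
    case (generator a)
    show ?case
      by (rule actions_eq_on_generators [OF mult_act comm_act L_generated V_generated _ b v])
        (use generator gen_closed lie_gen_dual_gen in auto)
  next
    case (add a a')
    then show ?case
      using b v by (simp add: L.lie_l_distr add_left L.lie_closed comm_add)
  qed
  \<comment> \<open>The component is generated by pure tensors, so that these need only be found in the subgroup
    that is the preimage of the target component.\<close>
  have act_degree: "act x v \<in> upper_dual_component G Q (i + j)"
    if i: "0 < i" and j: "0 < j" and x: "x \<in> lower_lie_tensor_component G R i"
      and v: "v \<in> upper_dual_component G Q j" for i j x v
  proof -
    obtain f where f: "f \<in> carrier (upper_hom G Q j)" and v_eq: "v = dual_gen j f"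
      using v by (auto simp: upper_dual_component_def)
    have vV: "v \<in> carrier V"
      using j f by (simp add: v_eq dual_gen_closed)
    interpret act: group_hom "add_monoid L" "add_monoid V" "\<lambda>x. act x v"
      using vV L.a_group V.a_group closed add_left
      by (simp add: group_hom_def group_hom_axioms_def hom_def)
    have K: "subgroup (upper_dual_component G Q (i + j)) (add_monoid V)"
      using i by (intro additive_subgroup.a_subgroup V.component_subgroup) simp
    have "subgroup {x \<in> carrier L. act x v \<in> upper_dual_component G Q (i + j)} (add_monoid L)"
    proof (rule subgroup.intro)
      show "inv\<^bsub>add_monoid L\<^esub> x \<in> {x \<in> carrier L. act x v \<in> upper_dual_component G Q (i + j)}"
        if "x \<in> {x \<in> carrier L. act x v \<in> upper_dual_component G Q (i + j)}" for x
        using that act.hom_inv [of x] group.inv_closed [OF L.a_group, of x]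
          subgroup.m_inv_closed [OF K, of "act x v"] by simp
    qed (use vV add_left subgroup.m_closed [OF K] subgroup.one_closed [OF K] act.hom_one in auto)
    moreover have "{lie_gen i A r | A r. A \<in> carrier (lower_quotient G i) \<and> r \<in> carrier R}
        \<subseteq> {x \<in> carrier L. act x v \<in> upper_dual_component G Q (i + j)}"
      using i j f gen_closed act_gen dual_bracket_closed
      by (auto simp: v_eq upper_dual_component_def)
    ultimately have "lower_lie_tensor_component G R i
        \<subseteq> {x \<in> carrier L. act x v \<in> upper_dual_component G Q (i + j)}"
      unfolding lower_lie_tensor_component_def by (intro L.add.generate_subgroup_incl)
    with x show ?thesis
      by blast
  qed
  show ?thesis
    by (intro graded_lie_module.intro graded_lie_module_axioms.intro L_graded upper_graded_abelian_group
        act act_lie [unfolded comm_def] act_degree)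
qed

lemma action_bilinear:
  assumes act: "biadditive_action L V act" and nat: "natural_on_generators G R Q act"
  shows "bilinear_action R L V act"
proof -
  note closed = action_closed [OF act] and add_left = action_add_left [OF act]
    and add_right = action_add_right [OF act]
  interpret LM: module R L
    unfolding lower_lie_tensor_def by (rule LT.TL_module)
  interpret VM: module R V
    by (rule V_module)
  have act_gen: "act (lie_gen i A r) (dual_gen j f) = dual_gen (i + j) (dual_bracket r i j A f)"
    if "0 < i" "0 < j" "A \<in> carrier (lower_quotient G i)" "r \<in> carrier R" "f \<in> carrier (upper_hom G Q j)"
    for i j A r f
    using nat that by (simp add: natural_iff)
  have smult_gen: "r \<odot>\<^bsub>L\<^esub> lie_gen i A s = lie_gen i A (r \<otimes>\<^bsub>R\<^esub> s)"
    if "r \<in> carrier R" "0 < i" "A \<in> carrier (lower_quotient G i)" "s \<in> carrier R" for r i A s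
    using that by (simp add: lower_lie_tensor_def LT.smult_hom(2) homogeneous_in_Lie)
  have scaled: "biadditive_action L V (\<lambda>a v. r \<odot>\<^bsub>V\<^esub> act a v)" if "r \<in> carrier R" for r
    using that by (simp add: biadditive_action_def closed add_left add_right VM.smult_r_distr)
  have left: "act (r \<odot>\<^bsub>L\<^esub> a) v = r \<odot>\<^bsub>V\<^esub> act a v"
    if r: "r \<in> carrier R" and a: "a \<in> carrier L" and v: "v \<in> carrier V" for r a v
  proof (rule actions_eq_on_generators [where act = "\<lambda>a. act (r \<odot>\<^bsub>L\<^esub> a)", OF _ scaled [OF r] L_generated V_generated _ a v])
    show "biadditive_action L V (\<lambda>a. act (r \<odot>\<^bsub>L\<^esub> a))"
      using r by (simp add: biadditive_action_def closed add_left add_right LM.smult_r_distr)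
  qed (use r in \<open>auto simp: smult_gen act_gen smult_homogeneous dual_bracket_mult_left\<close>)
  have right: "act a (r \<odot>\<^bsub>V\<^esub> v) = r \<odot>\<^bsub>V\<^esub> act a v"
    if r: "r \<in> carrier R" and a: "a \<in> carrier L" and v: "v \<in> carrier V" for r a v
  proof (rule actions_eq_on_generators [where act = "\<lambda>a v. act a (r \<odot>\<^bsub>V\<^esub> v)", OF _ scaled [OF r] L_generated V_generated _ a v])
    show "biadditive_action L V (\<lambda>a v. act a (r \<odot>\<^bsub>V\<^esub> v))"
      using r by (simp add: biadditive_action_def closed add_left add_right VM.smult_r_distr)
  qed (use r in \<open>auto simp: act_gen smult_homogeneous dual_bracket_scale scale_closed\<close>)
  show ?thesis
    using act left right LM.module_axioms VM.module_axioms by (simp add: bilinear_action_def)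
qed

end

theorem theorem1:
  fixes G :: "('a, 'b) monoid_scheme"
    and R :: "('r, 'd) ring_scheme"
    and Q :: "('r, 'q, 'm) module_scheme"
  assumes "group G" and "cring R" and "module R Q"
  defines "L \<equiv> lower_lie_tensor G R" and "V \<equiv> upper_dual G Q"
  shows "(\<exists>!act. act \<in> carrier L \<rightarrow>\<^sub>E carrier V \<rightarrow>\<^sub>E carrier V \<and>
            biadditive_action L V act \<and> natural_on_generators G R Q act) \<and>
         (\<forall>act. biadditive_action L V act \<and> natural_on_generators G R Q act \<longrightarrow>
            graded_lie_module L (lower_lie_tensor_component G R) V (upper_dual_component G Q) act \<and>
            bilinear_action R L V act)"
proof -
  interpret D: central_series_duality G R Q
    using assms(1,3) by (rule central_series_duality.intro)
  let ?P = "\<lambda>act. act \<in> carrier D.L \<rightarrow>\<^sub>E carrier D.V \<rightarrow>\<^sub>E carrier D.V \<and>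
    biadditive_action D.L D.V act \<and> natural_on_generators G R Q act"
  have "act = act'" if act: "?P act" and act': "?P act'" for act act'
  proof (rule PiE_ext)
    show "act \<in> carrier D.L \<rightarrow>\<^sub>E carrier D.V \<rightarrow>\<^sub>E carrier D.V"
      "act' \<in> carrier D.L \<rightarrow>\<^sub>E carrier D.V \<rightarrow>\<^sub>E carrier D.V"
      using act act' by blast+
    fix a assume a: "a \<in> carrier D.L"
    show "act a = act' a"
    proof (rule PiE_ext)
      show "act a \<in> carrier D.V \<rightarrow>\<^sub>E carrier D.V" "act' a \<in> carrier D.V \<rightarrow>\<^sub>E carrier D.V"
        using act act' a by (blast intro: PiE_mem)+
      show "act a v = act' a v" if "v \<in> carrier D.V" for v
        using act act' a that by (intro D.action_unique) auto
    qed
  qed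
  then have "\<exists>!act. ?P act"
    using D.action_exists by (intro ex_ex1I) simp_all
  then show ?thesis
    unfolding L_def V_def using D.action_graded_lie_module D.action_bilinear by blast
qed

end
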